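(* Fix real numbers $d>4$ and $\epsilon>0$. Let $G$ be a finite group of order $n$, let $S$ be a random sequence of density $d$ in $G$ (that is, of length $k=d\log_2 n$, with entries drawn independently and uniformly from $G$), and let the hash functions $\eta:G\to\mathcal{C}$ used by the Pollard-$\rho$ short product algorithm described in the context be random oracles. Then the Pollard-$\rho$ algorithm can be implemented so that, for almost all $S$ (that is, with probability over the choice of $S$ tending to $1$ as $n\to\infty$) and for every target $z\in\pi(\mathcal{P}(S))$, on input $(S,z)$ it outputs a subsequence of $S$ whose product is $z$ using an expected number $O(\sqrt{n})$ of group operations and storage for $O(n^{\epsilon})$ group elements. Here the expectation is over the random choices made by the algorithm (the elements $w$ and the random oracles $\eta$), and the implied constants depend only on $d$ and $\epsilon$.
   Context: **Computational model.** $G$ is a finite group of order $n$, written multiplicatively, given as a generic (black-box) group: elements have unique identifiers, and multiplication, inversion, and generation of random elements are performed by a black box. Time is the number of group operations (black-box calls, including those used for any precomputation); space is the number of group elements simultaneously stored. Evaluating a hash function is not counted as a group operation and its description is not counted in the storage. Bit-strings of length $O(\log n)$ (in particular, elements of the set $\mathcal{C}$ below) count as $O(1)$ group elements of storage. **Notation.** For a finite sequence $S$ in $G$ of length $k$, its density is $d=k/\log_2 n$ (rounding $k$ to an integer is ignored). $\mathcal{P}(S)$ is the set of all subsequences of $S$, represented by subsets of the index set $\{1,\dots,k\}$ (so there are $2^k$ of them). For a sequence $y=(y_1,\dots,y_m)$ of elements of $G$, $\pi(y)=y_1y_2\cdots y_m\in G$ is its ordered product (the empty product being the identity), and $\mu(y)=(y_m^{-1},\dots,y_1^{-1})$.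 Write $S=AB$ as the concatenation of two sequences $A$ and $B$ of roughly equal length (lengths differing by at most one). Given $z\in G$, put $\mathcal{A}=\mathcal{P}(A)$ and $\mathcal{B}=\{z\mu(y): y\in\mathcal{P}(B)\}$, where $z\mu(y)$ is the sequence $(z,y_m^{-1},\dots,y_1^{-1})$ and the elements of $\mathcal{B}$ are again indexed by $y\in\mathcal{P}(B)$. Let $\mathcal{C}=\mathcal{A}\sqcup\mathcal{B}$ be the disjoint union; $\pi$ is also regarded as a map $\mathcal{C}\to G$. A random oracle $\eta:G\to\mathcal{C}$ is a function drawn uniformly at random from the set of all functions $G\to\mathcal{C}$. For such $\eta$, put $\phi=\eta\circ\pi:\mathcal{C}\to\mathcal{C}$, and let $\phi^{(i)}$ denote its $i$-fold iterate. **Pollard-$\rho$ algorithm.** Input: a finite sequence $S$ in $G$ and a target $z\in\pi(\mathcal{P}(S))$. Output: a subsequence of $S$ whose product is $z$. 1. Pick a random element $w\in\mathcal{C}$ and a hash function $\eta:G\to\mathcal{C}$ (here: a fresh random oracle each time this step is executed). 2. Find the least $i>0$ and $j\ge 0$ such that $\phi^{(i+j)}(w)=\phi^{(j)}(w)$ (using, for example, Floyd's cycle-finding algorithm, which stores only two elements of $\mathcal{C}$ at a time). 3. If $j=0$, return to Step 1. 4. Let $s=\phi^{(i+j-1)}(w)$ and $t=\phi^{(j-1)}(w)$. 5. If $\pi(s)\ne\pi(t)$, return to Step 1. 6. If $s\in\mathcal{A}$ and $t=z\mu(y)\in\mathcal{B}$, output the concatenation $sy$ and terminate. 7. If $t\in\mathcal{A}$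 and $s=z\mu(y)\in\mathcal{B}$, output the concatenation $ty$ and terminate. 8. Return to Step 1. An implementation of this algorithm is free to choose how the product map $\pi$ is evaluated; in particular it may precompute and store group elements (such as partial products of entries of $S$ or of their inverses) before starting and use them in evaluating $\pi$. *)

theory Defs
  imports "HOL-Probability.Probability" "HOL-Algebra.Coset"
begin

section \<open>Subsequences, products and the set on which the algorithm iterates\<close>

definition gprod :: "('a, 'b) monoid_scheme \<Rightarrow> 'a list \<Rightarrow> 'a" where
  "gprod G xs = foldr (\<lambda>x y. x \<otimes>\<^bsub>G\<^esub> y) xs \<one>\<^bsub>G\<^esub>"

definition mu :: "('a, 'b) monoid_scheme \<Rightarrow> 'a list \<Rightarrow> 'a list" where
  "mu G y = rev (map (\<lambda>x. inv\<^bsub>G\<^esub> x) y)"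

text \<open>Subsequences of a sequence \<open>S\<close> are represented by index sets \<open>I\<close>, the subsequence itself
  being \<open>nths S I\<close>. Indices start at 0.\<close>

definition subproducts :: "('a, 'b) monoid_scheme \<Rightarrow> 'a list \<Rightarrow> 'a set" where
  "subproducts G S = {gprod G (nths S I) | I. I \<subseteq> {..<length S}}"

text \<open>\<open>Inl I\<close> stands for the subsequence of \<open>A\<close> given by \<open>I\<close>, and \<open>Inr J\<close> for the sequence
  \<open>z \<mu>(y)\<close> where \<open>y\<close> is the subsequence of \<open>B\<close> given by \<open>J\<close>.\<close>

type_synonym word = "nat set + nat set"

abbreviation half :: "nat \<Rightarrow> nat" where
  "half k \<equiv> k div 2"

definition words :: "nat \<Rightarrow> word set" where
  "words k = Pow {..<half k} <+> Pow {..<k - half k}"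

fun word_seq :: "('a, 'b) monoid_scheme \<Rightarrow> 'a list \<Rightarrow> 'a \<Rightarrow> word \<Rightarrow> 'a list" where
  "word_seq G S z (Inl I) = nths (take (half (length S)) S) I"
| "word_seq G S z (Inr J) = z # mu G (nths (drop (half (length S)) S) J)"

definition word_prod :: "('a, 'b) monoid_scheme \<Rightarrow> 'a list \<Rightarrow> 'a \<Rightarrow> word \<Rightarrow> 'a" where
  "word_prod G S z c = gprod G (word_seq G S z c)"

text \<open>The index set, within \<open>S = A @ B\<close>, of the concatenation of a subsequence of \<open>A\<close> and one
  of \<open>B\<close>.\<close>

definition join_indices :: "nat \<Rightarrow> nat set \<Rightarrow> nat set \<Rightarrow> nat set" where
  "join_indices k I J = I \<union> (\<lambda>j. half k + j) ` J"


section \<open>The Pollard rho algorithm\<close>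

text \<open>One pass through the steps of the algorithm, for the pair \<open>(w, h)\<close> chosen in its first
  step; \<open>None\<close> means that the pass returns to the first step. The numbers \<open>i\<close> (the cycle length)
  and \<open>j\<close> (the tail length) are simultaneously least.\<close>

type_synonym 'a draw = "word \<times> ('a \<Rightarrow> word)"

definition pollard_pass ::
    "('a, 'b) monoid_scheme \<Rightarrow> 'a list \<Rightarrow> 'a \<Rightarrow> 'a draw \<Rightarrow> nat set option" where
  "pollard_pass G S z = (\<lambda>(w, h).
     let \<phi> = h \<circ> word_prod G S z;
         i = (LEAST i. i > 0 \<and> (\<exists>j. (\<phi> ^^ (i + j)) w = (\<phi> ^^ j) w));
         j = (LEAST j. (\<phi> ^^ (i + j)) w = (\<phi> ^^ j) w);
         s = (\<phi> ^^ (i + j - 1)) w;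
         t = (\<phi> ^^ (j - 1)) w
     in if j = 0 then None
        else if word_prod G S z s \<noteq> word_prod G S z t then None
        else (case (s, t) of
                (Inl I, Inr J) \<Rightarrow> Some (join_indices (length S) I J)
              | (Inr J, Inl I) \<Rightarrow> Some (join_indices (length S) I J)
              | _ \<Rightarrow> None))"

definition pollard_outputs ::
    "('a, 'b) monoid_scheme \<Rightarrow> 'a list \<Rightarrow> 'a \<Rightarrow> 'a draw stream \<Rightarrow> nat \<Rightarrow> nat set \<Rightarrow> bool" where
  "pollard_outputs G S z \<omega> m out \<longleftrightarrow>
     m > 0 \<and> pollard_pass G S z (\<omega> !! (m - 1)) = Some out \<and>
     (\<forall>i < m - 1. pollard_pass G S z (\<omega> !! i) = None)"

text \<open>The choices of the successive passes are independent and uniform.\<close>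

definition draw_set :: "('a, 'b) monoid_scheme \<Rightarrow> nat \<Rightarrow> 'a draw set" where
  "draw_set G k = words k \<times> (carrier G \<rightarrow>\<^sub>E words k)"

definition draw_space :: "('a, 'b) monoid_scheme \<Rightarrow> nat \<Rightarrow> 'a draw stream measure" where
  "draw_space G k = stream_space (uniform_count_measure (draw_set G k))"

definition random_sequence :: "('a, 'b) monoid_scheme \<Rightarrow> nat \<Rightarrow> 'a list pmf" where
  "random_sequence G k = replicate_pmf k (pmf_of_set (carrier G))"


section \<open>Generic group machines\<close>

text \<open>A machine has finitely many registers holding group elements and finitely many control
  states. It sees group elements only through equality tests and the hash function; its control
  state is its only other memory, so all bit-strings it remembers are part of the control state.
  The last argument of each instruction determines the next control state.\<close>

datatype instr =
    Mult nat nat nat nat              (* target register, two operand registers *)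
  | Inverse nat nat nat               (* target register, operand register *)
  | Equal nat nat nat nat             (* two registers, state if equal, state if not *)
  | Hash nat "word \<Rightarrow> nat"            (* register to be hashed *)
  | Draw "word \<Rightarrow> nat"                (* new random word and new hash function *)
  | Halt "nat set"                    (* output *)

record machine =
  registers :: nat
  states :: nat
  program :: "nat \<Rightarrow> instr"

fun instr_ok :: "nat \<Rightarrow> nat \<Rightarrow> nat \<Rightarrow> instr \<Rightarrow> bool" where
  "instr_ok k r q (Mult x y y' p) \<longleftrightarrow> x < r \<and> y < r \<and> y' < r \<and> p < q"
| "instr_ok k r q (Inverse x y p) \<longleftrightarrow> x < r \<and> y < r \<and> p < q"
| "instr_ok k r q (Equal x y p p') \<longleftrightarrow> x < r \<and> y < r \<and> p < q \<and> p' < q"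
| "instr_ok k r q (Hash x f) \<longleftrightarrow> x < r \<and> (\<forall>c \<in> words k. f c < q)"
| "instr_ok k r q (Draw f) \<longleftrightarrow> (\<forall>c \<in> words k. f c < q)"
| "instr_ok k r q (Halt out) \<longleftrightarrow> out \<subseteq> {..<k}"

text \<open>The \<open>k\<close> entries of the input sequence and the target are supplied in registers.\<close>

definition well_formed :: "nat \<Rightarrow> machine \<Rightarrow> bool" where
  "well_formed k M \<longleftrightarrow> k < registers M \<and> 0 < states M \<and>
     (\<forall>p < states M. instr_ok k (registers M) (states M) (program M p))"

text \<open>A register is one group element; a bit-string of length \<open>log\<^sub>2 n\<close> counts as one group
  element, and the control state is a bit-string of length \<open>log\<^sub>2 (states M)\<close>.\<close>

definition storage :: "nat \<Rightarrow> machine \<Rightarrow> real" where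
  "storage n M = real (registers M) + log 2 (real (states M)) / log 2 (real n)"

record 'a config =
  control :: nat
  regs :: "nat \<Rightarrow> 'a"
  current :: "'a draw"              (* the most recent draw *)
  future :: "'a draw stream"        (* the draws not yet made *)
  draws :: nat                      (* number of draws made *)
  time :: nat                       (* number of group operations performed *)

definition step :: "('a, 'b) monoid_scheme \<Rightarrow> machine \<Rightarrow> 'a config \<Rightarrow> 'a config" where
  "step G M c = (case program M (control c) of
     Mult x y y' p \<Rightarrow> c\<lparr>control := p, regs := (regs c)(x := regs c y \<otimes>\<^bsub>G\<^esub> regs c y'),
                        time := time c + 1\<rparr>
   | Inverse x y p \<Rightarrow> c\<lparr>control := p, regs := (regs c)(x := inv\<^bsub>G\<^esub> (regs c y)),
                        time := time c + 1\<rparr>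
   | Equal x y p p' \<Rightarrow> c\<lparr>control := (if regs c x = regs c y then p else p')\<rparr>
   | Hash x f \<Rightarrow> c\<lparr>control := f (snd (current c) (regs c x))\<rparr>
   | Draw f \<Rightarrow> c\<lparr>control := f (fst (shd (future c))), current := shd (future c),
                  future := stl (future c), draws := draws c + 1\<rparr>
   | Halt out \<Rightarrow> c)"

text \<open>The value of \<open>current\<close> before the first draw is irrelevant (it does not depend on the
  input).\<close>

definition initial ::
    "('a, 'b) monoid_scheme \<Rightarrow> 'a list \<Rightarrow> 'a \<Rightarrow> 'a draw stream \<Rightarrow> 'a config" where
  "initial G S z \<omega> = \<lparr>control = 0,
     regs = (\<lambda>x. if x < length S then S ! x else if x = length S then z else \<one>\<^bsub>G\<^esub>),
     current = (Inl {}, \<lambda>_. Inl {}), future = \<omega>, draws = 0, time = 0\<rparr>"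

definition run ::
    "('a, 'b) monoid_scheme \<Rightarrow> machine \<Rightarrow> 'a list \<Rightarrow> 'a \<Rightarrow> 'a draw stream \<Rightarrow> nat \<Rightarrow> 'a config" where
  "run G M S z \<omega> t = (step G M ^^ t) (initial G S z \<omega>)"

definition machine_outputs ::
    "('a, 'b) monoid_scheme \<Rightarrow> machine \<Rightarrow> 'a list \<Rightarrow> 'a \<Rightarrow> 'a draw stream \<Rightarrow> nat \<Rightarrow> nat set \<Rightarrow> bool"
  where
  "machine_outputs G M S z \<omega> m out \<longleftrightarrow>
     (\<exists>t. program M (control (run G M S z \<omega> t)) = Halt out \<and> draws (run G M S z \<omega> t) = m)"

definition running_time ::
    "('a, 'b) monoid_scheme \<Rightarrow> machine \<Rightarrow> 'a list \<Rightarrow> 'a \<Rightarrow> 'a draw stream \<Rightarrow> ennreal" where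
  "running_time G M S z \<omega> = (SUP t. of_nat (time (run G M S z \<omega> t)))"

definition expected_time ::
    "('a, 'b) monoid_scheme \<Rightarrow> machine \<Rightarrow> 'a list \<Rightarrow> 'a \<Rightarrow> ennreal" where
  "expected_time G M S z =
     (\<integral>\<^sup>+ \<omega>. running_time G M S z \<omega> \<partial>draw_space G (length S))"


section \<open>Implementations of the algorithm\<close>

text \<open>In each pass the hash function is only evaluated at the elements met by the iteration of
  \<open>\<phi>\<close> from \<open>w\<close>.\<close>

definition hashes_along_walk ::
    "('a, 'b) monoid_scheme \<Rightarrow> machine \<Rightarrow> 'a list \<Rightarrow> 'a \<Rightarrow> 'a draw stream \<Rightarrow> bool" where
  "hashes_along_walk G M S z \<omega> \<longleftrightarrow>
     (\<forall>t x f. let c = run G M S z \<omega> t; (w, h) = current c in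
        program M (control c) = Hash x f \<longrightarrow>
        draws c > 0 \<and>
        (\<exists>i. regs c x = word_prod G S z (((h \<circ> word_prod G S z) ^^ i) w)))"

text \<open>A machine implements the algorithm if, on every valid input and for every sequence of
  random choices, it stops with a given output after a given number of passes exactly when the
  algorithm does.\<close>

definition implements_pollard :: "('a, 'b) monoid_scheme \<Rightarrow> nat \<Rightarrow> machine \<Rightarrow> bool" where
  "implements_pollard G k M \<longleftrightarrow>
     (\<forall>S z \<omega>. length S = k \<and> set S \<subseteq> carrier G \<and> z \<in> subproducts G S \<and>
              \<omega> \<in> streams (draw_set G k) \<longrightarrow>
        hashes_along_walk G M S z \<omega> \<and>
        (\<forall>m out. machine_outputs G M S z \<omega> m out \<longleftrightarrow> pollard_outputs G S z \<omega> m out))"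

definition finds_short_product ::
    "('a, 'b) monoid_scheme \<Rightarrow> machine \<Rightarrow> 'a list \<Rightarrow> 'a \<Rightarrow> bool" where
  "finds_short_product G M S z \<longleftrightarrow>
     (AE \<omega> in draw_space G (length S).
        \<exists>m out. machine_outputs G M S z \<omega> m out \<and> out \<subseteq> {..<length S} \<and> gprod G (nths S out) = z)"

text \<open>\<open>k\<close> is the length of a sequence of density \<open>d\<close>, up to rounding in either direction.\<close>

definition has_density :: "real \<Rightarrow> nat \<Rightarrow> nat \<Rightarrow> bool" where
  "has_density d n k \<longleftrightarrow> \<bar>real k - d * log 2 (real n)\<bar> < 1"

end

theory Submission
  imports Defs
begin

text \<open>For a random sequence of length \<open>m\<close>, let \<open>D(g)\<close> be the number of subsequences with product \<open>g\<close>
  minus \<open>2 ^ m / n\<close>. Prepending a uniform entry \<open>x\<close> turns \<open>D(g)\<close> into \<open>D(g) + D(x\<inverse> g)\<close>, and since \<open>D\<close> sums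
  to zero, this doubles the expectation of the sum of the \<open>D(g)\<^sup>2\<close>, which is therefore at most \<open>2 ^ m\<close>.
  With \<open>m\<close> about \<open>(d / 2) log\<^sub>2 n\<close> and \<open>d > 4\<close>, Markov's inequality shows that, with probability tending to 1, all
  fibres of \<open>\<pi>\<close> on both halves have the expected size up to a factor of two.

  For such a sequence and every target, the next product of the walk hits each of the earlier
  products with probability of order \<open>1 / n\<close>, and the two colliding words lie on different sides with
  a proportion bounded below. So a pass takes \<open>O(\<surd>n)\<close> steps on average and succeeds with
  probability at least \<open>1 / 12\<close>, and the passes are independent.

  The machine splits the \<open>k\<close> indices into a constant number \<open>r\<close> of blocks and tabulates the
  \<open>O(n powr \<epsilon>)\<close> products of subsequences of single blocks, so that \<open>\<pi>\<close> takes \<open>r + 2\<close> operations. Floyd's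
  method finds the cycle; the words it needs are kept in the control state.\<close>


section \<open>Orbits of a self-map\<close>

text \<open>The condition \<open>d > 4\<close> comes from the second moment. Balance is demanded at
  all group elements simultaneously, so Markov is applied to the whole sum of squares, and a half of
  length m fails with probability at most 4 n^2 / 2^m. For m close to (d / 2) log n this is of order
  n powr (2 - d / 2). This uniformity lets one event serve all targets: a target z only permutes the
  fibres of the second half, by g \<mapsto> inv g * z. The other obstacle is that the walk is
  adaptive, the word hashed next depending on all earlier hash values. A pass has finitely many
  possible draws, so conditioning is replaced by counting draws, with the hash value not yet read
  playing the part of a free word. Implementing the algorithm is a statement about every stream of
  draws. The machine is therefore analysed deterministically, by an invariant that counts all steps
  and not only group operations; this count gives termination and the time bound together.
  Probability enters only through the lengths and outcomes of single passes.\<close>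

definition cycle_length :: "('w \<Rightarrow> 'w) \<Rightarrow> 'w \<Rightarrow> nat" where
  "cycle_length f w = (LEAST i. i > 0 \<and> (\<exists>j. (f ^^ (i + j)) w = (f ^^ j) w))"

definition tail_length :: "('w \<Rightarrow> 'w) \<Rightarrow> 'w \<Rightarrow> nat" where
  "tail_length f w = (LEAST j. (f ^^ (cycle_length f w + j)) w = (f ^^ j) w)"

text \<open>For an orbit that repeats, this is the index of the first repetition, hence the number
  of distinct points met.\<close>

definition rho_length :: "('w \<Rightarrow> 'w) \<Rightarrow> 'w \<Rightarrow> nat" where
  "rho_length f w = cycle_length f w + tail_length f w"

lemma orbit_shift:
  fixes f :: "'w \<Rightarrow> 'w"
  assumes "(f ^^ a) w = (f ^^ b) w"
  shows "(f ^^ (a + c)) w = (f ^^ (b + c)) w"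
proof -
  have "(f ^^ (m + c)) w = (f ^^ c) ((f ^^ m) w)" for m
    by (subst add.commute) (simp only: funpow_add comp_apply)
  thus ?thesis using assms by simp
qed

locale periodic_orbit =
  fixes f :: "'w \<Rightarrow> 'w" and w :: 'w
  assumes repeats: "\<exists>a b. a < b \<and> (f ^^ a) w = (f ^^ b) w"
begin

abbreviation "orb m \<equiv> (f ^^ m) w"
abbreviation "cyc \<equiv> cycle_length f w"
abbreviation "tl_len \<equiv> tail_length f w"

lemma cycle_props: "cyc > 0" "orb (cyc + tl_len) = orb tl_len"
proof -
  obtain a b where ab: "a < b" "orb a = orb b" using repeats by blast
  hence "b - a > 0 \<and> (\<exists>j. orb (b - a + j) = orb j)" by (intro conjI exI[of _ a]) auto
  hence *: "cyc > 0 \<and> (\<exists>j. orb (cyc + j) = orb j)"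
    unfolding cycle_length_def by (rule LeastI)
  thus "cyc > 0" by blast
  from * obtain j where "orb (cyc + j) = orb j" by blast
  thus "orb (cyc + tl_len) = orb tl_len" unfolding tail_length_def by (rule LeastI)
qed

lemma orb_cyc:
  assumes "tl_len \<le> l"
  shows "orb (cyc + l) = orb l"
proof -
  have "cyc + tl_len + (l - tl_len) = cyc + l" "tl_len + (l - tl_len) = l" using assms by auto
  thus ?thesis using orbit_shift[OF cycle_props(2), of "l - tl_len"] by (simp only:)
qed

lemma orb_cyc_mult: "tl_len \<le> l \<Longrightarrow> orb (N * cyc + l) = orb l"
proof (induction N)
  case (Suc N)
  have "orb (Suc N * cyc + l) = orb (cyc + (N * cyc + l))" by (simp add: algebra_simps)
  also have "\<dots> = orb (N * cyc + l)" using Suc.prems by (intro orb_cyc) simp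
  finally show ?case using Suc by simp
qed simp

text \<open>A repetition at \<open>a < b\<close> can be iterated until it reaches an index beyond
  the tail. There a shift by the cycle length changes nothing, and carrying this back to
  \<open>a\<close> bounds the tail by \<open>a\<close>.\<close>

lemma orb_eqD:
  assumes "a < b" "orb a = orb b"
  shows "tl_len \<le> a" "rho_length f w \<le> b"
proof -
  have rep: "orb (a + N * (b - a)) = orb a" for N
  proof (induction N)
    case (Suc N)
    have "a + Suc N * (b - a) = b + N * (b - a)" using assms by simp
    hence "orb (a + Suc N * (b - a)) = orb (b + N * (b - a))" by (simp only:)
    also have "\<dots> = orb (a + N * (b - a))" using orbit_shift[OF assms(2)] by simp
    finally show ?case using Suc by simp
  qed simp
  let ?c = "a + tl_len * (b - a)"
  have "tl_len * 1 \<le> tl_len * (b - a)" using assms by (intro mult_left_mono) auto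
  hence c: "tl_len \<le> ?c" by linarith
  have "orb (cyc + a) = orb (?c + cyc)" using orbit_shift[OF rep[of tl_len], of cyc] by (simp add: add.commute)
  also have "\<dots> = orb ?c" using orb_cyc[OF c] by (simp add: add.commute)
  also have "\<dots> = orb a" by (rule rep)
  finally show 1: "tl_len \<le> a" unfolding tail_length_def by (rule Least_le)
  have "b - a > 0 \<and> (\<exists>j. orb (b - a + j) = orb j)"
    using assms by (intro conjI exI[of _ a]) auto
  hence "cyc \<le> b - a" unfolding cycle_length_def by (rule Least_le)
  thus "rho_length f w \<le> b" using 1 assms(1) unfolding rho_length_def by linarith
qed

lemma orb_distinct: "a < b \<Longrightarrow> b < rho_length f w \<Longrightarrow> orb a \<noteq> orb b"
  using orb_eqD(2) by fastforce

text \<open>Identifies both lengths from the first repetition seen, so that a walk whose first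
  collision is known needs no further inspection.\<close>

lemma rho_unique:
  assumes "\<And>a b. a < b \<Longrightarrow> b < m \<Longrightarrow> orb a \<noteq> orb b" "l < m" "orb l = orb m"
  shows "rho_length f w = m" "tl_len = l"
proof -
  have le: "rho_length f w \<le> m" using orb_eqD(2)[OF assms(2,3)] .
  have lt: "tl_len < rho_length f w" unfolding rho_length_def using cycle_props(1) by simp
  have eq: "orb tl_len = orb (rho_length f w)" using cycle_props(2) unfolding rho_length_def by simp
  show 1: "rho_length f w = m" using assms(1)[OF lt] le eq by fastforce
  have "orb tl_len = orb l" using eq 1 assms(3) by simp
  thus "tl_len = l" using assms(1)[of tl_len l] assms(1)[of l tl_len] assms(2) lt 1
    by (metis nat_neq_iff)
qed

text \<open>Tortoise and hare coincide at every positive multiple of the cycle length that is not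
  below the tail length, and one such multiple is at most the sum of the two lengths.\<close>

lemma floyd_bound:
  assumes "\<And>q. 0 < q \<Longrightarrow> q \<le> p \<Longrightarrow> orb q \<noteq> orb (2 * q)"
  shows "p < rho_length f w"
proof (rule ccontr)
  assume "\<not> ?thesis"
  hence p: "rho_length f w \<le> p" by simp
  let ?N = "tl_len div cyc + 1"
  let ?q = "?N * cyc"
  have lo: "tl_len \<le> ?q"
  proof -
    have "tl_len mod cyc < cyc" using cycle_props(1) by simp
    moreover have "tl_len = tl_len div cyc * cyc + tl_len mod cyc"
      by (rule div_mult_mod_eq[symmetric])
    ultimately show ?thesis unfolding add_mult_distrib by linarith
  qed
  have hi: "?q \<le> p"
  proof -
    have "tl_len div cyc * cyc \<le> tl_len" by simp
    thus ?thesis using p unfolding rho_length_def add_mult_distrib by linarith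
  qed
  have "orb (2 * ?q) = orb ?q" using orb_cyc_mult[OF lo, of ?N] by (simp only: mult_2)
  thus False using assms[of ?q] hi cycle_props(1) by simp
qed

text \<open>That \<open>m\<close> is a period beyond the tail follows without a divisibility
  argument: move \<open>l\<close> forward by \<open>m\<close> whole cycles to get past
  \<open>m\<close>, use the meeting equation there, and move back. The second claim finds the
  predecessor of the tail's end on the cycle.\<close>

lemma floyd_meeting:
  assumes "m > 0" "orb m = orb (2 * m)"
  shows "orb p = orb (m + p) \<longleftrightarrow> tl_len \<le> p"
    and "tl_len > 0 \<Longrightarrow> orb (m + (tl_len - 1)) = orb (rho_length f w - 1)"
proof -
  have per: "orb l = orb (m + l)" if l: "tl_len \<le> l" for l
  proof -
    let ?L = "m * cyc + l"
    have "m * 1 \<le> m * cyc" using cycle_props(1) by (intro mult_left_mono) auto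
    hence ml: "m \<le> ?L" by linarith
    have "orb (m + (?L - m)) = orb (2 * m + (?L - m))" by (rule orbit_shift[OF assms(2)])
    hence e: "orb ?L = orb (m + ?L)" using ml by (simp add: mult_2)
    have "orb (m + ?L) = orb (m * cyc + (m + l))" by (simp add: algebra_simps)
    also have "\<dots> = orb (m + l)" using l by (intro orb_cyc_mult) simp
    finally show ?thesis using e orb_cyc_mult[OF l, of m] by simp
  qed
  show "orb p = orb (m + p) \<longleftrightarrow> tl_len \<le> p"
    using per orb_eqD(1)[of p "m + p"] assms(1) by auto
  assume t: "tl_len > 0"
  \<comment> \<open>Both indices are beyond the tail because the cycle length and \<open>m\<close>
    are at least 1, so periods may be added and removed freely.\<close>
  have "orb (rho_length f w - 1) = orb (m + (rho_length f w - 1))"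
    using cycle_props(1) by (intro per) (simp add: rho_length_def)
  also have "\<dots> = orb (cyc + (m + (tl_len - 1)))" using t cycle_props(1)
    by (simp add: rho_length_def algebra_simps)
  also have "\<dots> = orb (m + (tl_len - 1))" using assms(1) by (intro orb_cyc) linarith
  finally show "orb (m + (tl_len - 1)) = orb (rho_length f w - 1)" by simp
qed

end

lemma periodic_orbit_finite:
  fixes f :: "'w \<Rightarrow> 'w"
  assumes "finite C" "w \<in> C" "\<And>c. c \<in> C \<Longrightarrow> f c \<in> C"
  shows "periodic_orbit f w"
proof
  have "(f ^^ a) w \<in> C" for a using assms by (induction a) auto
  hence "finite (range (\<lambda>a. (f ^^ a) w))" 
    by (intro finite_subset[OF _ assms(1)]) auto
  hence "\<not> inj (\<lambda>a. (f ^^ a) w)" using range_inj_infinite by blast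
  then obtain a b where "a \<noteq> b" "(f ^^ a) w = (f ^^ b) w" by (auto simp: inj_on_def)
  hence "a < b \<or> b < a" "(f ^^ b) w = (f ^^ a) w" by auto
  thus "\<exists>a b. a < b \<and> (f ^^ a) w = (f ^^ b) w" using \<open>(f ^^ a) w = (f ^^ b) w\<close> by blast
qed


section \<open>Ordered products of subsequences\<close>

lemma gprod_Nil [simp]: "gprod G [] = \<one>\<^bsub>G\<^esub>"
  and gprod_Cons [simp]: "gprod G (x # xs) = x \<otimes>\<^bsub>G\<^esub> gprod G xs"
  by (simp_all add: gprod_def)

context group
begin

lemma gprod_closed [simp]: "set xs \<subseteq> carrier G \<Longrightarrow> gprod G xs \<in> carrier G"
  by (induction xs) auto

lemma gprod_append:
  "set xs \<subseteq> carrier G \<Longrightarrow> set ys \<subseteq> carrier G \<Longrightarrow> gprod G (xs @ ys) = gprod G xs \<otimes> gprod G ys"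
  by (induction xs) (auto simp: m_assoc)

lemma gprod_mu: "set xs \<subseteq> carrier G \<Longrightarrow> gprod G (mu G xs) = inv (gprod G xs)"
proof (induction xs)
  case (Cons x xs)
  have "gprod G (mu G xs @ [inv x]) = gprod G (mu G xs) \<otimes> gprod G [inv x]"
    using Cons.prems by (intro gprod_append) (auto simp: mu_def)
  thus ?case using Cons by (simp add: mu_def inv_mult_group)
qed (simp add: mu_def)

end

text \<open>The group need not be commutative, so products of index sets may be joined only across a
  threshold.\<close>

lemma nths_Un_split:
  assumes "X \<subseteq> {..<q}" "Y \<subseteq> {q..}"
  shows "nths S (X \<union> Y) = nths S X @ nths S Y"
proof (induction S rule: rev_induct)
  case (snoc x xs)
  show ?case
  proof (cases "length xs \<in> X")
    case True
    hence "length xs < q" using assms by auto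
    hence "length xs \<notin> Y" and "set (nths xs Y) = {}" using assms by (auto simp: set_nths)
    hence "nths xs Y = []" by simp
    with True snoc \<open>length xs \<notin> Y\<close> show ?thesis by (simp add: nths_append)
  qed (use snoc in \<open>auto simp: nths_append\<close>)
qed simp

lemma nths_singleton_index: "nths S {q} = (if q < length S then [S ! q] else [])"
proof (cases "q < length S")
  case True
  have "nths S {q} = nths (drop q S) {0}" by (simp add: nths_drop)
  moreover have "drop q S = S ! q # drop (Suc q) S" using True by (simp add: Cons_nth_drop_Suc)
  ultimately show ?thesis using True by (simp add: nths_Cons)
next
  case False
  hence "set (nths S {q}) = {}" by (auto simp: set_nths)
  thus ?thesis using False by simp
qed

lemma nths_take:
  assumes "I \<subseteq> {..<m}"
  shows "nths (take m S) I = nths S I"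
proof (cases "m \<le> length S")
  case True
  have "nths S I = nths (take m S) I @ nths (drop m S) {j. j + length (take m S) \<in> I}"
    using nths_append[of "take m S" "drop m S" I] by simp
  moreover have "{j. j + length (take m S) \<in> I} = {}" using assms True by fastforce
  ultimately show ?thesis by simp
qed simp


section \<open>Distribution of subsequence products\<close>

context group
begin

definition nsub :: "'a list \<Rightarrow> 'a \<Rightarrow> nat" where
  "nsub S g = card {I. I \<subseteq> {..<length S} \<and> gprod G (nths S I) = g}"

definition discrepancy :: "'a list \<Rightarrow> 'a \<Rightarrow> real" where
  "discrepancy S g = real (nsub S g) - 2 ^ length S / real (order G)"

definition square_discrepancy :: "'a list \<Rightarrow> real" where
  "square_discrepancy S = (\<Sum>g\<in>carrier G. (discrepancy S g)\<^sup>2)"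

text \<open>Asked of every group element and not just of most, because an arbitrary target moves the
  relevant fibres of the second half.\<close>

definition balanced :: "'a list \<Rightarrow> bool" where
  "balanced S \<longleftrightarrow> (\<forall>g\<in>carrier G. 2 ^ length S / (2 * real (order G)) \<le> real (nsub S g) \<and>
                                 real (nsub S g) \<le> 2 * 2 ^ length S / real (order G))"

lemma nsub_Cons:
  assumes "x \<in> carrier G" "set S \<subseteq> carrier G" "g \<in> carrier G"
  shows "nsub (x # S) g = nsub S g + nsub S (inv x \<otimes> g)"
proof -
  let ?T = "\<lambda>g. {I. I \<subseteq> {..<length S} \<and> gprod G (nths S I) = g}"
  have cl: "gprod G (nths S I) \<in> carrier G" for I
    using assms(2) set_nths_subset[of S I] by (intro gprod_closed) blast
  have solve: "x \<otimes> gprod G (nths S I) = g \<longleftrightarrow> gprod G (nths S I) = inv x \<otimes> g" for I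
    using assms cl[of I] by (metis inv_solve_left)
  have fin: "finite (?T h)" for h by (rule finite_subset[of _ "Pow {..<length S}"]) auto
  have eq: "{I. I \<subseteq> {..<length (x # S)} \<and> gprod G (nths (x # S) I) = g} =
      (\<lambda>I. Suc ` I) ` ?T g \<union> (\<lambda>I. insert 0 (Suc ` I)) ` ?T (inv x \<otimes> g)" (is "?L = ?R")
  proof (intro equalityI subsetI)
    fix I assume I: "I \<in> ?L"
    let ?J = "{j. Suc j \<in> I}"
    have J: "?J \<subseteq> {..<length S}" using I by auto
    have split: "I = (if 0 \<in> I then insert 0 (Suc ` ?J) else Suc ` ?J)"
      by (auto simp: image_iff) (metis not0_implies_Suc)+
    have val: "gprod G (nths (x # S) I) = (if 0 \<in> I then x \<otimes> gprod G (nths S ?J) else gprod G (nths S ?J))"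
      by (simp add: nths_Cons)
    show "I \<in> ?R"
    proof (cases "0 \<in> I")
      case True
      hence "?J \<in> ?T (inv x \<otimes> g)" using I val J solve[of ?J] by simp
      thus ?thesis using split True by (metis (no_types, lifting) UnI2 image_eqI)
    next
      case False
      hence "?J \<in> ?T g" using I val J by simp
      thus ?thesis using split False by (metis (no_types, lifting) UnI1 image_eqI)
    qed
  next
    fix I assume "I \<in> ?R"
    thus "I \<in> ?L"
      using solve by (auto simp: nths_Cons inj_image_mem_iff)
  qed
  have "inj_on (\<lambda>I. insert 0 (Suc ` I)) A" for A
    by (rule inj_onI) (metis Diff_insert_absorb inj_Suc inj_image_eq_iff zero_notin_Suc_image)
  moreover have "inj_on ((`) Suc) A" for A
    by (rule inj_onI) (simp add: inj_image_eq_iff)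
  moreover have "(\<lambda>I. Suc ` I) ` ?T g \<inter> (\<lambda>I. insert 0 (Suc ` I)) ` ?T (inv x \<otimes> g) = {}"
    by blast
  ultimately have "card ?R = card (?T g) + card (?T (inv x \<otimes> g))"
    using fin by (simp add: card_Un_disjoint card_image)
  thus ?thesis unfolding nsub_def eq by simp
qed

end

section \<open>Second moment of the discrepancy of a random sequence\<close>

locale finite_group = group +
  assumes finite_carrier: "finite (carrier G)"
begin

lemma order_pos: "real (order G) > 0"
  using finite_carrier one_closed unfolding order_def by (simp add: card_gt_0_iff) blast

lemma sum_nsub:
  assumes "set S \<subseteq> carrier G"
  shows "(\<Sum>g\<in>carrier G. nsub S g) = 2 ^ length S"
proof -
  let ?P = "Pow {..<length S}"
  have cl: "gprod G (nths S I) \<in> carrier G" for I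
    using assms set_nths_subset[of S I] by (intro gprod_closed) blast
  have "(\<Sum>g\<in>carrier G. nsub S g) =
        (\<Sum>g\<in>carrier G. \<Sum>I\<in>{I. I \<in> ?P \<and> gprod G (nths S I) = g}. 1)"
    by (simp add: nsub_def)
  also have "\<dots> = (\<Sum>I\<in>?P. 1)"
    by (rule sum.group) (use finite_carrier cl in auto)
  finally show ?thesis by (simp add: card_Pow)
qed

lemma sum_discrepancy: "set S \<subseteq> carrier G \<Longrightarrow> (\<Sum>g\<in>carrier G. discrepancy S g) = 0"
  using order_pos sum_nsub[of S]
  by (simp add: discrepancy_def sum_subtractf order_def of_nat_sum[symmetric] del: of_nat_sum)

lemma discrepancy_Cons:
  assumes "x \<in> carrier G" "set S \<subseteq> carrier G" "g \<in> carrier G"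
  shows "discrepancy (x # S) g = discrepancy S g + discrepancy S (inv x \<otimes> g)"
  using nsub_Cons[OF assms] by (simp add: discrepancy_def field_simps)

lemma sum_square_discrepancy_Cons:
  assumes "set S \<subseteq> carrier G"
  shows "(\<Sum>x\<in>carrier G. square_discrepancy (x # S)) = 2 * real (order G) * square_discrepancy S"
proof -
  let ?C = "carrier G" and ?D = "discrepancy S"
  have left: "(\<Sum>g\<in>?C. F (inv x \<otimes> g)) = (\<Sum>g\<in>?C. F g)" if "x \<in> ?C" for x and F :: "'a \<Rightarrow> real"
    using that
    by (intro sum.reindex_bij_witness[of _ "\<lambda>g. x \<otimes> g" "\<lambda>g. inv x \<otimes> g"])
       (auto simp: m_assoc[symmetric])
  have right: "(\<Sum>x\<in>?C. F (inv x \<otimes> g)) = (\<Sum>g\<in>?C. F g)" if "g \<in> ?C" for g and F :: "'a \<Rightarrow> real"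
    using that
    by (intro sum.reindex_bij_witness[of _ "\<lambda>h. g \<otimes> inv h" "\<lambda>x. inv x \<otimes> g"])
       (auto simp: inv_mult_group m_assoc[symmetric], auto simp: m_assoc)
  have "(\<Sum>x\<in>?C. square_discrepancy (x # S)) =
        (\<Sum>x\<in>?C. \<Sum>g\<in>?C. (?D g)\<^sup>2 + (?D (inv x \<otimes> g))\<^sup>2 + 2 * (?D g * ?D (inv x \<otimes> g)))"
    unfolding square_discrepancy_def using assms
    by (intro sum.cong refl) (simp add: discrepancy_Cons power2_sum)
  also have "\<dots> = (\<Sum>x\<in>?C. \<Sum>g\<in>?C. (?D g)\<^sup>2) + (\<Sum>x\<in>?C. \<Sum>g\<in>?C. (?D (inv x \<otimes> g))\<^sup>2) +
                  2 * (\<Sum>x\<in>?C. \<Sum>g\<in>?C. ?D g * ?D (inv x \<otimes> g))"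
    by (simp add: sum.distrib sum_distrib_left)
  also have "(\<Sum>x\<in>?C. \<Sum>g\<in>?C. (?D (inv x \<otimes> g))\<^sup>2) = (\<Sum>x\<in>?C. \<Sum>g\<in>?C. (?D g)\<^sup>2)"
    by (intro sum.cong refl left)
  \<comment> \<open>Summing over \<open>x\<close> first: for fixed \<open>g\<close> the element
    \<open>inv x \<otimes> g\<close> runs over the whole group, so the inner sum vanishes.\<close>
  also have "(\<Sum>x\<in>?C. \<Sum>g\<in>?C. ?D g * ?D (inv x \<otimes> g)) = (\<Sum>g\<in>?C. ?D g * (\<Sum>x\<in>?C. ?D (inv x \<otimes> g)))"
    by (subst sum.swap) (simp add: sum_distrib_left)
  also have "\<dots> = (\<Sum>g\<in>?C. ?D g * (\<Sum>g\<in>?C. ?D g))"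
    by (intro sum.cong refl) (simp add: right)
  also have "\<dots> = 0" using sum_discrepancy[OF assms] by simp
  finally show ?thesis by (simp add: square_discrepancy_def order_def)
qed

lemma square_discrepancy_nonneg: "square_discrepancy S \<ge> 0"
  unfolding square_discrepancy_def by (simp add: sum_nonneg)

lemma square_discrepancy_Nil: "square_discrepancy [] \<le> 1"
proof -
  let ?n = "real (order G)"
  have n: "?n \<ge> 1" using order_pos by simp
  have nil: "nsub [] g = (if g = \<one> then 1 else 0)" for g
  proof -
    have "{I. I \<subseteq> {..<length ([]::'a list)} \<and> gprod G (nths [] I) = g} = (if g = \<one> then {{}} else {})"
      by auto
    thus ?thesis unfolding nsub_def by simp
  qed
  \<comment> \<open>At the identity (1 - 1/n)^2 is split into 1 - 2/n and the term 1/n^2 that all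
    elements share.\<close>
  have "square_discrepancy [] = (\<Sum>g\<in>carrier G. (if g = \<one> then 1 - 2 / ?n else 0) + (1 / ?n)\<^sup>2)"
    unfolding square_discrepancy_def discrepancy_def nil
    by (intro sum.cong refl) (auto simp: power2_eq_square algebra_simps)
  also have "\<dots> = (1 - 2 / ?n) + ?n * (1 / ?n)\<^sup>2"
    using finite_carrier by (simp add: sum.distrib order_def)
  also have "\<dots> = 1 - 1 / ?n" using n by (simp add: power2_eq_square field_simps)
  finally show ?thesis by simp
qed

lemma set_random_sequence: "set_pmf (random_sequence G k) = {S. set S \<subseteq> carrier G \<and> length S = k}"
proof -
  have "set_pmf (pmf_of_set (carrier G)) = carrier G"
    using finite_carrier by (intro set_pmf_of_set) auto
  thus ?thesis by (auto simp: random_sequence_def set_replicate_pmf lists_eq_set)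
qed

lemma expected_square_discrepancy:
  "(\<integral>\<^sup>+S. ennreal (square_discrepancy S) \<partial>random_sequence G k) \<le> 2 ^ k"
proof (induction k)
  case 0
  thus ?case using square_discrepancy_Nil by (simp add: random_sequence_def ennreal_le_1)
next
  case (Suc k)
  let ?p = "pmf_of_set (carrier G)" and ?R = "random_sequence G k"
  \<comment> \<open>Drawing the head last allows averaging over it for a fixed remainder.\<close>
  have step: "random_sequence G (Suc k) = do {S \<leftarrow> ?R; x \<leftarrow> ?p; return_pmf (x # S)}"
    unfolding random_sequence_def replicate_pmf.simps by (rule bind_commute_pmf)
  have "(\<integral>\<^sup>+S. ennreal (square_discrepancy S) \<partial>random_sequence G (Suc k)) =
        (\<integral>\<^sup>+S. \<integral>\<^sup>+x. ennreal (square_discrepancy (x # S)) \<partial>?p \<partial>?R)"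
    unfolding step by simp
  also have "\<dots> = (\<integral>\<^sup>+S. 2 * ennreal (square_discrepancy S) \<partial>?R)"
  proof (rule nn_integral_cong_AE, rule AE_pmfI)
    fix S assume "S \<in> set_pmf ?R"
    hence S: "set S \<subseteq> carrier G" by (simp add: set_random_sequence)
    have "(\<integral>\<^sup>+x. ennreal (square_discrepancy (x # S)) \<partial>?p) =
          (\<Sum>x\<in>carrier G. ennreal (square_discrepancy (x # S))) / ennreal (real (order G))"
      using finite_carrier order_pos
      by (subst nn_integral_pmf_of_set) (auto simp: order_def ennreal_of_nat_eq_real_of_nat)
    also have "\<dots> = ennreal (2 * real (order G) * square_discrepancy S) / ennreal (real (order G))"
      using sum_square_discrepancy_Cons[OF S] by (simp add: square_discrepancy_nonneg sum_ennreal)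
    also have "\<dots> = ennreal (2 * square_discrepancy S)"
      using order_pos by (subst divide_ennreal) (auto simp: square_discrepancy_nonneg)
    finally show "(\<integral>\<^sup>+x. ennreal (square_discrepancy (x # S)) \<partial>?p) = 2 * ennreal (square_discrepancy S)"
      by (simp add: ennreal_mult' square_discrepancy_nonneg)
  qed
  also have "\<dots> = 2 * (\<integral>\<^sup>+S. ennreal (square_discrepancy S) \<partial>?R)"
    by (simp add: nn_integral_cmult)
  also have "\<dots> \<le> 2 * 2 ^ k" using Suc by (intro mult_left_mono) auto
  finally show ?case by simp
qed

lemma prob_not_balanced:
  "measure_pmf.prob (random_sequence G k) {S. \<not> balanced S} \<le> 4 * (real (order G))\<^sup>2 / 2 ^ k"
proof -
  let ?n = "real (order G)" and ?M = "random_sequence G k"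
  \<comment> \<open>An unbalanced element deviates from the mean 2^k / n by at least half of it (by
    more than all of it on the upper side). Dividing the bound 2^k on the expectation by this
    threshold gives 4 n^2 / 2^k.\<close>
  let ?t = "(2 ^ k / (2 * ?n))\<^sup>2"
  have t: "?t > 0" using order_pos by simp
  have sub: "{S. \<not> balanced S} \<inter> set_pmf ?M \<subseteq> {S. 1 \<le> ennreal (1 / ?t) * ennreal (square_discrepancy S)}"
  proof
    fix S assume "S \<in> {S. \<not> balanced S} \<inter> set_pmf ?M"
    then obtain g where S: "length S = k" and g: "g \<in> carrier G"
      and *: "\<not> (2 ^ k / (2 * ?n) \<le> real (nsub S g) \<and> real (nsub S g) \<le> 2 * 2 ^ k / ?n)"
      by (auto simp: balanced_def set_random_sequence)
    have "2 * 2 ^ k / ?n - 2 ^ k / ?n \<ge> 2 ^ k / (2 * ?n)" and "2 ^ k / ?n - 2 ^ k / (2 * ?n) = 2 ^ k / (2 * ?n)"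
      using order_pos by (auto simp: field_simps)
    hence "2 ^ k / (2 * ?n) \<le> \<bar>discrepancy S g\<bar>"
      using * unfolding discrepancy_def S by linarith
    moreover have "0 \<le> 2 ^ k / (2 * ?n)" using order_pos by simp
    ultimately have "?t \<le> \<bar>discrepancy S g\<bar>\<^sup>2" by (rule power_mono)
    also have "\<dots> = (discrepancy S g)\<^sup>2" by simp
    also have "\<dots> \<le> square_discrepancy S"
      unfolding square_discrepancy_def using g finite_carrier
      by (intro member_le_sum) auto
    finally have "1 \<le> square_discrepancy S / ?t" using t by (subst le_divide_eq_1_pos)
    hence "1 \<le> (1 / ?t) * square_discrepancy S" by (simp only: times_divide_eq_left mult_1)
    hence "ennreal 1 \<le> ennreal ((1 / ?t) * square_discrepancy S)" by (rule ennreal_leI)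
    also have "\<dots> = ennreal (1 / ?t) * ennreal (square_discrepancy S)"
      by (rule ennreal_mult') simp
    finally show "S \<in> {S. 1 \<le> ennreal (1 / ?t) * ennreal (square_discrepancy S)}" by simp
  qed
  have "emeasure ?M {S. \<not> balanced S} = emeasure ?M ({S. \<not> balanced S} \<inter> set_pmf ?M)"
    by (simp add: emeasure_Int_set_pmf)
  also have "\<dots> \<le> emeasure ?M {S \<in> space ?M. 1 \<le> ennreal (1 / ?t) * ennreal (square_discrepancy S)}"
    using sub by (intro emeasure_mono) auto
  also have "\<dots> \<le> ennreal (1 / ?t) * (\<integral>\<^sup>+S. ennreal (square_discrepancy S) * indicator UNIV S \<partial>?M)"
    using nn_integral_Markov_inequality[of "\<lambda>S. ennreal (square_discrepancy S)" UNIV ?M "ennreal (1 / ?t)"]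
    by simp
  also have "\<dots> \<le> ennreal (1 / ?t) * 2 ^ k"
    using expected_square_discrepancy[of k] by (intro mult_left_mono) auto
  also have "\<dots> = ennreal (1 / ?t * 2 ^ k)"
    by (subst ennreal_mult') (auto simp: ennreal_power[symmetric])
  also have "1 / ?t * 2 ^ k = 4 * ?n\<^sup>2 / 2 ^ k"
    using order_pos by (simp add: power2_eq_square field_simps)
  finally show ?thesis by (simp add: measure_pmf.emeasure_eq_measure)
qed

lemma random_sequence_take_drop:
  "map_pmf (take a) (random_sequence G (a + b)) = random_sequence G a"
  "map_pmf (drop a) (random_sequence G (a + b)) = random_sequence G b"
proof -
  let ?R = "random_sequence G"
  have split: "?R (a + b) = do {xs \<leftarrow> ?R a; ys \<leftarrow> ?R b; return_pmf (xs @ ys)}"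
    unfolding random_sequence_def by (rule replicate_pmf_distrib)
  have len: "length xs = a" if "xs \<in> set_pmf (?R a)" for xs
    using that by (simp add: set_random_sequence)
  have "map_pmf (take a) (?R (a + b)) = do {xs \<leftarrow> ?R a; ys \<leftarrow> ?R b; return_pmf xs}"
    unfolding split map_bind_pmf map_return_pmf using len
    by (intro bind_pmf_cong refl) auto
  thus "map_pmf (take a) (?R (a + b)) = ?R a" by (simp add: bind_return_pmf')
  have "map_pmf (drop a) (?R (a + b)) = do {xs \<leftarrow> ?R a; ys \<leftarrow> ?R b; return_pmf ys}"
    unfolding split map_bind_pmf map_return_pmf using len
    by (intro bind_pmf_cong refl) auto
  thus "map_pmf (drop a) (?R (a + b)) = ?R b" by (simp add: bind_return_pmf')
qed

definition balanced_halves :: "'a list \<Rightarrow> bool" where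
  "balanced_halves S \<longleftrightarrow> set S \<subseteq> carrier G \<and>
     balanced (take (half (length S)) S) \<and> balanced (drop (half (length S)) S)"

text \<open>A union bound over the halves; the first is the shorter one and its bound is used for
  both, hence the 8.\<close>

lemma prob_balanced_halves:
  "measure_pmf.prob (random_sequence G k) {S. balanced_halves S \<and> length S = k}
     \<ge> 1 - 8 * (real (order G))\<^sup>2 / 2 ^ half k"
proof -
  let ?M = "random_sequence G k" and ?n = "real (order G)"
  let ?X = "{S. \<not> balanced (take (half k) S)}" and ?Y = "{S. \<not> balanced (drop (half k) S)}"
  have k: "half k + (k - half k) = k" by simp
  have "measure_pmf.prob ?M ?X = measure_pmf.prob (map_pmf (take (half k)) ?M) {S. \<not> balanced S}"
    by (simp add: vimage_def)
  hence X: "measure_pmf.prob ?M ?X \<le> 4 * ?n\<^sup>2 / 2 ^ half k"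
    using random_sequence_take_drop(1)[of "half k" "k - half k"] prob_not_balanced[of "half k"]
    unfolding k by simp
  have "measure_pmf.prob ?M ?Y = measure_pmf.prob (map_pmf (drop (half k)) ?M) {S. \<not> balanced S}"
    by (simp add: vimage_def)
  hence "measure_pmf.prob ?M ?Y \<le> 4 * ?n\<^sup>2 / 2 ^ (k - half k)"
    using random_sequence_take_drop(2)[of "half k" "k - half k"] prob_not_balanced[of "k - half k"]
    unfolding k by simp
  also have "\<dots> \<le> 4 * ?n\<^sup>2 / 2 ^ half k"
    by (intro divide_left_mono power_increasing) auto
  finally have Y: "measure_pmf.prob ?M ?Y \<le> 4 * ?n\<^sup>2 / 2 ^ half k" .
  have "measure_pmf.prob ?M (?X \<union> ?Y) \<le> measure_pmf.prob ?M ?X + measure_pmf.prob ?M ?Y"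
    by (rule measure_Un_le) auto
  hence XY: "measure_pmf.prob ?M (?X \<union> ?Y) \<le> 8 * ?n\<^sup>2 / 2 ^ half k" using X Y by simp
  have "1 - measure_pmf.prob ?M (?X \<union> ?Y) = measure_pmf.prob ?M (- (?X \<union> ?Y))"
    by (subst measure_pmf.prob_compl[symmetric]) (auto simp: Compl_eq_Diff_UNIV)
  also have "\<dots> = measure_pmf.prob ?M (- (?X \<union> ?Y) \<inter> set_pmf ?M)"
    by (simp add: measure_Int_set_pmf)
  also have "\<dots> \<le> measure_pmf.prob ?M {S. balanced_halves S \<and> length S = k}"
    by (intro measure_pmf.finite_measure_mono) (auto simp: set_random_sequence balanced_halves_def)
  finally show ?thesis using XY by linarith
qed

end


section \<open>Walks driven by a random function\<close>

text \<open>One pass in the abstract: \<open>pr\<close> will be the product map and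
  \<open>kind\<close> the side on which a word lies.\<close>

locale hashed_walk =
  fixes C :: "'w set" and H :: "'g set" and pr :: "'w \<Rightarrow> 'g" and kind :: "'w \<Rightarrow> bool"
  assumes finite_C: "finite C" and C_ne: "C \<noteq> {}" and finite_H: "finite H"
    and pr_in: "c \<in> C \<Longrightarrow> pr c \<in> H"
begin

definition D :: "('w \<times> ('g \<Rightarrow> 'w)) set" where
  "D = C \<times> (H \<rightarrow>\<^sub>E C)"

definition wk :: "'w \<times> ('g \<Rightarrow> 'w) \<Rightarrow> nat \<Rightarrow> 'w" where
  "wk d m = ((snd d \<circ> pr) ^^ m) (fst d)"

definition rho :: "'w \<times> ('g \<Rightarrow> 'w) \<Rightarrow> nat" where
  "rho d = rho_length (snd d \<circ> pr) (fst d)"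

text \<open>Distinctness is required of products, not of words: it ensures that the hash function
  has not yet been read at the last product, so that the next word is still free.\<close>

definition fresh :: "nat \<Rightarrow> ('w \<times> ('g \<Rightarrow> 'w)) set" where
  "fresh m = {d \<in> D. inj_on (\<lambda>l. pr (wk d l)) {..m}}"

definition walk_list :: "'w \<times> ('g \<Rightarrow> 'w) \<Rightarrow> nat \<Rightarrow> 'w list" where
  "walk_list d m = map (wk d) [0..<Suc m]"

lemma finite_D: "finite D" unfolding D_def using finite_C finite_H by (intro finite_cartesian_product finite_PiE)

lemma D_ne: "D \<noteq> {}"
  unfolding D_def using C_ne by (simp add: PiE_eq_empty_iff)

lemma finite_fresh: "finite (fresh m)" unfolding fresh_def using finite_D by simp

lemma wk_0 [simp]: "wk d 0 = fst d" and wk_Suc: "wk d (Suc m) = snd d (pr (wk d m))"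
  by (simp_all add: wk_def)

lemma hash_in: "d \<in> D \<Longrightarrow> c \<in> C \<Longrightarrow> snd d (pr c) \<in> C"
  unfolding D_def using pr_in[of c] by (cases d) (simp add: PiE_def Pi_def)

lemma wk_in: "d \<in> D \<Longrightarrow> wk d m \<in> C"
  by (induction m) (simp_all add: wk_Suc hash_in, simp add: D_def mem_Times_iff)

lemma pr_wk_in: "d \<in> D \<Longrightarrow> pr (wk d m) \<in> H"
  by (simp add: wk_in pr_in)

lemma fresh_Suc_subset: "fresh (Suc m) \<subseteq> fresh m"
  unfolding fresh_def by (auto intro: inj_on_subset)

lemma fresh_mono: "m \<le> m' \<Longrightarrow> fresh m' \<subseteq> fresh m"
  unfolding fresh_def by (auto intro: inj_on_subset)

lemma fresh_0: "fresh 0 = D" unfolding fresh_def by auto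

lemma fresh_less: "d \<in> fresh m \<Longrightarrow> m < card H"
proof -
  assume d: "d \<in> fresh m"
  have "card {..m} \<le> card H"
    using d finite_H by (intro card_inj_on_le[of "\<lambda>l. pr (wk d l)"]) (auto simp: fresh_def pr_wk_in)
  thus ?thesis by simp
qed

lemma fresh_card_H: "fresh (card H) = {}" using fresh_less by blast

text \<open>The value of the hash function at the \<open>m\<close>-th product does not influence the first \<open>m\<close> steps
  when the products are distinct. Exchanging it with an arbitrary word is therefore an involution,
  which shows that the next word is uniformly distributed.\<close>

definition exchange :: "nat \<Rightarrow> ('w \<times> ('g \<Rightarrow> 'w)) \<times> 'w \<Rightarrow> ('w \<times> ('g \<Rightarrow> 'w)) \<times> 'w" where
  "exchange m = (\<lambda>(d, c). ((fst d, (snd d)(pr (wk d m) := c)), wk d (Suc m)))"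

lemma wk_update:
  assumes "d \<in> fresh m" "l \<le> m"
  shows "wk (fst d, (snd d)(pr (wk d m) := c)) l = wk d l"
  using assms(2)
proof (induction l)
  case (Suc l)
  have "inj_on (\<lambda>l. pr (wk d l)) {..m}" using assms(1) by (simp add: fresh_def)
  hence "pr (wk d l) \<noteq> pr (wk d m)"
    using inj_on_eq_iff[of "\<lambda>l. pr (wk d l)" "{..m}" l m] Suc.prems by simp
  thus ?case using Suc by (simp add: wk_Suc)
qed simp

lemma exchange:
  assumes "x \<in> fresh m \<times> C"
  shows "exchange m x \<in> fresh m \<times> C" "exchange m (exchange m x) = x"
    "walk_list (fst (exchange m x)) m = walk_list (fst x) m"
    "wk (fst (exchange m x)) (Suc m) = snd x"
proof -
  obtain d c where x: "x = (d, c)" by (cases x)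
  with assms have d: "d \<in> fresh m" and c: "c \<in> C" by auto
  let ?d = "(fst d, (snd d)(pr (wk d m) := c))"
  have up: "wk ?d l = wk d l" if "l \<le> m" for l using wk_update[OF d that] .
  have dD: "d \<in> D" using d by (simp add: fresh_def)
  have "?d \<in> D"
    using dD c pr_wk_in[OF dD, of m] unfolding D_def by (auto simp: PiE_def Pi_def extensional_def)
  hence fr: "?d \<in> fresh m"
    using d up unfolding fresh_def by (auto simp: inj_on_def)
  show "exchange m x \<in> fresh m \<times> C"
    using fr wk_in[OF dD] by (simp add: x exchange_def)
  show 1: "wk (fst (exchange m x)) (Suc m) = snd x"
    by (simp add: x exchange_def wk_Suc up)
  show "walk_list (fst (exchange m x)) m = walk_list (fst x) m"
    using up by (simp add: x exchange_def walk_list_def)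
  show "exchange m (exchange m x) = x"
    using 1 by (simp add: x exchange_def up wk_Suc)
qed

text \<open>The predicate may look at the whole past, which enters as a list because
  \<open>exchange\<close> leaves this list unchanged while it trades the next word for the spare
  one.\<close>

lemma card_next:
  "card C * card {d \<in> fresh m. P (walk_list d m) (wk d (Suc m))} =
   (\<Sum>d\<in>fresh m. card {c \<in> C. P (walk_list d m) c})"
proof -
  have "(\<Sum>d\<in>fresh m. card {c \<in> C. P (walk_list d m) c}) =
        (\<Sum>d\<in>fresh m. \<Sum>c\<in>C. of_bool (P (walk_list d m) c))"
    using finite_C by (intro sum.cong refl) (simp add: Int_def)
  also have "\<dots> = (\<Sum>x\<in>fresh m \<times> C. of_bool (P (walk_list (fst x) m) (snd x)))"
    by (simp add: sum.cartesian_product case_prod_unfold)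
  also have "\<dots> = (\<Sum>x\<in>fresh m \<times> C. of_bool (P (walk_list (fst x) m) (wk (fst x) (Suc m))))"
    by (rule sum.reindex_bij_witness[of _ "exchange m" "exchange m"]) (simp_all add: exchange)
  also have "\<dots> = (\<Sum>d\<in>fresh m. \<Sum>c\<in>C. of_bool (P (walk_list d m) (wk d (Suc m))))"
    by (simp only: sum.cartesian_product case_prod_unfold)
  also have "\<dots> = card C * (\<Sum>d\<in>fresh m. of_bool (P (walk_list d m) (wk d (Suc m))))"
    by (simp add: sum_distrib_left)
  also have "(\<Sum>d\<in>fresh m. of_bool (P (walk_list d m) (wk d (Suc m)))) =
             card {d \<in> fresh m. P (walk_list d m) (wk d (Suc m))}"
    using finite_fresh[of m] by (simp add: Int_def)
  finally show ?thesis by simp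
qed

section \<open>First collisions of products and the sides they join\<close>

lemma set_walk_list: "set (walk_list d m) = wk d ` {..m}"
  unfolding walk_list_def by (auto simp: atLeast0LessThan lessThan_Suc_atMost simp del: upt_Suc)

text \<open>As the earlier products are distinct, the collision is the first one and its
  \<open>l\<close> is unique. These draws will make a pass succeed.\<close>

definition meets :: "nat \<Rightarrow> ('w \<times> ('g \<Rightarrow> 'w)) set" where
  "meets m = {d \<in> fresh m. \<exists>l\<le>m. pr (wk d (Suc m)) = pr (wk d l) \<and>
                                 kind (wk d (Suc m)) \<noteq> kind (wk d l)}"

lemma fresh_diff: "fresh m - fresh (Suc m) = {d \<in> fresh m. \<exists>l\<le>m. pr (wk d (Suc m)) = pr (wk d l)}"
proof -
  have "inj_on (\<lambda>l. pr (wk d l)) {..Suc m} \<longleftrightarrow>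
        inj_on (\<lambda>l. pr (wk d l)) {..m} \<and> \<not> (\<exists>l\<le>m. pr (wk d (Suc m)) = pr (wk d l))" for d
    unfolding atMost_Suc by (subst inj_on_insert) auto
  thus ?thesis unfolding fresh_def by blast
qed

lemma meets_subset: "meets m \<subseteq> fresh m - fresh (Suc m)"
  unfolding fresh_diff meets_def by blast

text \<open>Distinct products have disjoint fibres, so the union bound is an equality; this is what
  later permits lower bounds.\<close>

lemma card_fibres:
  assumes "d \<in> fresh m"
  shows "card {c \<in> C. \<exists>l\<le>m. pr c = pr (wk d l) \<and> Q c l} =
         (\<Sum>l\<le>m. card {c \<in> C. pr c = pr (wk d l) \<and> Q c l})"
proof -
  have "{c \<in> C. \<exists>l\<le>m. pr c = pr (wk d l) \<and> Q c l} =
        (\<Union>l\<in>{..m}. {c \<in> C. pr c = pr (wk d l) \<and> Q c l})" by auto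
  thus ?thesis
    using finite_C assms unfolding fresh_def
    by (simp only:) (intro card_UN_disjoint; auto simp: inj_on_def)
qed

lemma periodic_orbit_D: "d \<in> D \<Longrightarrow> periodic_orbit (snd d \<circ> pr) (fst d)"
  using hash_in wk_in[of d 0] by (intro periodic_orbit_finite[OF finite_C]) simp_all

text \<open>Equal products lead to equal words one step later, so the products are distinct up to
  one index before the last new word. The count form makes the sum over all draws a sum of the sizes
  of \<open>fresh m\<close>.\<close>

lemma rho_le:
  assumes "d \<in> D"
  shows "rho d \<le> 1 + card {m. m < card H \<and> d \<in> fresh m}"
proof -
  interpret periodic_orbit "snd d \<circ> pr" "fst d"
    by (rule periodic_orbit_D[OF assms])
  have "{..<rho d - 1} \<subseteq> {m. m < card H \<and> d \<in> fresh m}"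
  proof
    fix m assume "m \<in> {..<rho d - 1}"
    hence m: "m + 1 < rho d" by auto
    have "pr (wk d a) \<noteq> pr (wk d b)" if "a < b" "b \<le> m" for a b
    proof
      assume "pr (wk d a) = pr (wk d b)"
      hence "wk d (Suc a) = wk d (Suc b)" by (simp add: wk_Suc)
      moreover have "wk d (Suc a) \<noteq> wk d (Suc b)"
        using orb_distinct[of "Suc a" "Suc b"] that m unfolding wk_def rho_def by linarith
      ultimately show False by blast
    qed
    hence "inj_on (\<lambda>l. pr (wk d l)) {..m}"
      by (intro linorder_inj_onI) auto
    hence "d \<in> fresh m" using assms by (simp add: fresh_def)
    thus "m \<in> {m. m < card H \<and> d \<in> fresh m}" using fresh_less by blast
  qed
  hence "card {..<rho d - 1} \<le> card {m. m < card H \<and> d \<in> fresh m}"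
    by (intro card_mono) auto
  thus ?thesis by simp
qed

text \<open>The colliding words have different kinds, so they differ, and the words first repeat one
  step after the products do. The two predecessors of the repeated word are then exactly the
  colliding pair, and the tail is not empty.\<close>

lemma meets_rho:
  assumes "d \<in> meets m"
  obtains l where "l \<le> m" "cycle_length (snd d \<circ> pr) (fst d) + tail_length (snd d \<circ> pr) (fst d) = Suc (Suc m)"
    "tail_length (snd d \<circ> pr) (fst d) = Suc l"
    "pr (wk d (Suc m)) = pr (wk d l)" "kind (wk d (Suc m)) \<noteq> kind (wk d l)"
proof -
  from assms obtain l where d: "d \<in> fresh m" and l: "l \<le> m" "pr (wk d (Suc m)) = pr (wk d l)"
    "kind (wk d (Suc m)) \<noteq> kind (wk d l)" unfolding meets_def by blast
  have dD: "d \<in> D" using d by (simp add: fresh_def)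
  interpret periodic_orbit "snd d \<circ> pr" "fst d"
    by (rule periodic_orbit_D[OF dD])
  have inj: "pr (wk d a) \<noteq> pr (wk d b)" if "a < b" "b \<le> m" for a b
    using d that inj_on_eq_iff[of "\<lambda>l. pr (wk d l)" "{..m}" a b] by (simp add: fresh_def)
  have dist: "wk d a \<noteq> wk d b" if "a < b" "b < Suc (Suc m)" for a b
  proof (cases "b \<le> m")
    case True
    thus ?thesis using inj[OF that(1)] by metis
  next
    case False
    hence b: "b = Suc m" using that by simp
    show ?thesis
    proof
      assume "wk d a = wk d b"
      hence e: "wk d a = wk d (Suc m)" by (simp add: b)
      \<comment> \<open>Equal words have equal products, which forces \<open>a = l\<close>; but the
        words at \<open>l\<close> and \<open>Suc m\<close> lie on different sides.\<close>
      hence "pr (wk d a) = pr (wk d l)" using l by simp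
      hence "a = l" using inj[of a l] inj[of l a] l(1) that b by (metis less_Suc_eq_le nat_neq_iff)
      thus False using e l(3) by simp
    qed
  qed
  have "wk d (Suc l) = wk d (Suc (Suc m))"
    by (simp only: wk_Suc[of d l] wk_Suc[of d "Suc m"] l(2))
  from rho_unique[of "Suc (Suc m)" "Suc l", folded wk_def, OF dist _ this] l(1)
  have "rho_length (snd d \<circ> pr) (fst d) = Suc (Suc m)" "tail_length (snd d \<circ> pr) (fst d) = Suc l"
    by simp_all
  thus thesis using that[OF l(1) _ _ l(2,3)] unfolding rho_length_def by blast
qed

end

text \<open>The factors 2 are those of \<open>balanced\<close>. The 6 is 2 times 3, since in the
  application there are at most three times as many words as on the smaller side.\<close>

locale equidistributed_walk = hashed_walk +
  assumes fibre_lower: "g \<in> H \<Longrightarrow> real (card C) / (2 * real (card H)) \<le> real (card {c \<in> C. pr c = g})"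
    and fibre_upper: "g \<in> H \<Longrightarrow> real (card {c \<in> C. pr c = g}) \<le> 2 * real (card C) / real (card H)"
    and kind_lower: "g \<in> H \<Longrightarrow>
      real (card C) / (6 * real (card H)) \<le> real (card {c \<in> C. pr c = g \<and> kind c \<noteq> b})"
begin

lemma card_C_pos: "real (card C) > 0" using finite_C C_ne by (simp add: card_gt_0_iff)

lemma H_ne: "H \<noteq> {}" using pr_in C_ne by blast

lemma card_H_pos: "real (card H) > 0" using finite_H H_ne by (simp add: card_gt_0_iff)

section \<open>Decay of the collision-free draws, success probability and mean length\<close>

lemma card_fresh_diff:
  "real (card (fresh m - fresh (Suc m))) = real (card (fresh m)) - real (card (fresh (Suc m)))"
  using fresh_Suc_subset[of m] finite_fresh card_mono[OF finite_fresh fresh_Suc_subset, of m]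
  by (simp add: card_Diff_subset of_nat_diff)

lemma fresh_next:
  "real (card C) * real (card (fresh m - fresh (Suc m))) =
   (\<Sum>d\<in>fresh m. \<Sum>l\<le>m. real (card {c \<in> C. pr c = pr (wk d l)}))"
proof -
  have "fresh m - fresh (Suc m) = {d \<in> fresh m. \<exists>x\<in>set (walk_list d m). pr (wk d (Suc m)) = pr x}"
    unfolding fresh_diff set_walk_list by auto
  hence "card C * card (fresh m - fresh (Suc m)) =
         (\<Sum>d\<in>fresh m. card {c \<in> C. \<exists>x\<in>set (walk_list d m). pr c = pr x})"
    using card_next[of m "\<lambda>xs c. \<exists>x\<in>set xs. pr c = pr x"] by simp
  also have "\<dots> = (\<Sum>d\<in>fresh m. \<Sum>l\<le>m. card {c \<in> C. pr c = pr (wk d l)})"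
    using card_fibres[of _ m "\<lambda>_ _. True"]
    by (intro sum.cong refl) (simp add: set_walk_list Bex_def)
  finally show ?thesis by (metis (no_types, lifting) of_nat_mult of_nat_sum sum.cong)
qed

lemma meets_next:
  "real (card C) * real (card (meets m)) =
   (\<Sum>d\<in>fresh m. \<Sum>l\<le>m. real (card {c \<in> C. pr c = pr (wk d l) \<and> kind c \<noteq> kind (wk d l)}))"
proof -
  have "meets m = {d \<in> fresh m. \<exists>x\<in>set (walk_list d m). pr (wk d (Suc m)) = pr x \<and> kind (wk d (Suc m)) \<noteq> kind x}"
    unfolding meets_def set_walk_list by auto
  hence "card C * card (meets m) =
         (\<Sum>d\<in>fresh m. card {c \<in> C. \<exists>x\<in>set (walk_list d m). pr c = pr x \<and> kind c \<noteq> kind x})"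
    using card_next[of m "\<lambda>xs c. \<exists>x\<in>set xs. pr c = pr x \<and> kind c \<noteq> kind x"] by simp
  also have "\<dots> = (\<Sum>d\<in>fresh m. \<Sum>l\<le>m. card {c \<in> C. pr c = pr (wk d l) \<and> kind c \<noteq> kind (wk d l)})"
    using card_fibres[of _ m "\<lambda>c l. kind c \<noteq> kind (wk _ l)"]
    by (intro sum.cong refl) (simp add: set_walk_list Bex_def)
  finally show ?thesis by (metis (no_types, lifting) of_nat_mult of_nat_sum sum.cong)
qed

text \<open>With m + 1 distinct products behind it, the next word falls into one of m + 1 disjoint
  fibres, each of relative size at least 1 / (2 n) with n = \<open>card H\<close>.\<close>

lemma fresh_decay:
  "real (Suc m) * real (card (fresh m)) \<le>
     2 * real (card H) * (real (card (fresh m)) - real (card (fresh (Suc m))))"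
proof -
  let ?q = "real (card C) / (2 * real (card H))"
  have "real (Suc m) * real (card (fresh m)) * ?q = (\<Sum>d\<in>fresh m. \<Sum>l\<le>m. ?q)" by simp
  also have "\<dots> \<le> (\<Sum>d\<in>fresh m. \<Sum>l\<le>m. real (card {c \<in> C. pr c = pr (wk d l)}))"
    by (intro sum_mono fibre_lower pr_wk_in) (auto simp: fresh_def)
  also have "\<dots> = real (card C) * real (card (fresh m - fresh (Suc m)))" by (rule fresh_next[symmetric])
  finally have "real (Suc m) * real (card (fresh m)) * real (card C) \<le>
     2 * real (card H) * real (card (fresh m - fresh (Suc m))) * real (card C)"
    using card_H_pos by (simp add: field_simps)
  hence "real (Suc m) * real (card (fresh m)) \<le> 2 * real (card H) * real (card (fresh m - fresh (Suc m)))"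
    using card_C_pos by (rule mult_right_le_imp_le)
  thus ?thesis unfolding card_fresh_diff .
qed

text \<open>A fibre has relative size at most 2 / n, and its part on a prescribed side at least 1 /
  (6 n). The quotient 12 is applied fibre by fibre, before summation.\<close>

lemma meets_lower:
  "real (card (fresh m)) - real (card (fresh (Suc m))) \<le> 12 * real (card (meets m))"
proof -
  let ?q = "real (card C) / real (card H)"
  have "real (card C) * real (card (fresh m - fresh (Suc m))) =
        (\<Sum>d\<in>fresh m. \<Sum>l\<le>m. real (card {c \<in> C. pr c = pr (wk d l)}))" by (rule fresh_next)
  also have "\<dots> \<le> (\<Sum>d\<in>fresh m. \<Sum>l\<le>m. 12 * real (card {c \<in> C. pr c = pr (wk d l) \<and> kind c \<noteq> kind (wk d l)}))"
  proof (intro sum_mono)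
    fix d l assume "d \<in> fresh m"
    hence g: "pr (wk d l) \<in> H" by (simp add: fresh_def pr_wk_in)
    have "real (card {c \<in> C. pr c = pr (wk d l)}) \<le> 12 * (real (card C) / (6 * real (card H)))"
      using fibre_upper[OF g] by simp
    thus "real (card {c \<in> C. pr c = pr (wk d l)}) \<le>
          12 * real (card {c \<in> C. pr c = pr (wk d l) \<and> kind c \<noteq> kind (wk d l)})"
      using kind_lower[OF g, of "kind (wk d l)"] by linarith
  qed
  also have "\<dots> = 12 * (real (card C) * real (card (meets m)))"
    unfolding meets_next by (simp add: sum_distrib_left)
  finally have "real (card (fresh m - fresh (Suc m))) * real (card C) \<le> 12 * real (card (meets m)) * real (card C)"
    by (simp add: mult_ac)
  hence "real (card (fresh m - fresh (Suc m))) \<le> 12 * real (card (meets m))"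
    using card_C_pos by (rule mult_right_le_imp_le)
  thus ?thesis unfolding card_fresh_diff .
qed

text \<open>Every draw ceases to be fresh at exactly one index, so the losses telescope to all of
  \<open>D\<close>; the sets \<open>meets m\<close> are disjoint and each takes at least a twelfth
  of its loss.\<close>

lemma card_meets: "real (card D) \<le> 12 * real (card (\<Union>m. meets m))"
proof -
  let ?n = "card H"
  have "real (card D) = (\<Sum>m<?n. real (card (fresh m)) - real (card (fresh (Suc m))))"
    by (subst sum_lessThan_telescope') (simp add: fresh_0 fresh_card_H)
  also have "\<dots> \<le> (\<Sum>m<?n. 12 * real (card (meets m)))" by (intro sum_mono meets_lower)
  also have "\<dots> = 12 * real (card (\<Union>m<?n. meets m))"
  proof -
    have "meets a \<inter> meets b = {}" if "a < b" for a b
      using meets_subset[of a] meets_subset[of b] fresh_mono[of "Suc a" b] that by auto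
    hence "meets a \<inter> meets b = {}" if "a \<noteq> b" for a b
      using that by (metis inf_commute nat_neq_iff)
    moreover have "finite (meets m)" for m
      using finite_fresh[of m] meets_subset[of m] by (meson Diff_subset finite_subset)
    ultimately have "card (\<Union>m<?n. meets m) = (\<Sum>m<?n. card (meets m))"
      by (intro card_UN_disjoint) auto
    thus ?thesis by (simp add: sum_distrib_left)
  qed
  also have "card (\<Union>m<?n. meets m) \<le> card (\<Union>m. meets m)"
    using finite_subset[OF _ finite_D, of "\<Union>m. meets m"]
    by (intro card_mono) (auto simp: meets_def fresh_def)
  hence "12 * real (card (\<Union>m<?n. meets m)) \<le> 12 * real (card (\<Union>m. meets m))" by simp
  finally show ?thesis .
qed

text \<open>Up to index \<open>s\<close> the trivial bound is used. From \<open>s\<close> on, the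
  decay bounds \<open>fresh m\<close> by 2 n / s times the loss at \<open>m\<close>, and the losses
  telescope. This avoids estimating the tail of the collision time.\<close>

lemma sum_fresh:
  assumes "s > 0"
  shows "(\<Sum>m<card H. real (card (fresh m))) \<le> (real s + 2 * real (card H) / real s) * real (card D)"
proof -
  let ?n = "card H" and ?e = "\<lambda>m. real (card (fresh m))"
  have eD: "?e m \<le> real (card D)" for m
    using finite_D by (simp add: card_mono fresh_def)
  have "?e m \<le> (if m < s then real (card D) else 0) + 2 * real ?n / real s * (?e m - ?e (Suc m))" for m
  proof (cases "m < s")
    case True
    have "?e (Suc m) \<le> ?e m" using card_mono[OF finite_fresh fresh_Suc_subset] by simp
    hence "0 \<le> 2 * real ?n / real s * (?e m - ?e (Suc m))" by simp
    thus ?thesis using True eD[of m] by simp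
  next
    case False
    hence "real s * ?e m \<le> real (Suc m) * ?e m" by (intro mult_right_mono) auto
    also have "\<dots> \<le> 2 * real ?n * (?e m - ?e (Suc m))" by (rule fresh_decay)
    finally show ?thesis using False assms by (simp add: field_simps)
  qed
  hence "(\<Sum>m<?n. ?e m) \<le> (\<Sum>m<?n. (if m < s then real (card D) else 0) +
                               2 * real ?n / real s * (?e m - ?e (Suc m)))" by (intro sum_mono)
  also have "\<dots> = (\<Sum>m<?n. if m < s then real (card D) else 0) +
                  2 * real ?n / real s * (\<Sum>m<?n. ?e m - ?e (Suc m))"
    by (simp add: sum.distrib sum_distrib_left)
  also have "(\<Sum>m<?n. ?e m - ?e (Suc m)) = real (card D)"
    by (subst sum_lessThan_telescope') (simp add: fresh_0 fresh_card_H)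
  also have "(\<Sum>m<?n. if m < s then real (card D) else 0) = (\<Sum>m\<in>{..<?n} \<inter> {..<s}. real (card D))"
    by (subst sum.inter_restrict) (auto intro: sum.cong)
  also have "\<dots> \<le> (\<Sum>m<s. real (card D))" by (intro sum_mono2) auto
  finally show ?thesis by (simp add: algebra_simps)
qed

lemma sum_rho: "(\<Sum>d\<in>D. real (rho d)) \<le> (3 * sqrt (real (card H)) + 2) * real (card D)"
proof -
  let ?n = "card H"
  \<comment> \<open>Near the square root of n the terms s and 2 n / s have the same order, with
    total about 3 sqrt n.\<close>
  define s where "s = nat \<lceil>sqrt (real ?n)\<rceil>"
  have root: "sqrt (real ?n) > 0" using card_H_pos by simp
  have s: "s > 0" "sqrt (real ?n) \<le> real s" "real s \<le> sqrt (real ?n) + 1"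
    unfolding s_def using root by (linarith | simp)+
  have "(\<Sum>d\<in>D. real (rho d)) \<le> (\<Sum>d\<in>D. 1 + (\<Sum>m<?n. of_bool (d \<in> fresh m)))"
  proof (intro sum_mono)
    fix d assume "d \<in> D"
    from rho_le[OF this] have "real (rho d) \<le> 1 + real (card {m. m < ?n \<and> d \<in> fresh m})" by linarith
    also have "{m. m < ?n \<and> d \<in> fresh m} = {..<?n} \<inter> {m. d \<in> fresh m}" by auto
    finally show "real (rho d) \<le> 1 + (\<Sum>m<?n. of_bool (d \<in> fresh m))" by simp
  qed
  also have "\<dots> = real (card D) + (\<Sum>d\<in>D. \<Sum>m<?n. of_bool (d \<in> fresh m))"
    by (simp add: sum.distrib)
  also have "(\<Sum>d\<in>D. \<Sum>m<?n. of_bool (d \<in> fresh m)) = (\<Sum>m<?n. \<Sum>d\<in>D. (of_bool (d \<in> fresh m) :: real))"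
    by (rule sum.swap)
  also have "\<dots> = (\<Sum>m<?n. real (card (fresh m)))"
  proof (intro sum.cong refl)
    fix m
    have "D \<inter> {d. d \<in> fresh m} = fresh m" by (auto simp: fresh_def)
    thus "(\<Sum>d\<in>D. (of_bool (d \<in> fresh m) :: real)) = real (card (fresh m))"
      using finite_D by simp
  qed
  also have "\<dots> \<le> (real s + 2 * real ?n / real s) * real (card D)" by (rule sum_fresh[OF s(1)])
  also have "\<dots> \<le> (3 * sqrt (real ?n) + 1) * real (card D)"
  proof (intro mult_right_mono)
    have "2 * real ?n / real s \<le> 2 * real ?n / sqrt (real ?n)"
      using s(2) root s(1) by (intro divide_left_mono mult_pos_pos) simp_all
    also have "\<dots> = 2 * sqrt (real ?n)" 
      using real_div_sqrt[of "real ?n"] by (simp only: times_divide_eq_right[symmetric] of_nat_0_le_iff)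
    finally show "real s + 2 * real ?n / real s \<le> 3 * sqrt (real ?n) + 1" using s by linarith
  qed simp
  finally show ?thesis by (simp add: algebra_simps)
qed

end


section \<open>A machine with tables of block products\<close>

text \<open>\<open>Hare\<close> and \<open>Hare2\<close> are the two moves of the fast walker. In
  the tail phases the tortoise starts again from the first word, the hare continues from the meeting
  point, and both move at the same speed.\<close>

datatype phase = Precompute | Tortoise | Hare | Hare2 | Tail_Tortoise | Tail_Hare
  | Restart | Compare | Output

lemma UNIV_phase: "UNIV = {Precompute, Tortoise, Hare, Hare2, Tail_Tortoise, Tail_Hare,
  Restart, Compare, Output}"
  using phase.exhaust by auto

text \<open>A control state consists of the phase, a counter, the starting word of the walk, the
  tortoise, the hare, and the word that follows the tortoise.\<close>

type_synonym mstate = "phase \<times> nat \<times> word \<times> word \<times> word \<times> word"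

lemma finite_words: "finite (words k)" unfolding words_def by auto

lemma Inl_empty_in_words: "Inl {} \<in> words k" unfolding words_def by auto

lemma card_words: "card (words k) = 2 ^ half k + 2 ^ (k - half k)"
  unfolding words_def by (simp add: card_Plus card_Pow)

text \<open>The remaining cases are never output, as \<open>Compare\<close> sends words on the same
  side to \<open>Restart\<close>; the empty set keeps their \<open>Halt\<close> instructions well
  formed.\<close>

fun out_set :: "nat \<Rightarrow> word \<Rightarrow> word \<Rightarrow> nat set" where
  "out_set k (Inl I) (Inr J) = join_indices k I J"
| "out_set k (Inr J) (Inl I) = join_indices k I J"
| "out_set k _ _ = {}"

lemma out_set_subset:
  assumes "x \<in> words k" "y \<in> words k"
  shows "out_set k x y \<subseteq> {..<k}"
proof -
  have "join_indices k I J \<subseteq> {..<k}" if "I \<subseteq> {..<half k}" "J \<subseteq> {..<k - half k}" for I J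
    using that unfolding join_indices_def by fastforce
  thus ?thesis using assms unfolding words_def by (cases x; cases y) auto
qed

definition target :: "phase \<Rightarrow> word \<Rightarrow> word \<Rightarrow> word" where
  "target ph x y = (if ph = Tortoise \<or> ph = Tail_Tortoise then x else y)"

definition walking :: "phase \<Rightarrow> bool" where
  "walking ph \<longleftrightarrow> ph \<in> {Tortoise, Hare, Hare2, Tail_Tortoise, Tail_Hare}"

text \<open>When the walkers meet, \<open>w = c\<close> says that the walk has no tail. In the tail
  search the successor of the tortoise is kept apart in \<open>u\<close>: when the two successors
  agree, \<open>x\<close> and \<open>y\<close> are still their predecessors, the words t and s of
  the algorithm. The last equation serves the phases that do not hash.\<close>

fun after_hash :: "phase \<Rightarrow> word \<Rightarrow> word \<Rightarrow> word \<Rightarrow> word \<Rightarrow> word \<Rightarrow> mstate" where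
  "after_hash Tortoise w x y u c = (Hare, 0, w, c, y, u)"
| "after_hash Hare w x y u c = (Hare2, 0, w, x, c, u)"
| "after_hash Hare2 w x y u c =
     (if x = c then if w = c then (Restart, 0, w, w, w, w) else (Tail_Tortoise, 0, w, w, c, u)
      else (Tortoise, 0, w, x, c, u))"
| "after_hash Tail_Tortoise w x y u c = (Tail_Hare, 0, w, x, y, c)"
| "after_hash Tail_Hare w x y u c =
     (if u = c then (Compare, 0, w, x, y, u) else (Tail_Tortoise, 0, w, u, c, u))"
| "after_hash _ w x y u c = (Restart, 0, w, w, w, w)"

locale table_machine =
  fixes k r :: nat
  assumes r_pos: "r > 0"
begin

text \<open>The added 1 makes \<open>r\<close> blocks cover all \<open>k\<close> indices; indices
  from \<open>k\<close> on stand for the identity.\<close>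

definition b :: nat where "b = k div r + 1"

definition entries :: nat where "entries = r * 2 ^ b"

text \<open>Indices refer to the whole sequence, so that one table serves both sides: a word of the
  second side needs the same forward product, inverted once and multiplied by the target.\<close>

definition support :: "word \<Rightarrow> nat set" where
  "support c = (case c of Inl I \<Rightarrow> I | Inr J \<Rightarrow> (+) (half k) ` J)"

definition block :: "word \<Rightarrow> nat \<Rightarrow> nat set" where
  "block c \<beta> = {i. i < b \<and> \<beta> * b + i \<in> support c}"

definition entry :: "word \<Rightarrow> nat \<Rightarrow> nat" where
  "entry c \<beta> = \<beta> * 2 ^ b + set_encode (block c \<beta>)"

text \<open>Registers: the input, the target, the identity (register \<open>k + 1\<close>), two accumulators
  (\<open>k + 2\<close> and \<open>k + 3\<close>), and the table of block products.\<close>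

definition tab :: "nat \<Rightarrow> nat" where "tab v = k + 4 + v"

text \<open>Only the last evaluation before a comparison uses the second accumulator, since the
  product of \<open>x\<close> has to survive in the first.\<close>

definition acc :: "phase \<Rightarrow> nat" where
  "acc ph = (if ph = Tail_Hare then k + 3 else k + 2)"

definition Q :: "mstate set" where
  "Q = UNIV \<times> {..<entries + r + 3} \<times> words k \<times> words k \<times> words k \<times> words k"

definition start :: mstate where
  "start = (Precompute, 0, Inl {}, Inl {}, Inl {}, Inl {})"

definition enc :: "mstate \<Rightarrow> nat" where
  "enc = (SOME e. bij_betw e Q {..<card Q} \<and> e start = 0)"

text \<open>In \<open>Precompute\<close>, removing the highest bit \<open>t\<close> from the mask of
  a block leads to an earlier entry, so each entry costs one multiplication. Every evaluation of a
  product takes \<open>r + 2\<close> operations: words of the first side multiply by the identity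
  where the others invert and multiply by the target.\<close>

fun instr_at :: "mstate \<Rightarrow> instr" where
  "instr_at (Precompute, v, w, x, y, u) =
     (let next = enc (if v + 1 < entries then (Precompute, v + 1, w, x, y, u)
                      else (Restart, 0, w, x, y, u));
          t = Max (set_decode (v mod 2 ^ b));
          q = v div 2 ^ b * b + t
      in if v mod 2 ^ b = 0 then Mult (tab v) (k + 1) (k + 1) next
         else Mult (tab v) (tab (v - 2 ^ t)) (if q < k then q else k + 1) next)"
| "instr_at (Restart, v, w, x, y, u) = Draw (\<lambda>c. enc (Tortoise, 0, c, c, c, c))"
| "instr_at (Compare, v, w, x, y, u) =
     Equal (k + 2) (k + 3)
       (enc (if isl x \<noteq> isl y then Output else Restart, 0, w, x, y, u))
       (enc (Restart, 0, w, x, y, u))"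
| "instr_at (Output, v, w, x, y, u) = Halt (out_set k x y)"
| "instr_at (ph, v, w, x, y, u) =
     (let c = target ph x y; next = enc (ph, v + 1, w, x, y, u); a = acc ph in
      if v < r then Mult a (if v = 0 then k + 1 else a) (tab (entry c v)) next
      else if v = r then (if isl c then Mult a a (k + 1) next else Inverse a a next)
      else if v = r + 1 then (if isl c then Mult a a (k + 1) next else Mult a k a next)
      else Hash a (\<lambda>c'. enc (after_hash ph w x y u c')))"

lemma instr_at_walking:
  assumes "walking ph"
  shows "instr_at (ph, v, w, x, y, u) =
     (let c = target ph x y; next = enc (ph, v + 1, w, x, y, u); a = acc ph in
      if v < r then Mult a (if v = 0 then k + 1 else a) (tab (entry c v)) next
      else if v = r then (if isl c then Mult a a (k + 1) next else Inverse a a next)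
      else if v = r + 1 then (if isl c then Mult a a (k + 1) next else Mult a k a next)
      else Hash a (\<lambda>c'. enc (after_hash ph w x y u c')))"
  using assms unfolding walking_def 
  by (elim insertE emptyE; hypsubst; simp only: instr_at.simps)

definition machine :: machine where
  "machine = \<lparr>registers = k + entries + r + 7, states = card Q,
              program = (\<lambda>p. instr_at (inv_into Q enc p))\<rparr>"

section \<open>Numbering of the control states and well-formedness\<close>

lemma finite_Q: "finite Q"
  unfolding Q_def using finite_words by (intro finite_cartesian_product) (auto simp: UNIV_phase)

lemma card_Q: "card Q = 9 * (entries + r + 3) * card (words k) ^ 4"
proof -
  have "card (UNIV :: phase set) = 9" by (simp add: UNIV_phase)
  thus ?thesis unfolding Q_def by (simp add: card_cartesian_product power4_eq_xxxx)
qed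

lemma start_in_Q: "start \<in> Q"
  unfolding start_def Q_def using Inl_empty_in_words by auto

lemma enc: "bij_betw enc Q {..<card Q}" "enc start = 0"
proof -
  obtain e where e: "bij_betw e Q {0..<card Q}" using ex_bij_betw_finite_nat[OF finite_Q] by blast
  let ?N = "{..<card Q}"
  have N: "e start \<in> ?N" "0 \<in> ?N"
    using e start_in_Q finite_Q by (auto simp: bij_betw_def card_gt_0_iff)
  \<comment> \<open>Machines start in control state 0, so the code of \<open>start\<close> is
    exchanged with 0.\<close>
  have "bij_betw (Transposition.transpose (e start) 0) ?N ?N"
    using N by (simp add: bij_betw_transpose_iff)
  hence "bij_betw (Transposition.transpose (e start) 0 \<circ> e) Q ?N"
    using e by (intro bij_betw_trans) (auto simp: lessThan_atLeast0)
  hence "\<exists>e. bij_betw e Q ?N \<and> e start = 0" 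
    by (intro exI[of _ "Transposition.transpose (e start) 0 \<circ> e"]) simp
  hence "bij_betw enc Q ?N \<and> enc start = 0" unfolding enc_def by (rule someI_ex)
  thus "bij_betw enc Q {..<card Q}" "enc start = 0" by auto
qed

lemma program_enc: "q \<in> Q \<Longrightarrow> program machine (enc q) = instr_at q"
  using enc(1) by (simp add: machine_def bij_betw_def inv_into_f_f)

lemma enc_less: "q \<in> Q \<Longrightarrow> enc q < card Q"
  using enc(1) by (auto simp: bij_betw_def)

lemma block_less: "set_encode (block c \<beta>) < 2 ^ b"
proof -
  have "set_encode (block c \<beta>) \<le> set_encode {..<b}"
    unfolding block_def set_encode_def by (auto intro!: sum_mono2)
  also have "\<dots> = (\<Sum>i<b. 2 ^ i)" by (simp add: set_encode_def)
  also have "(\<Sum>i<m. 2 ^ i) < (2::nat) ^ m" for m by (induction m) auto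
  finally show ?thesis .
qed

lemma entry_less: "\<beta> < r \<Longrightarrow> entry c \<beta> < entries"
proof -
  assume "\<beta> < r"
  hence "(\<beta> + 1) * 2 ^ b \<le> r * 2 ^ b" by (intro mult_right_mono) auto
  thus ?thesis using block_less[of c \<beta>] unfolding entry_def entries_def by simp
qed

lemma entries_pos: "entries > 0" unfolding entries_def using r_pos by simp

lemma after_hash_in_Q:
  assumes "w \<in> words k" "x \<in> words k" "y \<in> words k" "u \<in> words k" "c \<in> words k"
  shows "after_hash ph w x y u c \<in> Q"
  using assms by (cases ph) (auto simp: Q_def)

lemma well_formed_machine: "well_formed k machine"
proof -
  have ok: "instr_ok k (k + entries + r + 7) (card Q) (instr_at q)" if q: "q \<in> Q" for q
  proof -
    obtain ph v w x y u where q_eq: "q = (ph, v, w, x, y, u)" by (cases q)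
    have v: "v < entries + r + 3" and
      W: "w \<in> words k" "x \<in> words k" "y \<in> words k" "u \<in> words k"
      using q by (auto simp: Q_def q_eq)
    have in_Q: "(ph', v', w', x', y', u') \<in> Q"
      if "v' < entries + r + 3" "w' \<in> words k" "x' \<in> words k" "y' \<in> words k" "u' \<in> words k"
      for ph' v' w' x' y' u'
      using that by (simp add: Q_def)
    have hash: "\<forall>c\<in>words k. enc (after_hash ph w x y u c) < card Q"
      using W after_hash_in_Q enc_less by blast
    have tab_ok: "tab (entry c v) < k + entries + r + 7" if "v < r" for c
      using entry_less[OF that, of c] by (simp add: tab_def)
    show ?thesis
    proof (cases "walking ph")
      case True
      thus ?thesis using W v r_pos hash tab_ok[of "target ph x y"]
        unfolding q_eq by (auto simp: instr_at_walking Let_def acc_def intro!: enc_less in_Q)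
    next
      case False
      thus ?thesis using W v entries_pos out_set_subset[OF W(2,3)] unfolding q_eq
        by (cases ph) (auto simp: walking_def Let_def tab_def intro!: enc_less in_Q)
    qed
  qed
  have "program machine p = instr_at (inv_into Q enc p)" for p by (simp add: machine_def)
  moreover have "inv_into Q enc p \<in> Q" if "p < card Q" for p
    using that enc(1) by (intro inv_into_into) (auto simp: bij_betw_def)
  ultimately show ?thesis
    using ok enc_less[OF start_in_Q] unfolding well_formed_def machine_def by auto
qed

lemma r_b: "k \<le> r * b"
proof -
  have "k = r * (k div r) + k mod r" by simp
  moreover have "k mod r < r" using r_pos by simp
  ultimately show ?thesis unfolding b_def distrib_left by linarith
qed

end


section \<open>Runs of the machine\<close>

text \<open>The stream of draws is fixed and arbitrary, because the implementation property concerns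
  all streams.\<close>

locale machine_run = table_machine k r + group G
  for k r :: nat and G :: "('a, 'b) monoid_scheme" (structure) +
  fixes S :: "'a list" and z :: 'a and \<omega> :: "'a draw stream"
  assumes len: "length S = k" and S_in: "set S \<subseteq> carrier G" and z_in: "z \<in> carrier G"
    and draws_in: "\<omega> \<in> streams (draw_set G k)"
begin

abbreviation \<pi> :: "word \<Rightarrow> 'a" where "\<pi> \<equiv> word_prod G S z"

abbreviation sub :: "nat set \<Rightarrow> 'a" where "sub I \<equiv> gprod G (nths S I)"

definition orbit :: "'a draw \<Rightarrow> nat \<Rightarrow> word" where
  "orbit d m = ((snd d \<circ> \<pi>) ^^ m) (fst d)"

abbreviation tail :: "'a draw \<Rightarrow> nat" where "tail d \<equiv> tail_length (snd d \<circ> \<pi>) (fst d)"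

abbreviation rho :: "'a draw \<Rightarrow> nat" where "rho d \<equiv> rho_length (snd d \<circ> \<pi>) (fst d)"

lemma orbit_0: "orbit d 0 = fst d" and orbit_Suc: "orbit d (Suc m) = snd d (\<pi> (orbit d m))"
  by (simp_all add: orbit_def)

lemma sub_closed [simp]: "sub I \<in> carrier G"
  using S_in set_nths_subset[of S I] by (intro gprod_closed) blast

lemma support_subset: "c \<in> words k \<Longrightarrow> support c \<subseteq> {..<k}"
  unfolding words_def support_def by fastforce

lemma word_prod_support:
  assumes "c \<in> words k"
  shows "\<pi> c = (if isl c then sub (support c) else z \<otimes> inv (sub (support c)))"
proof (cases c)
  case (Inl I)
  hence "I \<subseteq> {..<half k}" using assms by (auto simp: words_def)
  thus ?thesis using Inl by (simp add: word_prod_def support_def len nths_take)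
next
  case (Inr J)
  have "set (nths (drop (half k) S) J) \<subseteq> carrier G"
    using S_in set_nths_subset[of "drop (half k) S" J] set_drop_subset[of "half k" S] by blast
  thus ?thesis using Inr
    by (simp add: word_prod_def support_def len gprod_mu) (simp add: nths_drop)
qed

lemma word_prod_closed: "c \<in> words k \<Longrightarrow> \<pi> c \<in> carrier G"
  using word_prod_support z_in by simp

lemma hash_in_words:
  assumes "d \<in> draw_set G k" "g \<in> carrier G"
  shows "snd d g \<in> words k"
  using assms unfolding draw_set_def by (auto simp: PiE_def Pi_def)

lemma orbit_in: "d \<in> draw_set G k \<Longrightarrow> orbit d m \<in> words k"
  by (induction m) (auto simp: orbit_0 orbit_Suc hash_in_words word_prod_closed,
      auto simp: draw_set_def)

lemma periodic: "d \<in> draw_set G k \<Longrightarrow> periodic_orbit (snd d \<circ> \<pi>) (fst d)"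
  using hash_in_words word_prod_closed orbit_in[of d 0]
  unfolding orbit_0 by (intro periodic_orbit_finite[OF finite_words[of k]]) auto

lemma draw_in: "\<omega> !! m \<in> draw_set G k"
  using draws_in by (simp add: streams_iff_snth)

lemma pollard_pass_alt:
  "pollard_pass G S z d =
     (if tail d = 0 then None
      else let s = orbit d (rho d - 1); t = orbit d (tail d - 1)
           in if \<pi> s = \<pi> t \<and> isl t \<noteq> isl s then Some (out_set k t s) else None)"
proof -
  have case_eq: "(case s of Inl I \<Rightarrow> (case t of Inl _ \<Rightarrow> None | Inr J \<Rightarrow> Some (join_indices (length S) I J))
       | Inr J \<Rightarrow> (case t of Inl I \<Rightarrow> Some (join_indices (length S) I J) | Inr _ \<Rightarrow> None)) =
     (if isl t \<noteq> isl s then Some (out_set k t s) else None)" for s t :: word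
    by (cases s; cases t) (simp_all add: len)
  show ?thesis
    unfolding pollard_pass_def case_prod_unfold Let_def rho_length_def fst_conv snd_conv
      cycle_length_def[symmetric] tail_length_def[symmetric] case_eq orbit_def by simp
qed


subsection \<open>Table entries and partial products\<close>

definition tab_value :: "nat \<Rightarrow> 'a" where
  "tab_value v = sub ((\<lambda>i. v div 2 ^ b * b + i) ` set_decode (v mod 2 ^ b))"

lemma sub_Un:
  assumes "X \<subseteq> {..<q}" "Y \<subseteq> {q..}"
  shows "sub (X \<union> Y) = sub X \<otimes> sub Y"
  unfolding nths_Un_split[OF assms]
  using S_in set_nths_subset[of S X] set_nths_subset[of S Y] by (intro gprod_append) auto

lemma sub_singleton: "sub {q} = (if q < k then S ! q else \<one>)"
proof (cases "q < k")
  case True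
  hence "S ! q \<in> carrier G" using S_in nth_mem[of q S] len by blast
  thus ?thesis using True by (simp add: nths_singleton_index len)
qed (simp add: nths_singleton_index len)

lemma tab_value_0: "v mod 2 ^ b = 0 \<Longrightarrow> tab_value v = \<one>"
  by (simp add: tab_value_def)

text \<open>The largest index comes last in an ordered product, so clearing the highest bit splits
  off the rightmost factor.\<close>

lemma tab_value_rec:
  fixes v :: nat
  assumes "v mod 2 ^ b \<noteq> 0"
  defines "t \<equiv> Max (set_decode (v mod 2 ^ b))"
  defines "q \<equiv> v div 2 ^ b * b + t"
  shows "tab_value v = tab_value (v - 2 ^ t) \<otimes> (if q < k then S ! q else \<one>)" "v - 2 ^ t < v"
proof -
  let ?m = "v mod 2 ^ b"
  let ?X = "set_decode ?m - {t}"
  have ne: "set_decode ?m \<noteq> {}"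
    using assms(1) by (metis set_decode_inverse set_encode_empty)
  have t: "t \<in> set_decode ?m" unfolding t_def using ne by (intro Max_in) auto
  have less: "x < t" if "x \<in> ?X" for x
    using that Max_ge[of "set_decode ?m" x] unfolding t_def by fastforce
  have ins: "set_decode ?m = insert t ?X" using t by blast
  have "set_encode (set_decode ?m) = set_encode (insert t ?X)" using ins by (rule arg_cong)
  also have "\<dots> = 2 ^ t + set_encode ?X" by (rule set_encode_insert) auto
  finally have m: "?m = 2 ^ t + set_encode ?X" by (simp only: set_decode_inverse)
  have "?m - 2 ^ t = set_encode ?X" using m by linarith
  hence dec: "set_decode (?m - 2 ^ t) = ?X"
    by (simp only: set_encode_inverse finite_Diff finite_set_decode)
  have v: "v = v div 2 ^ b * 2 ^ b + ?m" by (rule div_mult_mod_eq[symmetric])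
  have le: "2 ^ t \<le> ?m" using m by linarith
  have small: "?m - 2 ^ t < 2 ^ b" by (rule le_less_trans[of _ ?m]) auto
  \<comment> \<open>There is no borrow, since \<open>2 ^ t\<close> is at most the mask; the block
    number stays the same.\<close>
  have "v - 2 ^ t = v div 2 ^ b * 2 ^ b + (?m - 2 ^ t)" using v le by linarith
  hence d: "(v - 2 ^ t) div 2 ^ b = v div 2 ^ b" "(v - 2 ^ t) mod 2 ^ b = ?m - 2 ^ t"
    using small by simp_all
  have "(\<lambda>i. v div 2 ^ b * b + i) ` set_decode ?m = (\<lambda>i. v div 2 ^ b * b + i) ` ?X \<union> {q}"
    using t unfolding q_def by blast
  hence "tab_value v = sub ((\<lambda>i. v div 2 ^ b * b + i) ` ?X \<union> {q})"
    unfolding tab_value_def by (simp only:)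
  also have "\<dots> = sub ((\<lambda>i. v div 2 ^ b * b + i) ` ?X) \<otimes> sub {q}"
  proof (rule sub_Un[of _ q])
    show "(\<lambda>i. v div 2 ^ b * b + i) ` ?X \<subseteq> {..<q}"
      by (rule image_subsetI) (simp only: q_def lessThan_iff add_less_cancel_left less)
  qed simp
  also have "sub ((\<lambda>i. v div 2 ^ b * b + i) ` ?X) = tab_value (v - 2 ^ t)"
    unfolding tab_value_def d dec ..
  finally show "tab_value v = tab_value (v - 2 ^ t) \<otimes> (if q < k then S ! q else \<one>)"
    by (simp add: sub_singleton)
  have "2 ^ t > (0::nat)" by simp
  moreover have "2 ^ t \<le> v" using le v by linarith
  ultimately show "v - 2 ^ t < v" by linarith
qed

text \<open>The content of the accumulator after each operation: \<open>r\<close> table factors, the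
  possible inversion, the possible factor \<open>z\<close>.\<close>

definition partial_prod :: "word \<Rightarrow> nat \<Rightarrow> 'a" where
  "partial_prod c \<beta> =
     (if \<beta> \<le> r then sub (support c \<inter> {..<\<beta> * b})
      else if \<beta> = r + 1 then (if isl c then sub (support c) else inv (sub (support c)))
      else \<pi> c)"

lemma partial_prod_0: "partial_prod c 0 = \<one>"
  by (simp add: partial_prod_def)

lemma partial_prod_Suc:
  assumes "\<beta> < r"
  shows "partial_prod c (Suc \<beta>) = partial_prod c \<beta> \<otimes> tab_value (entry c \<beta>)"
proof -
  have fin: "finite (block c \<beta>)" unfolding block_def by simp
  have e: "entry c \<beta> div 2 ^ b = \<beta>" "entry c \<beta> mod 2 ^ b = set_encode (block c \<beta>)"
    using block_less[of c \<beta>] unfolding entry_def by simp_all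
  have split: "support c \<inter> {..<Suc \<beta> * b} =
        (support c \<inter> {..<\<beta> * b}) \<union> (\<lambda>i. \<beta> * b + i) ` block c \<beta>" (is "?L = ?R")
  proof (intro equalityI subsetI)
    fix x assume x: "x \<in> ?L"
    show "x \<in> ?R"
    proof (cases "x < \<beta> * b")
      case False
      hence "x = \<beta> * b + (x - \<beta> * b)" "x - \<beta> * b \<in> block c \<beta>"
        using x by (auto simp: block_def)
      thus ?thesis by blast
    qed (use x in simp)
  qed (auto simp: block_def)
  have "sub (support c \<inter> {..<Suc \<beta> * b}) =
        sub (support c \<inter> {..<\<beta> * b}) \<otimes> sub ((\<lambda>i. \<beta> * b + i) ` block c \<beta>)"
    unfolding split by (rule sub_Un[of _ "\<beta> * b"]) auto
  moreover have "Suc \<beta> \<le> r" "\<beta> \<le> r" using assms by auto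
  ultimately show ?thesis
    unfolding partial_prod_def tab_value_def e set_encode_inverse[OF fin] by (simp only: if_True)
qed

lemma partial_prod_all: "c \<in> words k \<Longrightarrow> partial_prod c r = sub (support c)"
proof -
  assume "c \<in> words k"
  hence "support c \<inter> {..<r * b} = support c" using support_subset[of c] r_b by fastforce
  thus ?thesis unfolding partial_prod_def by (simp only: if_True order_refl)
qed


subsection \<open>Cycle finding\<close>

text \<open>The last argument is at least the number of products evaluated so far in the pass.\<close>

fun walk_inv :: "phase \<Rightarrow> 'a draw \<Rightarrow> word \<Rightarrow> word \<Rightarrow> word \<Rightarrow> nat \<Rightarrow> bool" where
  "walk_inv Tortoise d x y u e \<longleftrightarrow> (\<exists>p. x = orbit d p \<and> y = orbit d (2 * p) \<and>
     (\<forall>q. 0 < q \<and> q \<le> p \<longrightarrow> orbit d q \<noteq> orbit d (2 * q)) \<and> e = 3 * p)"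
| "walk_inv Hare d x y u e \<longleftrightarrow> (\<exists>p. x = orbit d (p + 1) \<and> y = orbit d (2 * p) \<and>
     (\<forall>q. 0 < q \<and> q \<le> p \<longrightarrow> orbit d q \<noteq> orbit d (2 * q)) \<and> e = 3 * p + 1)"
| "walk_inv Hare2 d x y u e \<longleftrightarrow> (\<exists>p. x = orbit d (p + 1) \<and> y = orbit d (2 * p + 1) \<and>
     (\<forall>q. 0 < q \<and> q \<le> p \<longrightarrow> orbit d q \<noteq> orbit d (2 * q)) \<and> e = 3 * p + 2)"
| "walk_inv Tail_Tortoise d x y u e \<longleftrightarrow> (\<exists>p m. m > 0 \<and> orbit d m = orbit d (2 * m) \<and>
     x = orbit d p \<and> y = orbit d (m + p) \<and>
     (\<forall>q\<le>p. orbit d q \<noteq> orbit d (m + q)) \<and> e = 3 * rho d + 2 * p)"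
| "walk_inv Tail_Hare d x y u e \<longleftrightarrow> (\<exists>p m. m > 0 \<and> orbit d m = orbit d (2 * m) \<and>
     x = orbit d p \<and> y = orbit d (m + p) \<and> u = orbit d (p + 1) \<and>
     (\<forall>q\<le>p. orbit d q \<noteq> orbit d (m + q)) \<and> e = 3 * rho d + 2 * p + 1)"
| "walk_inv _ d x y u e \<longleftrightarrow> False"

lemma unmet_less_rho:
  assumes "d \<in> draw_set G k" "\<forall>q. 0 < q \<and> q \<le> p \<longrightarrow> orbit d q \<noteq> orbit d (2 * q)"
  shows "p < rho d"
  using assms(2) periodic_orbit.floyd_bound[OF periodic[OF assms(1)], of p]
  unfolding orbit_def by blast

lemma apart_less_tail:
  assumes "d \<in> draw_set G k" "m > 0" "orbit d m = orbit d (2 * m)"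
    "\<forall>q\<le>p. orbit d q \<noteq> orbit d (m + q)"
  shows "p < tail d"
  using periodic_orbit.floyd_meeting(1)[OF periodic[OF assms(1)] assms(2) assms(3)[unfolded orbit_def], of p]
    assms(4) unfolding orbit_def by (meson linorder_not_le order_refl)

lemma tail_less_rho: "d \<in> draw_set G k \<Longrightarrow> tail d < rho d"
  using periodic_orbit.cycle_props(1)[OF periodic, of d] unfolding rho_length_def by simp

text \<open>The search for a meeting takes three evaluations per tortoise move and less than
  \<open>rho d\<close> moves without meeting; the tail search takes two per move and at most
  \<open>tail d\<close> moves. Together this gives the 5.\<close>

lemma walk_inv_bound:
  assumes d: "d \<in> draw_set G k" and inv: "walk_inv ph d x y u e"
  shows "e + 1 \<le> 5 * rho d"
proof -
  have unmet: "3 * p + 3 \<le> 5 * rho d"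
    if "\<forall>q. 0 < q \<and> q \<le> p \<longrightarrow> orbit d q \<noteq> orbit d (2 * q)" for p
    using unmet_less_rho[OF d that] by simp
  have apart: "3 * rho d + 2 * p + 2 \<le> 5 * rho d"
    if "m > 0" "orbit d m = orbit d (2 * m)" "\<forall>q\<le>p. orbit d q \<noteq> orbit d (m + q)" for p m
    using apart_less_tail[OF d that] tail_less_rho[OF d] by simp
  show ?thesis
  proof (cases ph)
    case Tortoise
    with inv obtain p where p: "\<forall>q. 0 < q \<and> q \<le> p \<longrightarrow> orbit d q \<noteq> orbit d (2 * q)" "e = 3 * p" by auto
    thus ?thesis using unmet[OF p(1)] p(2) by linarith
  next
    case Hare
    with inv obtain p where p: "\<forall>q. 0 < q \<and> q \<le> p \<longrightarrow> orbit d q \<noteq> orbit d (2 * q)" "e = 3 * p + 1" by auto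
    thus ?thesis using unmet[OF p(1)] p(2) by linarith
  next
    case Hare2
    with inv obtain p where p: "\<forall>q. 0 < q \<and> q \<le> p \<longrightarrow> orbit d q \<noteq> orbit d (2 * q)" "e = 3 * p + 2" by auto
    thus ?thesis using unmet[OF p(1)] p(2) by linarith
  next
    case Tail_Tortoise
    with inv obtain p m where p: "m > 0" "orbit d m = orbit d (2 * m)"
      "\<forall>q\<le>p. orbit d q \<noteq> orbit d (m + q)" "e = 3 * rho d + 2 * p" by auto
    thus ?thesis using apart[OF p(1-3)] p(4) by linarith
  next
    case Tail_Hare
    with inv obtain p m where p: "m > 0" "orbit d m = orbit d (2 * m)"
      "\<forall>q\<le>p. orbit d q \<noteq> orbit d (m + q)" "e = 3 * rho d + 2 * p + 1" by auto
    thus ?thesis using apart[OF p(1-3)] p(4) by linarith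
  qed (use inv in simp_all)
qed

lemma walk_inv_target:
  assumes "walk_inv ph d x y u e"
  shows "\<exists>i. target ph x y = orbit d i"
  using assms by (cases ph) (auto simp: target_def)

lemma walk_inv_start: "walk_inv Tortoise d (fst d) (fst d) u 0"
  unfolding walk_inv.simps by (rule exI[of _ 0]) (auto simp: orbit_0)

text \<open>The new count may exceed \<open>e + 1\<close>, because entering the tail search raises
  it to the full charge for the first search.\<close>

lemma walk_inv_after_hash:
  assumes d: "d \<in> draw_set G k" and inv: "walk_inv ph d x y u e"
    and st: "after_hash ph (fst d) x y u (snd d (\<pi> (target ph x y))) = (ph', v', w', x', y', u')"
  shows "v' = 0 \<and> w' = fst d \<and>
     (walking ph' \<and> (\<exists>e'\<ge>e + 1. walk_inv ph' d x' y' u' e') \<and>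
        (ph' = Tail_Hare \<longrightarrow> ph = Tail_Tortoise \<and> x' = x) \<or>
      ph' = Restart \<and> tail d = 0 \<or>
      ph' = Compare \<and> ph = Tail_Hare \<and> x' = x \<and> y' = y \<and> tail d > 0 \<and>
        x' = orbit d (tail d - 1) \<and> y' = orbit d (rho d - 1))" (is ?goal)
proof (cases ph)
  case Tortoise
  then obtain p where p: "x = orbit d p" "y = orbit d (2 * p)"
    "\<forall>q. 0 < q \<and> q \<le> p \<longrightarrow> orbit d q \<noteq> orbit d (2 * q)" "e = 3 * p" using inv by auto
  have "snd d (\<pi> (target ph x y)) = orbit d (p + 1)"
    by (simp add: target_def Tortoise p(1) orbit_Suc)
  hence st': "(ph', v', w', x', y', u') = (Hare, 0, fst d, orbit d (p + 1), y, u)"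
    using st Tortoise by simp
  have "walk_inv Hare d (orbit d (p + 1)) y u (e + 1)"
    unfolding walk_inv.simps using p by (intro exI[of _ p]) simp
  thus ?goal using st' by (auto simp: walking_def simp del: walk_inv.simps)
next
  case Hare
  then obtain p where p: "x = orbit d (p + 1)" "y = orbit d (2 * p)"
    "\<forall>q. 0 < q \<and> q \<le> p \<longrightarrow> orbit d q \<noteq> orbit d (2 * q)" "e = 3 * p + 1" using inv by auto
  have "snd d (\<pi> (target ph x y)) = orbit d (2 * p + 1)"
    by (simp add: target_def Hare p(2) orbit_Suc)
  hence st': "(ph', v', w', x', y', u') = (Hare2, 0, fst d, x, orbit d (2 * p + 1), u)"
    using st Hare by simp
  have "walk_inv Hare2 d x (orbit d (2 * p + 1)) u (e + 1)"
    unfolding walk_inv.simps using p by (intro exI[of _ p]) simp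
  thus ?goal using st' by (auto simp: walking_def simp del: walk_inv.simps)
next
  case Hare2
  then obtain p where p: "x = orbit d (p + 1)" "y = orbit d (2 * p + 1)"
    "\<forall>q. 0 < q \<and> q \<le> p \<longrightarrow> orbit d q \<noteq> orbit d (2 * q)" "e = 3 * p + 2" using inv by auto
  define c where "c = orbit d (2 * (p + 1))"
  have c: "snd d (\<pi> (target ph x y)) = c"
    by (simp add: target_def Hare2 p(2) orbit_Suc c_def)
  show ?goal
  proof (cases "x = c")
    case False
    have "orbit d q \<noteq> orbit d (2 * q)" if "0 < q" "q \<le> p + 1" for q
    proof (cases "q = p + 1")
      case True
      thus ?thesis using False p(1) by (simp only: c_def) simp
    next
      case False
      thus ?thesis using p(3)[rule_format, of q] that by linarith
    qed
    hence "walk_inv Tortoise d x c u (e + 1)"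
      unfolding walk_inv.simps using p(1,4) c_def by (intro exI[of _ "p + 1"]) simp
    moreover have "(ph', v', w', x', y', u') = (Tortoise, 0, fst d, x, c, u)"
        using st[unfolded c, unfolded Hare2, symmetric] False by (simp only: after_hash.simps if_True if_False refl)
    ultimately show ?thesis by (auto simp: walking_def simp del: walk_inv.simps)
  next
    case True
    have m: "p + 1 > 0" "orbit d (p + 1) = orbit d (2 * (p + 1))"
      using True p(1) by (simp_all add: c_def)
    note meet = periodic_orbit.floyd_meeting(1)[OF periodic[OF d] m[unfolded orbit_def], folded orbit_def]
    show ?thesis
    proof (cases "fst d = c")
      case T: True
      hence "orbit d 0 = orbit d (p + 1 + 0)" using True p(1) by (simp add: orbit_0)
      hence "tail d = 0" using meet[of 0] by blast
      thus ?thesis using st[unfolded c, unfolded Hare2] True T by simp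
    next
      case F: False
      hence "orbit d 0 \<noteq> orbit d (p + 1 + 0)" using True p(1) by (simp add: orbit_0)
      hence "walk_inv Tail_Tortoise d (fst d) c u (3 * rho d)"
        unfolding walk_inv.simps using m True p(1)
        by (intro exI[of _ 0] exI[of _ "p + 1"]) (simp add: orbit_0)
      \<comment> \<open>Charging the worst case of the first search frees the later count from the
        place where the walkers met.\<close>
      moreover have "e + 1 \<le> 3 * rho d" using unmet_less_rho[OF d p(3)] p(4) by simp
      moreover have "(ph', v', w', x', y', u') = (Tail_Tortoise, 0, fst d, fst d, c, u)"
        using st[unfolded c, unfolded Hare2, symmetric] True F by (simp only: after_hash.simps if_True if_False refl)
      ultimately show ?thesis by (auto simp: walking_def simp del: walk_inv.simps)
    qed
  qed
next
  case Tail_Tortoise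
  then obtain p m where p: "m > 0" "orbit d m = orbit d (2 * m)" "x = orbit d p" "y = orbit d (m + p)"
    "\<forall>q\<le>p. orbit d q \<noteq> orbit d (m + q)" "e = 3 * rho d + 2 * p" using inv by auto
  have "snd d (\<pi> (target ph x y)) = orbit d (p + 1)"
    by (simp add: target_def Tail_Tortoise p(3) orbit_Suc)
  hence st': "(ph', v', w', x', y', u') = (Tail_Hare, 0, fst d, x, y, orbit d (p + 1))"
    using st Tail_Tortoise by simp
  have "walk_inv Tail_Hare d x y (orbit d (p + 1)) (e + 1)"
    unfolding walk_inv.simps using p by (intro exI[of _ p] exI[of _ m]) simp
  thus ?goal using st' Tail_Tortoise by (auto simp: walking_def simp del: walk_inv.simps)
next
  case Tail_Hare
  then obtain p m where p: "m > 0" "orbit d m = orbit d (2 * m)" "x = orbit d p" "y = orbit d (m + p)"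
    "u = orbit d (p + 1)" "\<forall>q\<le>p. orbit d q \<noteq> orbit d (m + q)" "e = 3 * rho d + 2 * p + 1"
    using inv by auto
  define c where "c = orbit d (m + (p + 1))"
  have c: "snd d (\<pi> (target ph x y)) = c"
    by (simp add: target_def Tail_Hare p(4) orbit_Suc c_def)
  note meet = periodic_orbit.floyd_meeting[OF periodic[OF d] p(1) p(2)[unfolded orbit_def],
      folded orbit_def]
  show ?goal
  proof (cases "u = c")
    case True
    \<comment> \<open>Agreement at \<open>p + 1\<close> bounds the tail from above; disagreement up
      to \<open>p\<close> bounds it from below.\<close>
    have "tail d \<le> p + 1" using True p(5) meet(1)[of "p + 1"] by (simp add: c_def)
    moreover have "p < tail d" by (rule apart_less_tail[OF d p(1,2,6)])
    ultimately have t: "tail d = p + 1" by simp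
    hence y: "y = orbit d (rho d - 1)" using meet(2) p(4) by simp
    have "(ph', v', w', x', y', u') = (Compare, 0, fst d, x, y, u)"
        using st[unfolded c, unfolded Tail_Hare, symmetric] True by (simp only: after_hash.simps if_True if_False refl)
    thus ?thesis using Tail_Hare t p(3) y by simp
  next
    case False
    have "orbit d q \<noteq> orbit d (m + q)" if "q \<le> p + 1" for q
    proof (cases "q = p + 1")
      case True
      thus ?thesis using False p(5) by (simp only: c_def) simp
    next
      case False
      thus ?thesis using p(6)[rule_format, of q] that by linarith
    qed
    hence "walk_inv Tail_Tortoise d u c u (e + 1)"
      unfolding walk_inv.simps using p(1,2,5,7) c_def
      by (intro exI[of _ "p + 1"] exI[of _ m]) simp
    moreover have "(ph', v', w', x', y', u') = (Tail_Tortoise, 0, fst d, u, c, u)"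
        using st[unfolded c, unfolded Tail_Hare, symmetric] False by (simp only: after_hash.simps if_True if_False refl)
    ultimately show ?thesis by (auto simp: walking_def simp del: walk_inv.simps)
  qed
qed (use inv in simp_all)

end


context machine_run
begin

subsection \<open>The invariant\<close>

abbreviation pass :: "'a draw \<Rightarrow> nat set option" where "pass \<equiv> pollard_pass G S z"

definition base_regs :: "(nat \<Rightarrow> 'a) \<Rightarrow> bool" where
  "base_regs R \<longleftrightarrow> (\<forall>i<k. R i = S ! i) \<and> R k = z \<and> R (k + 1) = \<one>"

definition table_upto :: "(nat \<Rightarrow> 'a) \<Rightarrow> nat \<Rightarrow> bool" where
  "table_upto R v \<longleftrightarrow> (\<forall>i<v. R (tab i) = tab_value i)"

text \<open>At most \<open>5 * rho d\<close> evaluations of \<open>r + 2\<close> operations and one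
  hashing each, plus one draw and one comparison.\<close>

definition cost :: "'a draw \<Rightarrow> nat" where
  "cost d = 5 * (r + 3) * rho d + 2"

text \<open>Bounds the number of all steps, including those that are free of charge, so that
  exceeding it forces a halt.\<close>

definition budget :: "nat \<Rightarrow> nat" where
  "budget m = entries + (\<Sum>i<m. cost (\<omega> !! i))"

definition common_inv :: "'a config \<Rightarrow> bool" where
  "common_inv c \<longleftrightarrow> future c = sdrop (draws c) \<omega> \<and>
     (draws c > 0 \<longrightarrow> current c = \<omega> !! (draws c - 1)) \<and>
     (\<forall>i < draws c - 1. pass (\<omega> !! i) = None) \<and> base_regs (regs c)"

text \<open>The 1 in the bound is the draw. For \<open>v = 0\<close> the accumulator still holds an
  old value, which the first multiplication overwrites. The last clause keeps the tortoise's product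
  for the comparison.\<close>

definition walking_inv :: "nat \<Rightarrow> 'a config \<Rightarrow> mstate \<Rightarrow> bool" where
  "walking_inv t c = (\<lambda>(ph, v, w, x, y, u). let d = \<omega> !! (draws c - 1) in
     draws c > 0 \<and> w = fst d \<and> time c \<le> t \<and> table_upto (regs c) entries \<and> v < r + 3 \<and>
     (\<exists>e. walk_inv ph d x y u e \<and> t \<le> budget (draws c - 1) + 1 + (r + 3) * e + v) \<and>
     (v > 0 \<longrightarrow> regs c (acc ph) = partial_prod (target ph x y) v) \<and>
     (ph = Tail_Hare \<longrightarrow> regs c (k + 2) = \<pi> x))"

text \<open>In \<open>Output\<close> only the time is bounded: \<open>t\<close> keeps growing while
  the machine stands still.\<close>

fun resting_inv :: "nat \<Rightarrow> 'a config \<Rightarrow> mstate \<Rightarrow> bool" where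
  "resting_inv t c (Precompute, v, w, x, y, u) \<longleftrightarrow>
     draws c = 0 \<and> t = v \<and> v < entries \<and> time c \<le> t \<and> table_upto (regs c) v"
| "resting_inv t c (Restart, v, w, x, y, u) \<longleftrightarrow>
     t \<le> budget (draws c) \<and> time c \<le> t \<and> table_upto (regs c) entries \<and>
     (\<forall>i < draws c. pass (\<omega> !! i) = None)"
| "resting_inv t c (Compare, v, w, x, y, u) \<longleftrightarrow> (let d = \<omega> !! (draws c - 1) in
     draws c > 0 \<and> t + 1 \<le> budget (draws c - 1) + cost d \<and> time c \<le> t \<and>
     table_upto (regs c) entries \<and> tail d > 0 \<and>
     x = orbit d (tail d - 1) \<and> y = orbit d (rho d - 1) \<and>
     regs c (k + 2) = \<pi> x \<and> regs c (k + 3) = \<pi> y)"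
| "resting_inv t c (Output, v, w, x, y, u) \<longleftrightarrow>
     draws c > 0 \<and> time c \<le> budget (draws c) \<and>
     pass (\<omega> !! (draws c - 1)) = Some (out_set k x y)"
| "resting_inv t c _ \<longleftrightarrow> False"

definition inv_at :: "nat \<Rightarrow> 'a config \<Rightarrow> mstate \<Rightarrow> bool" where
  "inv_at t c q \<longleftrightarrow> q \<in> Q \<and> control c = enc q \<and> common_inv c \<and>
     (if walking (fst q) then walking_inv t c q else resting_inv t c q)"

section \<open>Preservation of the invariant by each kind of step\<close>

lemma base_regs_update: "base_regs R \<Longrightarrow> i > k + 1 \<Longrightarrow> base_regs (R(i := g))"
  unfolding base_regs_def by auto

lemma table_upto_update: "table_upto R v \<Longrightarrow> i < k + 4 \<Longrightarrow> table_upto (R(i := g)) v"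
  unfolding table_upto_def tab_def by auto

lemma budget_Suc: "m > 0 \<Longrightarrow> budget m = budget (m - 1) + cost (\<omega> !! (m - 1))"
  unfolding budget_def by (cases m) auto

lemma inv_initial: "inv_at 0 (initial G S z \<omega>) start"
  unfolding inv_at_def
  using start_in_Q entries_pos enc(2)
  by (simp add: initial_def common_inv_def base_regs_def len start_def walking_def table_upto_def)

lemma in_Q_iff: "(ph, v, w, x, y, u) \<in> Q \<longleftrightarrow>
  v < entries + r + 3 \<and> w \<in> words k \<and> x \<in> words k \<and> y \<in> words k \<and> u \<in> words k"
  by (simp add: Q_def)

lemma step_precompute:
  assumes "inv_at t c (Precompute, v, w, x, y, u)"
  shows "\<exists>q. inv_at (Suc t) (step G machine c) q"
proof -
  have q: "(Precompute, v, w, x, y, u) \<in> Q" and ctrl: "control c = enc (Precompute, v, w, x, y, u)"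
    and com: "common_inv c" and inv: "draws c = 0" "t = v" "v < entries" "time c \<le> t" "table_upto (regs c) v"
    using assms by (auto simp: inv_at_def walking_def)
  define q' where "q' = (if v + 1 < entries then (Precompute, v + 1, w, x, y, u)
                         else (Restart, 0, w, x, y, u))"
  have base: "base_regs (regs c)" using com by (simp add: common_inv_def)
  have step: "step G machine c =
    c\<lparr>control := enc q', regs := (regs c)(tab v := tab_value v), time := time c + 1\<rparr>"
  proof (cases "v mod 2 ^ b = 0")
    case True
    have "regs c (k + 1) = \<one>" using base by (simp add: base_regs_def)
    thus ?thesis using True tab_value_0[OF True]
      unfolding step_def ctrl program_enc[OF q] q'_def by (simp add: Let_def)
  next
    case False
    let ?t = "Max (set_decode (v mod 2 ^ b))"
    let ?q = "v div 2 ^ b * b + ?t"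
    have "regs c (tab (v - 2 ^ ?t)) = tab_value (v - 2 ^ ?t)"
      using inv(5) tab_value_rec(2)[OF False] unfolding table_upto_def by blast
    moreover have "regs c (if ?q < k then ?q else k + 1) = (if ?q < k then S ! ?q else \<one>)"
      using base by (simp add: base_regs_def)
    ultimately have "tab_value v = regs c (tab (v - 2 ^ ?t)) \<otimes> regs c (if ?q < k then ?q else k + 1)"
      using tab_value_rec(1)[OF False] by simp
    thus ?thesis using False
      unfolding step_def ctrl program_enc[OF q] q'_def by (simp add: Let_def)
  qed
  have tab: "table_upto ((regs c)(tab v := tab_value v)) (Suc v)"
    using inv(5) unfolding table_upto_def tab_def by (auto simp: less_Suc_eq)
  have base': "base_regs ((regs c)(tab v := tab_value v))"
    using base by (intro base_regs_update) (auto simp: tab_def)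
  have "q' \<in> Q" using q inv(3) unfolding q'_def by (auto simp: in_Q_iff)
  moreover have "resting_inv (Suc t) (step G machine c) q'"
  proof (cases "v + 1 < entries")
    case True
    thus ?thesis using inv tab unfolding step q'_def by simp
  next
    case False
    hence "Suc v = entries" using inv(3) by simp
    thus ?thesis using inv tab unfolding step q'_def by (simp add: budget_def)
  qed
  moreover have "\<not> walking (fst q')" unfolding q'_def by (simp add: walking_def)
  moreover have "common_inv (step G machine c)" "control (step G machine c) = enc q'"
    using com base' unfolding step common_inv_def by simp_all
  ultimately have "inv_at (Suc t) (step G machine c) q'" unfolding inv_at_def by simp
  thus ?thesis by blast
qed

lemma step_restart:
  assumes "inv_at t c (Restart, v, w, x, y, u)"
  shows "\<exists>q. inv_at (Suc t) (step G machine c) q"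
proof -
  have q: "(Restart, v, w, x, y, u) \<in> Q" and ctrl: "control c = enc (Restart, v, w, x, y, u)"
    and com: "common_inv c" and inv: "t \<le> budget (draws c)" "time c \<le> t"
      "table_upto (regs c) entries" "\<forall>i < draws c. pass (\<omega> !! i) = None"
    using assms by (auto simp: inv_at_def walking_def)
  let ?d = "\<omega> !! draws c"
  let ?w = "fst ?d"
  let ?q = "(Tortoise, 0, ?w, ?w, ?w, ?w)"
  have fut: "future c = sdrop (draws c) \<omega>" using com by (simp add: common_inv_def)
  have w: "?w \<in> words k" using orbit_in[OF draw_in[of "draws c"], of 0] by (simp add: orbit_0)
  have step: "step G machine c =
    c\<lparr>control := enc ?q, current := ?d, future := sdrop (Suc (draws c)) \<omega>, draws := draws c + 1\<rparr>"
    unfolding step_def ctrl program_enc[OF q] by (simp add: fut sdrop_simps del: sdrop.simps)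
  have "?q \<in> Q" using w by (simp add: in_Q_iff)
  moreover have "walking_inv (Suc t) (step G machine c) ?q"
    using inv walk_inv_start[of ?d ?w] unfolding step walking_inv_def
    by (auto simp: Let_def simp del: walk_inv.simps intro!: exI[of _ 0])
  moreover have "common_inv (step G machine c)"
    using com inv(4) unfolding step common_inv_def by simp
  moreover have "control (step G machine c) = enc ?q" unfolding step by simp
  ultimately have "inv_at (Suc t) (step G machine c) ?q" unfolding inv_at_def by (simp add: walking_def)
  thus ?thesis by blast
qed

lemma step_compare:
  assumes "inv_at t c (Compare, v, w, x, y, u)"
  shows "\<exists>q. inv_at (Suc t) (step G machine c) q"
proof -
  let ?d = "\<omega> !! (draws c - 1)"
  have q: "(Compare, v, w, x, y, u) \<in> Q" and ctrl: "control c = enc (Compare, v, w, x, y, u)"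
    and com: "common_inv c" and inv: "draws c > 0" "t + 1 \<le> budget (draws c - 1) + cost ?d" "time c \<le> t"
     "table_upto (regs c) entries" "tail ?d > 0"
     and xy: "x = orbit ?d (tail ?d - 1)" "y = orbit ?d (rho ?d - 1)"
     "regs c (k + 2) = \<pi> x" "regs c (k + 3) = \<pi> y"
    using assms by (auto simp: inv_at_def walking_def Let_def)
  define q' where "q' = (if \<pi> x = \<pi> y \<and> isl x \<noteq> isl y then Output else Restart, 0 :: nat, w, x, y, u)"
  have bud: "budget (draws c) = budget (draws c - 1) + cost ?d" by (rule budget_Suc[OF inv(1)])
  have step: "step G machine c = c\<lparr>control := enc q'\<rparr>"
    unfolding step_def ctrl program_enc[OF q] q'_def using xy(3,4) by simp
  have pass: "pass ?d = (if \<pi> x = \<pi> y \<and> isl x \<noteq> isl y then Some (out_set k x y) else None)"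
    using inv(5) unfolding pollard_pass_alt xy(1,2) by (auto simp: Let_def)
  have "q' \<in> Q" using q unfolding q'_def by (auto simp: in_Q_iff)
  moreover have "resting_inv (Suc t) (step G machine c) q'"
  proof (cases "\<pi> x = \<pi> y \<and> isl x \<noteq> isl y")
    case True
    thus ?thesis using inv bud pass unfolding step q'_def by simp
  next
    case False
    have "pass (\<omega> !! i) = None" if "i < draws c" for i
    proof (cases "i = draws c - 1")
      case True
      thus ?thesis using pass False by simp
    next
      case False
      hence "i < draws c - 1" using that by simp
      thus ?thesis using com by (simp add: common_inv_def)
    qed
    thus ?thesis using False inv bud unfolding step q'_def by simp
  qed
  moreover have "\<not> walking (fst q')" unfolding q'_def by (simp add: walking_def)
  moreover have "common_inv (step G machine c)" "control (step G machine c) = enc q'"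
    using com unfolding step common_inv_def by simp_all
  ultimately have "inv_at (Suc t) (step G machine c) q'" unfolding inv_at_def by simp
  thus ?thesis by blast
qed

lemma step_output:
  assumes "inv_at t c (Output, v, w, x, y, u)"
  shows "\<exists>q. inv_at (Suc t) (step G machine c) q"
proof -
  have q: "(Output, v, w, x, y, u) \<in> Q" and ctrl: "control c = enc (Output, v, w, x, y, u)"
    using assms by (auto simp: inv_at_def)
  have "step G machine c = c" unfolding step_def ctrl program_enc[OF q] by simp
  moreover have "inv_at (Suc t) c (Output, v, w, x, y, u)"
    using assms by (simp add: inv_at_def walking_def)
  ultimately show ?thesis by metis
qed

lemma target_in: "x \<in> words k \<Longrightarrow> y \<in> words k \<Longrightarrow> target ph x y \<in> words k"
  by (simp add: target_def)

lemma walking_mult: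
  assumes q: "(ph, v, w, x, y, u) \<in> Q" and ctrl: "control c = enc (ph, v, w, x, y, u)"
    and ph: "walking ph" and v: "v < r + 2"
    and base: "base_regs (regs c)" and tab: "table_upto (regs c) entries"
    and acc: "v > 0 \<longrightarrow> regs c (acc ph) = partial_prod (target ph x y) v"
  shows "step G machine c = c\<lparr>control := enc (ph, v + 1, w, x, y, u),
     regs := (regs c)(acc ph := partial_prod (target ph x y) (v + 1)), time := time c + 1\<rparr>"
proof -
  let ?c = "target ph x y" and ?R = "regs c"
  have c: "?c \<in> words k" using q by (simp add: in_Q_iff target_in)
  have one: "?R (k + 1) = \<one>" and z: "?R k = z" using base by (auto simp: base_regs_def)
  have prog: "program machine (control c) = instr_at (ph, v, w, x, y, u)"
    unfolding ctrl by (rule program_enc[OF q])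
  consider "v < r" | "v = r" | "v = r + 1" using v by linarith
  thus ?thesis
  proof cases
    case 1
    have "?R (tab (entry ?c v)) = tab_value (entry ?c v)"
      using tab entry_less[OF 1] by (simp add: table_upto_def)
    moreover have "?R (if v = 0 then k + 1 else acc ph) = partial_prod ?c v"
      using one acc by (simp add: partial_prod_0)
    ultimately show ?thesis using 1 partial_prod_Suc[OF 1, of ?c]
      unfolding step_def prog instr_at_walking[OF ph] by (simp add: Let_def)
  next
    case 2
    have a: "?R (acc ph) = sub (support ?c)" using acc 2 r_pos partial_prod_all[OF c] by simp
    have "partial_prod ?c (r + 1) = (if isl ?c then sub (support ?c) else inv (sub (support ?c)))"
      by (simp add: partial_prod_def)
    thus ?thesis using 2 a one
      unfolding step_def prog instr_at_walking[OF ph] by (simp add: Let_def)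
  next
    case 3
    have a: "?R (acc ph) = (if isl ?c then sub (support ?c) else inv (sub (support ?c)))"
      using acc 3 by (simp add: partial_prod_def)
    have "partial_prod ?c (r + 1 + 1) = (if isl ?c then sub (support ?c) else z \<otimes> inv (sub (support ?c)))"
      using word_prod_support[OF c] by (simp add: partial_prod_def)
    thus ?thesis using 3 a one z
      unfolding step_def prog instr_at_walking[OF ph] by (simp add: Let_def)
  qed
qed

lemma walking_hash:
  assumes q: "(ph, v, w, x, y, u) \<in> Q" and ctrl: "control c = enc (ph, v, w, x, y, u)"
    and ph: "walking ph" and v: "v = r + 2"
    and acc: "regs c (acc ph) = partial_prod (target ph x y) v"
  shows "program machine (control c) = Hash (acc ph) (\<lambda>c'. enc (after_hash ph w x y u c'))"
    "regs c (acc ph) = \<pi> (target ph x y)"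
  using acc v unfolding ctrl program_enc[OF q] instr_at_walking[OF ph]
  by (simp_all add: Let_def partial_prod_def)

lemma step_walking:
  assumes inv: "inv_at t c (ph, v, w, x, y, u)" and ph: "walking ph"
  shows "\<exists>q. inv_at (Suc t) (step G machine c) q"
proof -
  let ?d = "\<omega> !! (draws c - 1)" and ?c = "target ph x y"
  have q: "(ph, v, w, x, y, u) \<in> Q" and ctrl: "control c = enc (ph, v, w, x, y, u)"
    and com: "common_inv c" and dr: "draws c > 0" and w: "w = fst ?d" and time: "time c \<le> t"
    and tab: "table_upto (regs c) entries" and v: "v < r + 3"
    and acc: "v > 0 \<longrightarrow> regs c (acc ph) = partial_prod ?c v"
    and kept: "ph = Tail_Hare \<longrightarrow> regs c (k + 2) = \<pi> x"
    using inv ph by (auto simp: inv_at_def walking_inv_def Let_def)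
  obtain e where e: "walk_inv ph ?d x y u e" "t \<le> budget (draws c - 1) + 1 + (r + 3) * e + v"
    using inv ph by (auto simp: inv_at_def walking_inv_def Let_def)
  have base: "base_regs (regs c)" and cur: "current c = ?d"
    using com dr by (auto simp: common_inv_def)
  have d: "?d \<in> draw_set G k" by (rule draw_in)
  have acc_reg: "k + 1 < acc ph" "acc ph < k + 4" by (auto simp: acc_def)
  show ?thesis
  proof (cases "v < r + 2")
    case True
    let ?q = "(ph, v + 1, w, x, y, u)"
    let ?R = "(regs c)(acc ph := partial_prod ?c (v + 1))"
    have step: "step G machine c = c\<lparr>control := enc ?q, regs := ?R, time := time c + 1\<rparr>"
      by (rule walking_mult[OF q ctrl ph True base tab acc])
    have "?q \<in> Q" using q True by (simp add: in_Q_iff)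
    moreover have "common_inv (step G machine c)"
      using com base_regs_update[OF base acc_reg(1)] unfolding step common_inv_def by simp
    moreover have "walking_inv (Suc t) (step G machine c) ?q"
      unfolding walking_inv_def Let_def case_prod_conv step
      using dr w time True e kept table_upto_update[OF tab acc_reg(2)]
      by (auto simp: acc_def simp del: walk_inv.simps)
    moreover have "control (step G machine c) = enc ?q" unfolding step by simp
    ultimately have "inv_at (Suc t) (step G machine c) ?q" using ph unfolding inv_at_def by simp
    thus ?thesis by blast
  next
    case False
    hence v: "v = r + 2" using v by simp
    have a: "regs c (acc ph) = partial_prod ?c v" using acc v by simp
    note prog = walking_hash(1)[OF q ctrl ph v a] and val = walking_hash(2)[OF q ctrl ph v a]
    obtain ph' v' w' x' y' u' where q'_eq:
      "after_hash ph w x y u (snd ?d (\<pi> ?c)) = (ph', v', w', x', y', u')"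
      by (metis prod_cases6)
    let ?q = "(ph', v', w', x', y', u')"
    have step: "step G machine c = c\<lparr>control := enc ?q\<rparr>"
      unfolding step_def prog q'_eq[symmetric] by (simp add: cur val)
    have c: "?c \<in> words k" using q by (simp add: in_Q_iff target_in)
    have "snd ?d (\<pi> ?c) \<in> words k" by (rule hash_in_words[OF d word_prod_closed[OF c]])
    hence q': "?q \<in> Q" using after_hash_in_Q[of w x y u] q unfolding q'_eq[symmetric] by (auto simp: in_Q_iff)
    have com': "common_inv (step G machine c)" "control (step G machine c) = enc ?q"
      using com unfolding step common_inv_def by simp_all
    have bound: "Suc t \<le> budget (draws c - 1) + 1 + (r + 3) * (e + 1)"
      using e(2) v by simp
    have "e + 1 \<le> 5 * rho ?d" by (rule walk_inv_bound[OF d e(1)])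
    hence "(r + 3) * (e + 1) \<le> (r + 3) * (5 * rho ?d)" by (rule mult_le_mono2)
    also have "\<dots> = 5 * (r + 3) * rho ?d" by (simp add: algebra_simps)
    finally have rho_bound: "Suc t + 1 \<le> budget (draws c - 1) + cost ?d"
      using bound unfolding cost_def by linarith
    from walk_inv_after_hash[OF d e(1) q'_eq[unfolded w]]
    have "v' = 0" "w' = fst ?d" and alt: "(walking ph' \<and> (\<exists>e'\<ge>e + 1. walk_inv ph' ?d x' y' u' e') \<and>
        (ph' = Tail_Hare \<longrightarrow> ph = Tail_Tortoise \<and> x' = x)) \<or>
      (ph' = Restart \<and> tail ?d = 0) \<or>
      (ph' = Compare \<and> ph = Tail_Hare \<and> x' = x \<and> y' = y \<and> tail ?d > 0 \<and>
        x' = orbit ?d (tail ?d - 1) \<and> y' = orbit ?d (rho ?d - 1))" by simp_all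
    from alt have "if walking ph' then walking_inv (Suc t) (step G machine c) ?q
                   else resting_inv (Suc t) (step G machine c) ?q"
    proof (elim disjE conjE exE)
      fix e' assume w': "walking ph'" and e': "e + 1 \<le> e'" "walk_inv ph' ?d x' y' u' e'"
        and kept': "ph' = Tail_Hare \<longrightarrow> ph = Tail_Tortoise \<and> x' = x"
      have "(r + 3) * (e + 1) \<le> (r + 3) * e'" using e'(1) by (rule mult_le_mono2)
      hence "Suc t \<le> budget (draws c - 1) + 1 + (r + 3) * e' + 0" using bound by linarith
      \<comment> \<open>On entering \<open>Tail_Hare\<close>, the value just computed in the first
        accumulator is the product of the tortoise, which has not moved yet.\<close>
      moreover have "ph' = Tail_Hare \<longrightarrow> regs c (k + 2) = \<pi> x'"
        using kept' val by (auto simp: acc_def target_def)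
      ultimately have "walking_inv (Suc t) (step G machine c) ?q"
        unfolding walking_inv_def Let_def case_prod_conv step
        using dr time tab e'(2) \<open>v' = 0\<close> \<open>w' = fst ?d\<close>
        by (auto simp del: walk_inv.simps)
      thus ?thesis using w' by simp
    next
      assume ph': "ph' = Restart" and t0: "tail ?d = 0"
      have none: "pass ?d = None" unfolding pollard_pass_alt t0 by simp
      have "pass (\<omega> !! i) = None" if "i < draws c" for i
      proof (cases "i = draws c - 1")
        case False
        hence "i < draws c - 1" using that by simp
        thus ?thesis using com by (simp add: common_inv_def)
      qed (use none in \<open>simp only:\<close>)
      thus ?thesis unfolding step ph'
        using rho_bound budget_Suc[OF dr] time tab by (simp add: walking_def)
    next
      assume *: "ph' = Compare" "ph = Tail_Hare" "x' = x" "y' = y" "tail ?d > 0"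
        "x' = orbit ?d (tail ?d - 1)" "y' = orbit ?d (rho ?d - 1)"
      have "regs c (k + 3) = \<pi> y" using val *(2) by (simp add: acc_def target_def)
      thus ?thesis unfolding step *(1)
        using rho_bound dr time tab * kept by (simp add: walking_def Let_def)
    qed
    hence "inv_at (Suc t) (step G machine c) ?q" using q' com' unfolding inv_at_def by simp
    thus ?thesis by blast
  qed
qed

lemma inv_step:
  assumes "inv_at t c q"
  shows "\<exists>q. inv_at (Suc t) (step G machine c) q"
proof -
  obtain ph v w x y u where q: "q = (ph, v, w, x, y, u)" by (cases q)
  note inv = assms[unfolded q]
  consider "walking ph" | "ph = Precompute" | "ph = Restart" | "ph = Compare" | "ph = Output"
    by (cases ph) (simp_all add: walking_def)
  thus ?thesis
  proof cases
    case 1 show ?thesis by (rule step_walking[OF inv 1])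
  next
    case 2 show ?thesis by (rule step_precompute[OF inv[unfolded 2]])
  next
    case 3 show ?thesis by (rule step_restart[OF inv[unfolded 3]])
  next
    case 4 show ?thesis by (rule step_compare[OF inv[unfolded 4]])
  next
    case 5 show ?thesis by (rule step_output[OF inv[unfolded 5]])
  qed
qed

lemma inv_run: "\<exists>q. inv_at t (run G machine S z \<omega> t) q"
proof (induction t)
  case 0
  show ?case unfolding run_def funpow_0 using inv_initial by (rule exI)
next
  case (Suc t)
  then obtain q where "inv_at t (run G machine S z \<omega> t) q" by blast
  from inv_step[OF this] show ?case by (simp only: run_def funpow.simps comp_apply)
qed

end


context machine_run
begin

subsection \<open>Consequences of the invariant\<close>

lemma inv_at_state:
  assumes "inv_at t c (ph, v, w, x, y, u)"
  shows "(ph, v, w, x, y, u) \<in> Q" "control c = enc (ph, v, w, x, y, u)"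
  using assms by (simp_all add: inv_at_def)

lemma machine_hashes_along_walk: "hashes_along_walk G machine S z \<omega>"
proof -
  have "draws c > 0 \<and> (\<exists>i. regs c a = \<pi> (orbit (current c) i))"
    if c: "c = run G machine S z \<omega> t" and prog: "program machine (control c) = Hash a f" for t c a f
  proof -
    obtain q where "inv_at t c q" using inv_run[of t] c by blast
    moreover obtain ph v w x y u where "q = (ph, v, w, x, y, u)" by (cases q)
    ultimately have inv: "inv_at t c (ph, v, w, x, y, u)" by simp
    note q = inv_at_state[OF inv]
    have instr: "instr_at (ph, v, w, x, y, u) = Hash a f"
      using prog unfolding q(2) program_enc[OF q(1)] .
    have ph: "walking ph"
    proof (rule ccontr)
      assume "\<not> walking ph"
      thus False using instr by (cases ph) (simp_all add: walking_def Let_def split: if_splits)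
    qed
    from inv ph have wi: "walking_inv t c (ph, v, w, x, y, u)" by (simp add: inv_at_def)
    have v: "v = r + 2"
    proof (rule ccontr)
      assume "v \<noteq> r + 2"
      moreover have "v < r + 3" using wi by (simp add: walking_inv_def Let_def)
      ultimately have "v < r + 2" by simp
      thus False using instr unfolding instr_at_walking[OF ph]
        by (simp add: Let_def split: if_splits)
    qed
    let ?d = "\<omega> !! (draws c - 1)"
    have dr: "draws c > 0" and acc: "regs c (acc ph) = partial_prod (target ph x y) v"
      using wi v by (simp_all add: walking_inv_def Let_def)
    from wi obtain e where "walk_inv ph ?d x y u e"
      unfolding walking_inv_def Let_def case_prod_conv by blast
    from walk_inv_target[OF this] obtain i where i: "target ph x y = orbit ?d i" by blast
    have "a = acc ph" using walking_hash(1)[OF q ph v acc] prog by simp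
    moreover have "current c = ?d" using inv dr by (simp add: inv_at_def common_inv_def)
    ultimately show ?thesis using walking_hash(2)[OF q ph v acc] i dr by auto
  qed
  thus ?thesis
    unfolding hashes_along_walk_def Let_def orbit_def by (simp add: case_prod_unfold)
qed

text \<open>Before halting, every step is paid for by the table and the draws already made. The
  restriction to \<open>ph \<noteq> Output\<close> reflects the idle steps after halting.\<close>

lemma inv_budget:
  assumes inv: "inv_at t c (ph, v, w, x, y, u)"
  shows "time c \<le> budget (draws c)" "ph \<noteq> Output \<Longrightarrow> t \<le> budget (draws c)"
proof -
  have "time c \<le> budget (draws c) \<and> (ph \<noteq> Output \<longrightarrow> t \<le> budget (draws c))"
  proof (cases "walking ph")
    case True
    let ?d = "\<omega> !! (draws c - 1)"
    from inv True have wi: "walking_inv t c (ph, v, w, x, y, u)" by (simp add: inv_at_def)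
    hence dr: "draws c > 0" and v: "v < r + 3" and time: "time c \<le> t"
      by (simp_all add: walking_inv_def Let_def)
    from wi obtain e where e: "walk_inv ph ?d x y u e" "t \<le> budget (draws c - 1) + 1 + (r + 3) * e + v"
      unfolding walking_inv_def Let_def case_prod_conv by blast
    have "e + 1 \<le> 5 * rho ?d" by (rule walk_inv_bound[OF draw_in e(1)])
    hence "(r + 3) * (e + 1) \<le> (r + 3) * (5 * rho ?d)" by (rule mult_le_mono2)
    also have "\<dots> = 5 * (r + 3) * rho ?d" by (simp add: algebra_simps)
    finally have "(r + 3) * e + (r + 3) \<le> 5 * (r + 3) * rho ?d" by simp
    hence "t \<le> budget (draws c)" using e(2) v budget_Suc[OF dr] unfolding cost_def by linarith
    thus ?thesis using time by simp
  next
    case False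
    have rest: "resting_inv t c (ph, v, w, x, y, u)" using inv False by (simp add: inv_at_def)
    show ?thesis
    proof (cases ph)
      case Compare
      hence *: "draws c > 0" "t + 1 \<le> budget (draws c - 1) + cost (\<omega> !! (draws c - 1))" "time c \<le> t"
        using rest by (simp_all add: Let_def)
      thus ?thesis using budget_Suc[OF *(1)] by linarith
    qed (use False rest in \<open>auto simp: walking_def budget_def\<close>)
  qed
  thus "time c \<le> budget (draws c)" "ph \<noteq> Output \<Longrightarrow> t \<le> budget (draws c)" by blast+
qed

lemma inv_passes: "inv_at t c q \<Longrightarrow> \<forall>i < draws c - 1. pass (\<omega> !! i) = None"
  unfolding inv_at_def common_inv_def by blast

lemma halting_run:
  assumes inv: "inv_at t c (ph, v, w, x, y, u)" and halt: "program machine (control c) = Halt out"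
  shows "pollard_outputs G S z \<omega> (draws c) out"
proof -
  note q = inv_at_state[OF inv]
  have instr: "instr_at (ph, v, w, x, y, u) = Halt out"
    using halt unfolding q(2) program_enc[OF q(1)] .
  have "\<not> walking ph"
  proof
    assume ph: "walking ph"
    show False using instr unfolding instr_at_walking[OF ph]
      by (simp add: Let_def split: if_splits)
  qed
  hence ph: "ph = Output" using instr by (cases ph) (simp_all add: walking_def Let_def split: if_splits)
  hence "out = out_set k x y" "draws c > 0" "pass (\<omega> !! (draws c - 1)) = Some (out_set k x y)"
    using instr inv by (simp_all add: inv_at_def walking_def)
  thus ?thesis using inv_passes[OF inv] unfolding pollard_outputs_def by simp
qed

lemma pollard_outputs_unique:
  assumes "pollard_outputs G S z \<omega> m out" "pollard_outputs G S z \<omega> m' out'"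
  shows "m = m'" "out = out'"
proof -
  have "\<not> m < m'"
  proof
    assume "m < m'"
    hence "m - 1 < m' - 1" using assms(1) unfolding pollard_outputs_def by linarith
    thus False using assms unfolding pollard_outputs_def by fastforce
  qed
  moreover have "\<not> m' < m"
  proof
    assume "m' < m"
    hence "m' - 1 < m - 1" using assms(2) unfolding pollard_outputs_def by linarith
    thus False using assms unfolding pollard_outputs_def by fastforce
  qed
  ultimately show "m = m'" by simp
  thus "out = out'" using assms unfolding pollard_outputs_def by simp
qed

text \<open>Another draw would require that all passes before it failed, among them the successful
  one.\<close>

lemma draws_le:
  assumes "inv_at t c q" "pollard_outputs G S z \<omega> m out"
  shows "draws c \<le> m"
proof (rule ccontr)
  assume "\<not> ?thesis"
  hence "m - 1 < draws c - 1" using assms(2) unfolding pollard_outputs_def by linarith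
  thus False using inv_passes[OF assms(1)] assms(2) unfolding pollard_outputs_def by fastforce
qed

lemma machine_outputs_iff:
  "machine_outputs G machine S z \<omega> m out \<longleftrightarrow> pollard_outputs G S z \<omega> m out"
proof
  assume "machine_outputs G machine S z \<omega> m out"
  then obtain t where t: "program machine (control (run G machine S z \<omega> t)) = Halt out"
    "draws (run G machine S z \<omega> t) = m" unfolding machine_outputs_def by blast
  obtain q where inv: "inv_at t (run G machine S z \<omega> t) q" using inv_run by blast
  obtain ph v w x y u where "q = (ph, v, w, x, y, u)" by (cases q)
  thus "pollard_outputs G S z \<omega> m out" using halting_run[OF _ t(1)] inv t(2) by blast
next
  assume out: "pollard_outputs G S z \<omega> m out"
  \<comment> \<open>One step more than a run with at most \<open>m\<close> draws can make without
    halting.\<close>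
  let ?t = "budget m + 1"
  let ?c = "run G machine S z \<omega> ?t"
  obtain q where inv: "inv_at ?t ?c q" using inv_run by blast
  obtain ph v w x y u where q: "q = (ph, v, w, x, y, u)" by (cases q)
  note inv = inv[unfolded q]
  have "draws ?c \<le> m" by (rule draws_le[OF inv out])
  hence "budget (draws ?c) \<le> budget m" unfolding budget_def by (auto intro!: sum_mono2)
  hence ph: "ph = Output" using inv_budget(2)[OF inv] by (metis Suc_eq_plus1 not_less_eq_eq order_trans)
  have halt: "program machine (control ?c) = Halt (out_set k x y)"
    using inv_at_state[OF inv] by (simp add: program_enc ph)
  note o = pollard_outputs_unique[OF halting_run[OF inv halt] out]
  show "machine_outputs G machine S z \<omega> m out"
    unfolding machine_outputs_def using halt o by (intro exI[of _ ?t]) simp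
qed

text \<open>Charging a pass exactly when all earlier ones fail turns the running time into a series
  that can be integrated term by term.\<close>

lemma running_time_bound:
  "running_time G machine S z \<omega> \<le> of_nat entries +
     (\<Sum>i. if \<forall>j<i. pass (\<omega> !! j) = None then of_nat (cost (\<omega> !! i)) else 0)"
  unfolding running_time_def
proof (rule SUP_least)
  fix t
  let ?c = "run G machine S z \<omega> t"
  let ?f = "\<lambda>i. if \<forall>j<i. pass (\<omega> !! j) = None then of_nat (cost (\<omega> !! i)) else (0 :: ennreal)"
  obtain q where inv: "inv_at t ?c q" using inv_run by blast
  obtain ph v w x y u where q: "q = (ph, v, w, x, y, u)" by (cases q)
  have "(of_nat (time ?c) :: ennreal) \<le> of_nat (budget (draws ?c))"
    using inv_budget(1)[OF inv[unfolded q]] by simp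
  also have "\<dots> = of_nat entries + (\<Sum>i<draws ?c. of_nat (cost (\<omega> !! i)))"
    by (simp add: budget_def)
  also have "(\<Sum>i<draws ?c. (of_nat (cost (\<omega> !! i)) :: ennreal)) = (\<Sum>i<draws ?c. ?f i)"
  proof (intro sum.cong refl)
    fix i assume "i \<in> {..<draws ?c}"
    hence "pass (\<omega> !! j) = None" if "j < i" for j
      using inv_passes[OF inv] that by (metis One_nat_def lessThan_iff less_diff_conv
        less_trans_Suc Suc_eq_plus1)
    thus "of_nat (cost (\<omega> !! i)) = ?f i" by simp
  qed
  also have "\<dots> \<le> (\<Sum>i. ?f i)" by (rule sum_le_suminf) auto
  finally show "of_nat (time ?c) \<le> of_nat entries + (\<Sum>i. ?f i)" by (simp add: add_left_mono)
qed

lemma pass_correct: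
  assumes d: "d \<in> draw_set G k" and out: "pass d = Some out"
  shows "out \<subseteq> {..<k} \<and> sub out = z"
proof -
  define s where "s = orbit d (rho d - 1)"
  define t where "t = orbit d (tail d - 1)"
  have eq: "\<pi> s = \<pi> t" "isl t \<noteq> isl s" "out = out_set k t s"
    using out unfolding pollard_pass_alt s_def[symmetric] t_def[symmetric]
    by (auto simp: Let_def split: if_splits)
  have st: "s \<in> words k" "t \<in> words k" unfolding s_def t_def by (simp_all add: orbit_in d)
  have join: "sub (join_indices k I J) = z"
    if IJ: "Inl I \<in> words k" "Inr J \<in> words k" and p: "\<pi> (Inl I) = \<pi> (Inr J)" for I J
  proof -
    have I: "I \<subseteq> {..<half k}" using IJ by (auto simp: words_def)
    have "sub (join_indices k I J) = sub I \<otimes> sub ((+) (half k) ` J)"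
      unfolding join_indices_def using I by (intro sub_Un) auto
    also have "sub I = z \<otimes> inv (sub ((+) (half k) ` J))"
      using p unfolding word_prod_support[OF IJ(1)] word_prod_support[OF IJ(2)]
      by (simp add: support_def)
    also have "\<dots> \<otimes> sub ((+) (half k) ` J) = z" using z_in by (simp add: m_assoc)
    finally show ?thesis .
  qed
  have "sub out = z"
  proof (cases t)
    case (Inl I)
    then obtain J where J: "s = Inr J" using eq(2) by (cases s) auto
    have "sub (join_indices k I J) = z"
      using join[of I J] st eq(1) unfolding Inl J by metis
    thus ?thesis using eq(3) by (simp add: Inl J)
  next
    case (Inr J)
    then obtain I where I: "s = Inl I" using eq(2) by (cases s) auto
    have "sub (join_indices k I J) = z"
      using join[of I J] st eq(1) unfolding Inr I by metis
    thus ?thesis using eq(3) by (simp add: Inr I)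
  qed
  thus ?thesis using out_set_subset[OF st(2,1)] eq(3) by simp
qed

lemma machine_finds:
  assumes "pass (\<omega> !! i) \<noteq> None"
  shows "\<exists>m out. machine_outputs G machine S z \<omega> m out \<and> out \<subseteq> {..<length S} \<and> sub out = z"
proof -
  define i0 where "i0 = (LEAST i. pass (\<omega> !! i) \<noteq> None)"
  have "pass (\<omega> !! i0) \<noteq> None" unfolding i0_def using assms by (rule LeastI)
  then obtain out where out: "pass (\<omega> !! i0) = Some out" by blast
  have "pass (\<omega> !! j) = None" if "j < i0" for j
    using not_less_Least[OF that[unfolded i0_def]] by blast
  hence "pollard_outputs G S z \<omega> (i0 + 1) out" using out unfolding pollard_outputs_def by simp
  hence "machine_outputs G machine S z \<omega> (i0 + 1) out" by (simp only: machine_outputs_iff)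
  moreover have "out \<subseteq> {..<k} \<and> sub out = z" by (rule pass_correct[OF draw_in out])
  ultimately show ?thesis using len by blast
qed

end

lemma (in table_machine) machine_implements_pollard:
  assumes "group G"
  shows "implements_pollard G k machine"
  unfolding implements_pollard_def
proof (intro allI impI)
  fix S z \<omega>
  assume *: "length S = k \<and> set S \<subseteq> carrier G \<and> z \<in> subproducts G S \<and> \<omega> \<in> streams (draw_set G k)"
  interpret group G by fact
  have "z \<in> carrier G"
    using * set_nths_subset[of S] unfolding subproducts_def by (fastforce intro!: gprod_closed)
  then interpret machine_run k r G S z \<omega>
    using * by unfold_locales auto
  show "hashes_along_walk G machine S z \<omega> \<and>
    (\<forall>m out. machine_outputs G machine S z \<omega> m out = pollard_outputs G S z \<omega> m out)"
    using machine_hashes_along_walk machine_outputs_iff by blast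
qed


section \<open>Repeated independent trials\<close>

text \<open>Whether trial \<open>i\<close> takes place depends on earlier draws only, so its cost
  may be correlated with its own outcome and the expectations still multiply.\<close>

lemma (in prob_space) nn_integral_repeated_trials:
  fixes P :: "'a \<Rightarrow> bool" and F :: "'a \<Rightarrow> ennreal"
  assumes P [measurable]: "Measurable.pred M P" and F [measurable]: "F \<in> borel_measurable M"
  shows "(\<integral>\<^sup>+\<omega>. (\<Sum>i. if \<forall>j<i. P (\<omega> !! j) then F (\<omega> !! i) else 0) \<partial>stream_space M) =
         (\<Sum>i. emeasure M {x \<in> space M. P x} ^ i * (\<integral>\<^sup>+x. F x \<partial>M))"
    "(\<lambda>\<omega>. \<Sum>i. if \<forall>j<i. P (\<omega> !! j) then F (\<omega> !! i) else 0) \<in> borel_measurable (stream_space M)"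
proof -
  define g where "g i \<omega> = (if \<forall>j<i. P (\<omega> !! j) then F (\<omega> !! i) else 0)" for i \<omega>
  interpret S: prob_space "stream_space M" by (rule prob_space_stream_space)
  have g_meas [measurable]: "g i \<in> borel_measurable (stream_space M)" for i
  proof -
    have "(\<lambda>\<omega>. if \<forall>j\<in>{..<i}. P (\<omega> !! j) then F (\<omega> !! i) else 0) \<in> borel_measurable (stream_space M)"
      by measurable
    thus ?thesis unfolding g_def by (simp add: Ball_def)
  qed
  have g0: "g 0 (x ## \<omega>) = F x" for x \<omega> by (simp add: g_def)
  \<comment> \<open>Removing the head of the stream splits off the factor for the first trial, which
    drives the induction.\<close>
  have gSuc: "g (Suc i) (x ## \<omega>) = indicator {x \<in> space M. P x} x * g i \<omega>" if "x \<in> space M" for i x \<omega>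
    using that unfolding g_def All_less_Suc2 by (auto simp: indicator_def)
  have "(\<integral>\<^sup>+\<omega>. g i \<omega> \<partial>stream_space M) = emeasure M {x \<in> space M. P x} ^ i * (\<integral>\<^sup>+x. F x \<partial>M)" for i
  proof (induction i)
    case 0
    have "(\<integral>\<^sup>+\<omega>. g 0 \<omega> \<partial>stream_space M) = (\<integral>\<^sup>+x. (\<integral>\<^sup>+\<omega>. g 0 (x ## \<omega>) \<partial>stream_space M) \<partial>M)"
      by (rule nn_integral_stream_space) measurable
    thus ?case by (simp add: g0 S.emeasure_space_1)
  next
    case (Suc i)
    have "(\<integral>\<^sup>+\<omega>. g (Suc i) \<omega> \<partial>stream_space M) =
          (\<integral>\<^sup>+x. (\<integral>\<^sup>+\<omega>. g (Suc i) (x ## \<omega>) \<partial>stream_space M) \<partial>M)"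
      by (rule nn_integral_stream_space) measurable
    also have "\<dots> = (\<integral>\<^sup>+x. indicator {x \<in> space M. P x} x * (\<integral>\<^sup>+\<omega>. g i \<omega> \<partial>stream_space M) \<partial>M)"
      by (intro nn_integral_cong) (simp add: gSuc nn_integral_cmult)
    also have "\<dots> = emeasure M {x \<in> space M. P x} * (\<integral>\<^sup>+\<omega>. g i \<omega> \<partial>stream_space M)"
      by (simp add: nn_integral_multc)
    finally show ?case using Suc by (simp add: mult.assoc)
  qed
  hence "(\<integral>\<^sup>+\<omega>. (\<Sum>i. g i \<omega>) \<partial>stream_space M) =
        (\<Sum>i. emeasure M {x \<in> space M. P x} ^ i * (\<integral>\<^sup>+x. F x \<partial>M))"
    by (subst nn_integral_suminf) auto
  thus "(\<integral>\<^sup>+\<omega>. (\<Sum>i. if \<forall>j<i. P (\<omega> !! j) then F (\<omega> !! i) else 0) \<partial>stream_space M) =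
         (\<Sum>i. emeasure M {x \<in> space M. P x} ^ i * (\<integral>\<^sup>+x. F x \<partial>M))"
    unfolding g_def .
  have "(\<lambda>\<omega>. \<Sum>i. g i \<omega>) \<in> borel_measurable (stream_space M)" by measurable
  thus "(\<lambda>\<omega>. \<Sum>i. if \<forall>j<i. P (\<omega> !! j) then F (\<omega> !! i) else 0) \<in> borel_measurable (stream_space M)"
    unfolding g_def .
qed


section \<open>Expected running time for balanced inputs\<close>

locale balanced_input = table_machine k r + finite_group G
  for k r :: nat and G :: "('a, 'b) monoid_scheme" (structure) +
  fixes S :: "'a list" and z :: 'a
  assumes len: "length S = k" and bal: "balanced_halves S" and z_in: "z \<in> carrier G"
begin

abbreviation \<pi> :: "word \<Rightarrow> 'a" where "\<pi> \<equiv> word_prod G S z"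

abbreviation pass :: "'a draw \<Rightarrow> nat set option" where "pass \<equiv> pollard_pass G S z"

lemma S_in: "set S \<subseteq> carrier G" using bal by (simp add: balanced_halves_def)

lemma machine_run: "\<omega> \<in> streams (draw_set G k) \<Longrightarrow> machine_run k r G S z \<omega>"
  using len S_in z_in by unfold_locales auto

lemma words_ne: "words k \<noteq> {}" using Inl_empty_in_words by blast

text \<open>A constant stream makes the facts of \<open>machine_run\<close> available for a single
  draw.\<close>

lemma sconst_in: "d \<in> draw_set G k \<Longrightarrow> sconst d \<in> streams (draw_set G k)"
  by (simp add: streams_iff_snth)

lemma draw_set_finite: "finite (draw_set G k)"
  unfolding draw_set_def using finite_words finite_carrier
  by (intro finite_cartesian_product finite_PiE) auto

lemma draw_set_ne: "draw_set G k \<noteq> {}"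
  unfolding draw_set_def using words_ne by (simp add: PiE_eq_empty_iff)

lemma word_prod_closed: "c \<in> words k \<Longrightarrow> \<pi> c \<in> carrier G"
proof -
  assume c: "c \<in> words k"
  obtain d where "d \<in> draw_set G k" using draw_set_ne by blast
  then interpret R: machine_run k r G S z "sconst d" by (intro machine_run sconst_in)
  show "\<pi> c \<in> carrier G" using c by (rule R.word_prod_closed)
qed

section \<open>Fibres of the product map for a given target\<close>

lemma card_fibre_left: "card {c \<in> words k. \<pi> c = g \<and> isl c} = nsub (take (half k) S) g"
proof -
  have "{c \<in> words k. \<pi> c = g \<and> isl c} =
        Inl ` {I. I \<subseteq> {..<half k} \<and> gprod G (nths (take (half k) S) I) = g}"
    by (auto simp: words_def word_prod_def len isl_def)
  moreover have "length (take (half k) S) = half k" by (simp add: len)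
  ultimately show ?thesis unfolding nsub_def by (simp add: card_image)
qed

text \<open>Solving z * inv p = g for p shows that the target merely relabels the fibres of the
  second half, so a property of all fibres holds for all targets.\<close>

lemma card_fibre_right:
  assumes g: "g \<in> carrier G"
  shows "card {c \<in> words k. \<pi> c = g \<and> \<not> isl c} = nsub (drop (half k) S) (inv g \<otimes> z)"
proof -
  let ?B = "drop (half k) S"
  have B: "set (nths ?B J) \<subseteq> carrier G" for J
    using S_in set_nths_subset[of ?B J] set_drop_subset[of "half k" S] by blast
  have eq: "z \<otimes> inv p = g \<longleftrightarrow> p = inv g \<otimes> z" if p: "p \<in> carrier G" for p
  proof
    assume "z \<otimes> inv p = g"
    hence "z = g \<otimes> p" using p z_in g by (metis inv_closed inv_inv inv_solve_right)
    thus "p = inv g \<otimes> z" using p g by (simp add: m_assoc[symmetric])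
  next
    assume "p = inv g \<otimes> z"
    thus "z \<otimes> inv p = g" using g z_in by (simp add: inv_mult_group m_assoc[symmetric])
  qed
  have "\<pi> (Inr J) = g \<longleftrightarrow> gprod G (nths ?B J) = inv g \<otimes> z" for J
    using eq[of "gprod G (nths ?B J)"] B[of J] by (simp add: word_prod_def len gprod_mu)
  hence "{c \<in> words k. \<pi> c = g \<and> \<not> isl c} =
        Inr ` {J. J \<subseteq> {..<k - half k} \<and> gprod G (nths ?B J) = inv g \<otimes> z}"
    by (auto simp: words_def isl_def)
  moreover have "length ?B = k - half k" by (simp add: len)
  ultimately show ?thesis unfolding nsub_def by (simp add: card_image)
qed

lemma half_bounds: "k - half k = half k \<or> k - half k = Suc (half k)" by linarith

sublocale equidistributed_walk "words k" "carrier G" \<pi> isl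
proof
  show "finite (words k)" "words k \<noteq> {}" "finite (carrier G)"
    by (fact finite_words words_ne finite_carrier)+
  show "\<pi> c \<in> carrier G" if "c \<in> words k" for c by (rule word_prod_closed[OF that])
next
  fix g assume g: "g \<in> carrier G"
  let ?n = "real (card (carrier G))" and ?a = "half k" and ?b = "k - half k"
  let ?L = "real (card {c \<in> words k. \<pi> c = g \<and> isl c})"
  let ?R = "real (card {c \<in> words k. \<pi> c = g \<and> \<not> isl c})"
  have n: "?n > 0" using order_pos by (simp add: order_def)
  have C: "real (card (words k)) = 2 ^ ?a + 2 ^ ?b" by (simp add: card_words)
  have L: "2 ^ ?a / (2 * ?n) \<le> ?L" "?L \<le> 2 * 2 ^ ?a / ?n"
    using bal g unfolding card_fibre_left balanced_halves_def balanced_def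
    by (simp_all add: len order_def)
  have "inv g \<otimes> z \<in> carrier G" using g z_in by simp
  hence R: "2 ^ ?b / (2 * ?n) \<le> ?R" "?R \<le> 2 * 2 ^ ?b / ?n"
    using bal unfolding card_fibre_right[OF g] balanced_halves_def balanced_def
    by (simp_all add: len order_def)
  have "{c \<in> words k. \<pi> c = g} =
        {c \<in> words k. \<pi> c = g \<and> isl c} \<union> {c \<in> words k. \<pi> c = g \<and> \<not> isl c}" by auto
  hence "card {c \<in> words k. \<pi> c = g} =
         card {c \<in> words k. \<pi> c = g \<and> isl c} + card {c \<in> words k. \<pi> c = g \<and> \<not> isl c}"
    using finite_words[of k] by (simp only:) (intro card_Un_disjoint; auto)
  hence sum: "real (card {c \<in> words k. \<pi> c = g}) = ?L + ?R" by simp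
  show "real (card (words k)) / (2 * ?n) \<le> real (card {c \<in> words k. \<pi> c = g})"
    using L(1) R(1) unfolding sum C by (simp add: add_divide_distrib)
  show "real (card {c \<in> words k. \<pi> c = g}) \<le> 2 * real (card (words k)) / ?n"
    using L(2) R(2) unfolding sum C by (simp add: add_divide_distrib distrib_left)
  have ab: "(2::real) ^ ?a \<le> 2 ^ ?b" "(2::real) ^ ?b \<le> 2 * 2 ^ ?a"
    using half_bounds by auto
  \<comment> \<open>The second half is at most one entry longer, so its side has at most twice as
    many words as the first.\<close>
  have "real (card (words k)) \<le> 3 * 2 ^ ?a" unfolding C using ab by simp
  hence "real (card (words k)) / (6 * ?n) \<le> 3 * 2 ^ ?a / (6 * ?n)"
    using n by (intro divide_right_mono) auto
  also have "3 * 2 ^ ?a / (6 * ?n) = 2 ^ ?a / (2 * ?n)" by simp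
  finally have lo: "real (card (words k)) / (6 * ?n) \<le> 2 ^ ?a / (2 * ?n)" .
  have ab': "(2::real) ^ ?a / (2 * ?n) \<le> 2 ^ ?b / (2 * ?n)"
    using ab n by (intro divide_right_mono) auto
  show "real (card (words k)) / (6 * ?n) \<le> real (card {c \<in> words k. \<pi> c = g \<and> isl c \<noteq> kd})" for kd
    using L(1) R(1) lo ab' by (cases kd) auto
qed

lemma D_eq: "D = draw_set G k" unfolding D_def draw_set_def ..

lemma meets_pass:
  assumes "d \<in> meets m"
  shows "pass d \<noteq> None"
proof -
  have d: "d \<in> draw_set G k" using assms unfolding meets_def fresh_def D_eq by blast
  then interpret R: machine_run k r G S z "sconst d" by (intro machine_run sconst_in)
  from meets_rho[OF assms] obtain l where l: "l \<le> m" "R.rho d = Suc (Suc m)" "R.tail d = Suc l"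
    "\<pi> (wk d (Suc m)) = \<pi> (wk d l)" "isl (wk d (Suc m)) \<noteq> isl (wk d l)"
    unfolding rho_length_def by metis
  have "R.orbit d i = wk d i" for i unfolding R.orbit_def wk_def ..
  thus ?thesis unfolding R.pollard_pass_alt using l by (simp add: Let_def)
qed

section \<open>Failure probability, expected cost and termination\<close>

definition M where "M = uniform_count_measure (draw_set G k)"

definition cost :: "'a draw \<Rightarrow> nat" where "cost d = 5 * (r + 3) * rho d + 2"

lemma space_M: "space M = draw_set G k"
  unfolding M_def by (rule space_uniform_count_measure)

lemma measurable_M [measurable]: "f \<in> measurable M N" if "\<And>d. f d \<in> space N"
proof -
  have "f \<in> measurable (count_space (draw_set G k)) N" using that by simp
  thus ?thesis unfolding M_def
    using measurable_cong_sets[OF sets_uniform_count_measure_count_space refl] by blast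
qed

sublocale M: prob_space M
  unfolding M_def using draw_set_finite draw_set_ne by (rule prob_space_uniform_count_measure)

lemma prob_fail: "emeasure M {d \<in> space M. pass d = None} \<le> ennreal (11 / 12)"
proof -
  let ?D = "draw_set G k"
  have fin: "finite ?D" by (rule draw_set_finite)
  let ?X = "{d \<in> ?D. pass d = None}" and ?Y = "\<Union>m. meets m"
  have Y: "?Y \<subseteq> ?D" unfolding meets_def fresh_def D_eq by blast
  hence finY: "finite ?Y" using fin finite_subset by blast
  have "?X \<subseteq> ?D - ?Y" using meets_pass by blast
  hence "card ?X \<le> card (?D - ?Y)" using fin by (intro card_mono) auto
  also have "\<dots> = card ?D - card ?Y" by (rule card_Diff_subset[OF finY Y])
  finally have "real (card ?X) \<le> real (card ?D) - real (card ?Y)"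
    using card_mono[OF fin Y] by linarith
  hence X: "real (card ?X) \<le> 11 / 12 * real (card ?D)" using card_meets unfolding D_eq by linarith
  have "card ?D > 0" using fin draw_set_ne by (simp add: card_gt_0_iff)
  hence "real (card ?X) / real (card ?D) \<le> 11 / 12"
    using X by (subst pos_divide_le_eq) auto
  thus ?thesis
    unfolding space_M unfolding M_def using fin
    by (subst emeasure_uniform_count_measure) (auto intro: ennreal_leI)
qed

lemma expected_cost:
  "(\<integral>\<^sup>+d. of_nat (cost d) \<partial>M) \<le> ennreal (5 * real (r + 3) * (3 * sqrt (real (order G)) + 2) + 2)"
proof -
  let ?D = "draw_set G k"
  have D: "real (card ?D) > 0" using draw_set_finite draw_set_ne by (simp add: card_gt_0_iff)
  have "(\<integral>\<^sup>+d. of_nat (cost d) \<partial>M) = (\<Sum>d\<in>?D. ennreal (1 / real (card ?D)) * of_nat (cost d))"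
    unfolding M_def uniform_count_measure_def using draw_set_finite
    by (simp add: nn_integral_point_measure_finite)
  also have "\<dots> = (\<Sum>d\<in>?D. ennreal (1 / real (card ?D) * real (cost d)))"
    by (intro sum.cong refl, subst ennreal_mult') (simp_all add: ennreal_of_nat_eq_real_of_nat)
  also have "\<dots> = ennreal (\<Sum>d\<in>?D. 1 / real (card ?D) * real (cost d))"
    by (rule sum_ennreal) simp
  also have "\<dots> \<le> ennreal (5 * real (r + 3) * (3 * sqrt (real (order G)) + 2) + 2)"
  proof (rule ennreal_leI)
    have "(\<Sum>d\<in>?D. real (cost d)) = 5 * real (r + 3) * (\<Sum>d\<in>?D. real (rho d)) + 2 * real (card ?D)"
      by (simp add: cost_def sum.distrib sum_distrib_left)
    also have "\<dots> \<le> 5 * real (r + 3) * ((3 * sqrt (real (order G)) + 2) * real (card ?D)) + 2 * real (card ?D)"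
      using sum_rho unfolding D_eq order_def by (intro add_right_mono mult_left_mono) auto
    finally have "(\<Sum>d\<in>?D. real (cost d)) \<le> (5 * real (r + 3) * (3 * sqrt (real (order G)) + 2) + 2) * real (card ?D)"
      by (simp add: algebra_simps)
    hence "(\<Sum>d\<in>?D. real (cost d)) / real (card ?D) \<le> 5 * real (r + 3) * (3 * sqrt (real (order G)) + 2) + 2"
      using D by (subst pos_divide_le_eq) auto
    thus "(\<Sum>d\<in>?D. 1 / real (card ?D) * real (cost d)) \<le> 5 * real (r + 3) * (3 * sqrt (real (order G)) + 2) + 2"
      by (simp add: sum_divide_distrib)
  qed
  finally show ?thesis .
qed

definition total_cost :: "'a draw stream \<Rightarrow> ennreal" where
  "total_cost \<omega> = (\<Sum>i. if \<forall>j<i. pass (\<omega> !! j) = None then of_nat (cost (\<omega> !! i)) else 0)"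

lemma expected_total_cost:
  "(\<integral>\<^sup>+\<omega>. total_cost \<omega> \<partial>stream_space M) \<le>
     ennreal (12 * (5 * real (r + 3) * (3 * sqrt (real (order G)) + 2) + 2))"
proof -
  define E where "E = 5 * real (r + 3) * (3 * sqrt (real (order G)) + 2) + 2"
  have E: "E \<ge> 0" unfolding E_def by simp
  let ?q = "emeasure M {d \<in> space M. pass d = None}"
  have "(\<integral>\<^sup>+\<omega>. total_cost \<omega> \<partial>stream_space M) = (\<Sum>i. ?q ^ i * (\<integral>\<^sup>+d. of_nat (cost d) \<partial>M))"
    unfolding total_cost_def by (rule M.nn_integral_repeated_trials(1)) (auto intro: measurable_M)
  also have "\<dots> \<le> (\<Sum>i. ennreal ((11 / 12) ^ i * E))"
  proof (rule suminf_le)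
    fix i
    have "?q ^ i * (\<integral>\<^sup>+d. of_nat (cost d) \<partial>M) \<le> ennreal (11 / 12) ^ i * ennreal E"
      using prob_fail expected_cost unfolding E_def by (intro mult_mono power_mono) auto
    also have "\<dots> = ennreal ((11 / 12) ^ i * E)" using E by (simp add: ennreal_power ennreal_mult')
    finally show "?q ^ i * (\<integral>\<^sup>+d. of_nat (cost d) \<partial>M) \<le> ennreal ((11 / 12) ^ i * E)" .
  qed auto
  \<comment> \<open>The sum of the geometric series with ratio 11/12, a bound for the expected
    number of passes.\<close>
  also have "\<dots> = ennreal (12 * E)"
  proof (rule suminf_ennreal_eq)
    have "(\<lambda>i. (11 / 12 :: real) ^ i) sums (1 / (1 - 11 / 12))" by (rule geometric_sums) simp
    from sums_mult2[OF this, of E] show "(\<lambda>i. (11 / 12) ^ i * E) sums (12 * E)" by simp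
  qed (use E in simp)
  finally show ?thesis unfolding E_def .
qed

lemma draw_space_eq: "draw_space G (length S) = stream_space M"
  unfolding draw_space_def M_def len ..

lemma expected_time_bound:
  "expected_time G machine S z \<le>
     ennreal (real entries + 12 * (5 * real (r + 3) * (3 * sqrt (real (order G)) + 2) + 2))"
proof -
  interpret S: prob_space "stream_space M" by (rule M.prob_space_stream_space)
  have meas: "total_cost \<in> borel_measurable (stream_space M)"
    unfolding total_cost_def[abs_def]
    by (rule M.nn_integral_repeated_trials(2)) (auto intro: measurable_M)
  have "expected_time G machine S z \<le> (\<integral>\<^sup>+\<omega>. of_nat entries + total_cost \<omega> \<partial>stream_space M)"
    unfolding expected_time_def draw_space_eq
  proof (rule nn_integral_mono)
    fix \<omega> assume "\<omega> \<in> space (stream_space M)"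
    hence "\<omega> \<in> streams (draw_set G k)" by (simp add: space_stream_space space_M)
    then interpret R: machine_run k r G S z \<omega> by (rule machine_run)
    have cost: "R.cost d = cost d" for d unfolding R.cost_def cost_def rho_def ..
    show "running_time G machine S z \<omega> \<le> of_nat entries + total_cost \<omega>"
      using R.running_time_bound unfolding total_cost_def cost by simp
  qed
  also have "\<dots> = of_nat entries + (\<integral>\<^sup>+\<omega>. total_cost \<omega> \<partial>stream_space M)"
    using meas by (subst nn_integral_add) (auto simp: S.emeasure_space_1)
  also have "\<dots> \<le> of_nat entries + ennreal (12 * (5 * real (r + 3) * (3 * sqrt (real (order G)) + 2) + 2))"
    by (intro add_left_mono expected_total_cost)
  finally show ?thesis by (simp add: ennreal_of_nat_eq_real_of_nat ennreal_plus)
qed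

text \<open>Finite expected total cost makes the total almost surely finite, whereas an endless
  succession of failures would cost at least 2 each time.\<close>

lemma finds: "finds_short_product G machine S z"
proof -
  have meas: "total_cost \<in> borel_measurable (stream_space M)"
    unfolding total_cost_def[abs_def]
    by (rule M.nn_integral_repeated_trials(2)) (auto intro: measurable_M)
  have "(\<integral>\<^sup>+\<omega>. total_cost \<omega> \<partial>stream_space M) \<noteq> \<infinity>"
    using expected_total_cost by (metis ennreal_less_top infinity_ennreal_def less_irrefl order_le_less_trans)
  hence "AE \<omega> in stream_space M. total_cost \<omega> \<noteq> \<infinity>" by (rule nn_integral_noteq_infinite[OF meas])
  moreover have "AE \<omega> in stream_space M. \<omega> \<in> space (stream_space M)" by (rule AE_space)
  ultimately have "AE \<omega> in stream_space M.
    \<exists>m out. machine_outputs G machine S z \<omega> m out \<and> out \<subseteq> {..<length S} \<and> gprod G (nths S out) = z"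
  proof eventually_elim
    case (elim \<omega>)
    hence "\<omega> \<in> streams (draw_set G k)" by (simp add: space_stream_space space_M)
    then interpret R: machine_run k r G S z \<omega> by (rule machine_run)
    have "\<exists>i. pass (\<omega> !! i) \<noteq> None"
    proof (rule ccontr)
      assume "\<not> ?thesis"
      hence total: "total_cost \<omega> = (\<Sum>i. of_nat (cost (\<omega> !! i)))" unfolding total_cost_def by simp
      obtain x where x: "total_cost \<omega> = ennreal x"
        using elim(1) by (cases "total_cost \<omega>" rule: ennreal_cases) auto
      define m where "m = nat \<lceil>x\<rceil>"
      have m: "total_cost \<omega> \<le> of_nat m"
        unfolding x ennreal_of_nat_eq_real_of_nat m_def by (intro ennreal_leI) linarith
      have "(of_nat (Suc m) :: ennreal) = of_nat (\<Sum>i<Suc m. 1)" by simp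
      also have "\<dots> \<le> of_nat (\<Sum>i<Suc m. cost (\<omega> !! i))"
        unfolding of_nat_le_iff by (intro sum_mono) (simp add: cost_def)
      also have "\<dots> = (\<Sum>i<Suc m. of_nat (cost (\<omega> !! i)))" by (rule of_nat_sum)
      also have "\<dots> \<le> total_cost \<omega>" unfolding total by (rule sum_le_suminf) auto
      also note m
      finally show False unfolding of_nat_le_iff by simp
    qed
    thus ?case using R.machine_finds by blast
  qed
  thus ?thesis unfolding finds_short_product_def draw_space_eq .
qed

end


section \<open>Choice of parameters\<close>

lemma has_density_bounds:
  assumes "d > 0" "n \<ge> 2" "has_density d n k"
  shows "real k \<le> (d + 1) * log 2 (real n)" "d * log 2 (real n) / 2 - 1 \<le> real (half k)"
proof -
  have "1 \<le> log 2 (real n)" using assms(2) by simp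
  thus "real k \<le> (d + 1) * log 2 (real n)"
    using assms(3) unfolding has_density_def distrib_right by linarith
  have "real k \<le> 2 * real (half k) + 1" by linarith
  thus "d * log 2 (real n) / 2 - 1 \<le> real (half k)"
    using assms(3) unfolding has_density_def by linarith
qed

lemma two_powr_log: "n \<ge> 2 \<Longrightarrow> 2 powr (a * log 2 (real n)) = real n powr a"
  by (subst mult.commute) (simp add: powr_powr[symmetric])

context table_machine
begin

text \<open>With at least D / \<epsilon> blocks, a block has at most \<epsilon> log n + 1 indices,
  and the 2 to the power of that many products are at most 2 n powr \<epsilon>.\<close>

lemma entries_bound:
  assumes n: "n \<ge> 2" and k: "real k \<le> D * log 2 (real n)" and D: "D \<le> \<epsilon> * real r"
  shows "real entries \<le> 2 * real r * real n powr \<epsilon>"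
proof -
  have L: "log 2 (real n) \<ge> 0" using n by simp
  have "real b \<le> real k / real r + 1"
    unfolding b_def using of_nat_div_le_of_nat[of k r] by simp
  also have "real k / real r \<le> \<epsilon> * log 2 (real n)"
  proof -
    have "real k \<le> \<epsilon> * real r * log 2 (real n)" using k mult_right_mono[OF D L] by linarith
    thus ?thesis using r_pos by (simp add: field_simps)
  qed
  finally have b: "real b \<le> \<epsilon> * log 2 (real n) + 1" by simp
  have "(2::real) ^ b = 2 powr real b" by (simp add: powr_realpow)
  also have "\<dots> \<le> 2 powr (\<epsilon> * log 2 (real n) + 1)" using b by simp
  also have "\<dots> = 2 * real n powr \<epsilon>" by (simp add: powr_add two_powr_log[OF n])
  finally have "real r * 2 ^ b \<le> real r * (2 * real n powr \<epsilon>)" by (intro mult_left_mono) auto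
  thus ?thesis by (simp add: entries_def mult_ac)
qed

text \<open>The four stored words contribute a multiple of \<open>k\<close> bits. The counter is
  bounded wastefully, by 2 to the power of its range, which adds only a term linear in
  \<open>entries\<close>; the registers hold that many elements already.\<close>

lemma storage_bound:
  assumes "n \<ge> 2"
  shows "storage n machine \<le> 5 * real k + 2 * real entries + 2 * real r + 18"
proof -
  have L: "1 \<le> log 2 (real n)" using assms by simp
  have "card (words k) \<le> 2 ^ (k + 1)"
  proof -
    have "(2::nat) ^ half k \<le> 2 ^ k" "(2::nat) ^ (k - half k) \<le> 2 ^ k"
      by (intro power_increasing; simp)+
    thus ?thesis unfolding card_words power_add power_one_right by linarith
  qed
  hence W: "card (words k) ^ 4 \<le> (2 ^ (k + 1)) ^ 4" by (rule power_mono) simp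
  have e: "entries + r + 3 < 2 ^ (entries + r + 3)" by (rule less_exp)
  have "card Q \<le> 2 ^ 4 * 2 ^ (entries + r + 3) * (2 ^ (k + 1)) ^ 4"
    unfolding card_Q using W e by (intro mult_mono) auto
  also have "\<dots> = 2 ^ (4 + (entries + r + 3) + (k + 1) * 4)"
    by (simp only: power_add power_mult)
  finally have "real (card Q) \<le> 2 ^ (4 + (entries + r + 3) + (k + 1) * 4)"
    by (metis of_nat_le_iff of_nat_numeral of_nat_power)
  moreover have "card Q > 0" using finite_Q start_in_Q by (auto simp: card_gt_0_iff)
  ultimately have "log 2 (real (card Q)) \<le> log 2 (2 ^ (4 + (entries + r + 3) + (k + 1) * 4))"
    by (subst log_le_cancel_iff) auto
  also have "\<dots> = real (4 + (entries + r + 3) + (k + 1) * 4)" by (rule log_pow_cancel) auto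
  finally have log: "log 2 (real (card Q)) \<le> real (4 + (entries + r + 3) + (k + 1) * 4)" .
  have "log 2 (real (card Q)) \<ge> 0" using \<open>card Q > 0\<close> by simp
  hence "log 2 (real (card Q)) / log 2 (real n) \<le> log 2 (real (card Q)) / 1"
    using L by (intro divide_left_mono) auto
  thus ?thesis using log unfolding storage_def machine_def by simp
qed

end

text \<open>Rounding can lower the half length by 1 against (d / 2) log n, which doubles the
  8.\<close>

lemma prob_bound:
  assumes "d > 0" "n \<ge> 2" "has_density d n k"
  shows "8 * (real n)\<^sup>2 / 2 ^ half k \<le> 16 * real n powr (2 - d / 2)"
proof -
  have "real n powr (d / 2) / 2 = 2 powr (d / 2 * log 2 (real n) - 1)"
    by (simp only: powr_diff two_powr_log[OF assms(2)]) simp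
  also have "\<dots> \<le> 2 powr real (half k)"
    using has_density_bounds(2)[OF assms] by simp
  also have "\<dots> = 2 ^ half k" by (rule powr_realpow) simp
  finally have "real n powr (d / 2) / 2 \<le> 2 ^ half k" .
  hence "8 * (real n)\<^sup>2 / 2 ^ half k \<le> 8 * (real n)\<^sup>2 / (real n powr (d / 2) / 2)"
    using assms(2) by (intro divide_left_mono) auto
  also have "\<dots> = 16 * (real n powr 2 / real n powr (d / 2))"
    using assms(2) by (simp add: powr_numeral)
  also have "\<dots> = 16 * real n powr (2 - d / 2)" by (simp add: powr_diff)
  finally show ?thesis .
qed

lemma prob_bound_tendsto:
  assumes "d > (4::real)"
  shows "(\<lambda>n. 16 * real n powr (2 - d / 2)) \<longlonglongrightarrow> 0"
proof -
  have "(\<lambda>n. real n powr (2 - d / 2)) \<longlonglongrightarrow> 0"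
    using assms by (intro tendsto_neg_powr filterlim_real_sequentially) auto
  from tendsto_mult_left[OF this, of 16] show ?thesis by simp
qed

lemma subproducts_in_carrier:
  assumes "group G" "set S \<subseteq> carrier G" "z \<in> subproducts G S"
  shows "z \<in> carrier G"
proof -
  from assms(3) obtain I where "z = gprod G (nths S I)" unfolding subproducts_def by blast
  thus ?thesis using group.gprod_closed[OF assms(1)] assms(2) set_nths_subset[of S I] by blast
qed

theorem mainTheorem2:
  fixes d \<epsilon> :: real
  assumes "d > 4" and "\<epsilon> > 0"
  shows "\<exists>K > 0. \<exists>M :: nat \<Rightarrow> nat \<Rightarrow> machine.
    (\<forall>n k. n \<ge> 2 \<and> has_density d n k \<longrightarrow>
       well_formed k (M n k) \<and>
       storage n (M n k) \<le> K * real n powr \<epsilon> \<and>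
       (\<forall>G :: 'a monoid. group G \<and> finite (carrier G) \<and> order G = n \<longrightarrow>
          implements_pollard G k (M n k))) \<and>
    (\<forall>\<delta> > 0. \<exists>N. \<forall>n \<ge> N. \<forall>k. \<forall>G :: 'a monoid.
       has_density d n k \<and> group G \<and> finite (carrier G) \<and> order G = n \<longrightarrow>
       measure_pmf.prob (random_sequence G k)
         {S. \<forall>z \<in> subproducts G S.
               finds_short_product G (M n k) S z \<and>
               expected_time G (M n k) S z \<le> ennreal (K * sqrt (real n))} \<ge> 1 - \<delta>)"
proof -
  \<comment> \<open>The cap at 1/2 keeps the work for the table within O(sqrt n) operations even for
    large \<open>\<epsilon>\<close>.\<close>
  define \<epsilon>' where "\<epsilon>' = min \<epsilon> (1 / 2)"
  have \<epsilon>': "\<epsilon>' > 0" "\<epsilon>' \<le> \<epsilon>" "\<epsilon>' \<le> 1 / 2" using assms by (auto simp: \<epsilon>'_def)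
  define r where "r = nat \<lceil>(d + 1) / \<epsilon>'\<rceil>"
  have pos: "(d + 1) / \<epsilon>' > 0" using assms \<epsilon>' by simp
  have "real r \<ge> (d + 1) / \<epsilon>'" unfolding r_def by linarith
  hence r: "d + 1 \<le> \<epsilon>' * real r" using \<epsilon>' by (simp add: field_simps)
  have r_pos: "r > 0" using pos unfolding r_def by simp
  have tm: "table_machine r" using r_pos by unfold_locales
  \<comment> \<open>From ln n \<le> n powr \<epsilon> / \<epsilon>: the \<open>k\<close> input
    registers number at most \<open>c * n powr \<epsilon>\<close>.\<close>
  define c where "c = (d + 1) / (\<epsilon> * ln 2)"
  have c: "c > 0" using assms by (simp add: c_def)
  \<comment> \<open>The storage constant plus, in parentheses, the time constant, so that one
    \<open>K\<close> serves both bounds.\<close>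
  define K where "K = 5 * c + 6 * real r + 18 + (2 * real r + 12 * (25 * real (r + 3) + 2))"
  let ?M = "\<lambda>n k. table_machine.machine k r"
  have K: "K > 0" unfolding K_def using c by (intro add_pos_nonneg) auto
  have entries: "real (table_machine.entries k r) \<le> 2 * real r * real n powr \<epsilon>'"
    if "n \<ge> 2" "has_density d n k" for n k
    using assms(1) that
    by (intro table_machine.entries_bound[OF tm that(1) has_density_bounds(1) r]) auto
  have store: "storage n (?M n k) \<le> K * real n powr \<epsilon>" if n: "n \<ge> 2" and k: "has_density d n k" for n k
  proof -
    let ?x = "real n powr \<epsilon>"
    have one: "1 \<le> ?x" using n assms(2) by (intro ge_one_powr_ge_zero) auto
    have "real (table_machine.entries k r) \<le> 2 * real r * real n powr \<epsilon>'" by (rule entries[OF n k])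
    also have "\<dots> \<le> 2 * real r * ?x" using n \<epsilon>' by (intro mult_left_mono powr_mono) auto
    finally have e: "real (table_machine.entries k r) \<le> 2 * real r * ?x" .
    have "log 2 (real n) = ln (real n) / ln 2" by (simp add: log_def)
    also have "\<dots> \<le> (?x / \<epsilon>) / ln 2"
      using ln_powr_bound[of "real n" \<epsilon>] n assms(2) by (intro divide_right_mono) auto
    finally have "(d + 1) * log 2 (real n) \<le> (d + 1) * ((?x / \<epsilon>) / ln 2)"
      using assms(1) by (intro mult_left_mono) auto
    also have "\<dots> = c * ?x" by (simp add: c_def)
    finally have "real k \<le> c * ?x"
      using has_density_bounds(1)[OF _ n k] assms(1) by simp
    hence "storage n (?M n k) \<le> 5 * (c * ?x) + 2 * (2 * real r * ?x) + 2 * real r + 18"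
      using table_machine.storage_bound[OF tm n, of k] e by linarith
    also have "\<dots> \<le> 5 * (c * ?x) + 2 * (2 * real r * ?x) + 2 * real r * ?x + 18 * ?x"
    proof -
      have "2 * real r * 1 \<le> 2 * real r * ?x" using one by (intro mult_left_mono) auto
      thus ?thesis using one by linarith
    qed
    also have "\<dots> = (5 * c + 6 * real r + 18) * ?x" by (simp add: algebra_simps)
    also have "\<dots> \<le> K * ?x" unfolding K_def by (intro mult_right_mono) auto
    finally show ?thesis .
  qed
  have fast: "finds_short_product G (?M n k) S z \<and> expected_time G (?M n k) S z \<le> ennreal (K * sqrt (real n))"
    if n: "n \<ge> 2" and k: "has_density d n k" and G: "group G" "finite (carrier G)" "order G = n"
      and S: "finite_group.balanced_halves G S" "length S = k" and z: "z \<in> subproducts G S"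
    for n k S z and G :: "'a monoid"
  proof -
    have fg: "finite_group G" using G by (simp add: finite_group_def finite_group_axioms_def)
    have "set S \<subseteq> carrier G" using S(1) finite_group.balanced_halves_def[OF fg] by blast
    hence zG: "z \<in> carrier G" using subproducts_in_carrier[OF G(1) _ z] by blast
    interpret balanced_input k r G S z
      using tm fg S zG by (intro balanced_input.intro balanced_input_axioms.intro) auto
    let ?s = "sqrt (real n)"
    have s: "1 \<le> ?s" using n by simp
    have "real entries \<le> 2 * real r * real n powr \<epsilon>'" by (rule entries[OF n k])
    also have "real n powr \<epsilon>' \<le> real n powr (1 / 2)" using n \<epsilon>' by (intro powr_mono) auto
    hence "2 * real r * real n powr \<epsilon>' \<le> 2 * real r * ?s"
      by (intro mult_left_mono) (auto simp: powr_half_sqrt)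
    finally have e: "real entries \<le> 2 * real r * ?s" .
    have "5 * real (r + 3) * (3 * ?s + 2) + 2 \<le> 5 * real (r + 3) * (5 * ?s) + 2 * ?s"
      using s by (intro add_mono mult_left_mono) auto
    also have "\<dots> = (25 * real (r + 3) + 2) * ?s" by (simp add: algebra_simps)
    finally have "12 * (5 * real (r + 3) * (3 * ?s + 2) + 2) \<le> 12 * ((25 * real (r + 3) + 2) * ?s)"
      by (rule mult_left_mono) simp
    hence "real entries + 12 * (5 * real (r + 3) * (3 * ?s + 2) + 2) \<le>
        2 * real r * ?s + 12 * ((25 * real (r + 3) + 2) * ?s)" by (rule add_mono[OF e])
    also have "\<dots> = (2 * real r + 12 * (25 * real (r + 3) + 2)) * ?s" by (simp add: algebra_simps)
    also have "\<dots> \<le> K * ?s" unfolding K_def using c by (intro mult_right_mono) auto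
    finally have "expected_time G machine S z \<le> ennreal (K * ?s)"
      using expected_time_bound unfolding G(3) by (meson ennreal_leI order_trans)
    thus ?thesis using finds by blast
  qed
  have likely: "\<exists>N. \<forall>n \<ge> N. \<forall>k. \<forall>G :: 'a monoid.
       has_density d n k \<and> group G \<and> finite (carrier G) \<and> order G = n \<longrightarrow>
       measure_pmf.prob (random_sequence G k)
         {S. \<forall>z \<in> subproducts G S.
               finds_short_product G (?M n k) S z \<and>
               expected_time G (?M n k) S z \<le> ennreal (K * sqrt (real n))} \<ge> 1 - \<delta>"
    if \<delta>: "\<delta> > 0" for \<delta>
  proof -
    have "\<forall>\<^sub>F n in sequentially. 16 * real n powr (2 - d / 2) < \<delta>"
      using order_tendstoD(2)[OF prob_bound_tendsto[OF assms(1)] \<delta>] .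
    then obtain N where N: "\<And>n. n \<ge> N \<Longrightarrow> 16 * real n powr (2 - d / 2) < \<delta>"
      unfolding eventually_sequentially by blast
    show ?thesis
    proof (intro exI[of _ "max N 2"] allI impI)
      fix n k and G :: "'a monoid"
      assume "max N 2 \<le> n" and *: "has_density d n k \<and> group G \<and> finite (carrier G) \<and> order G = n"
      hence n: "n \<ge> 2" "n \<ge> N" and k: "has_density d n k"
        and G: "group G" "finite (carrier G)" "order G = n" by auto
      interpret finite_group G using G by (simp add: finite_group_def finite_group_axioms_def)
      have "1 - \<delta> \<le> 1 - 8 * (real (order G))\<^sup>2 / 2 ^ half k"
        using prob_bound[OF _ n(1) k] assms(1) N[OF n(2)] unfolding G(3) by linarith
      also have "\<dots> \<le> measure_pmf.prob (random_sequence G k) {S. balanced_halves S \<and> length S = k}"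
        by (rule prob_balanced_halves)
      also have "\<dots> \<le> measure_pmf.prob (random_sequence G k)
         {S. \<forall>z \<in> subproducts G S.
               finds_short_product G (?M n k) S z \<and>
               expected_time G (?M n k) S z \<le> ennreal (K * sqrt (real n))}"
        using fast[OF n(1) k G] by (intro measure_pmf.finite_measure_mono) auto
      finally show "1 - \<delta> \<le> measure_pmf.prob (random_sequence G k)
         {S. \<forall>z \<in> subproducts G S.
               finds_short_product G (?M n k) S z \<and>
               expected_time G (?M n k) S z \<le> ennreal (K * sqrt (real n))}" .
    qed
  qed
  show ?thesis
  proof (intro exI[of _ K] exI[of _ ?M] conjI allI impI)
    show "K > 0" by (rule K)
    fix n k assume "2 \<le> n \<and> has_density d n k"
    thus "storage n (?M n k) \<le> K * real n powr \<epsilon>" using store by blast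
    show "well_formed k (?M n k)" by (rule table_machine.well_formed_machine[OF tm])
    fix G :: "'a monoid" assume "group G \<and> finite (carrier G) \<and> order G = n"
    thus "implements_pollard G k (?M n k)"
      using table_machine.machine_implements_pollard[OF tm] by blast
  qed (use likely in blast)
qed

end
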